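(* A pre-proof net with cuts is sequentializable if and only if it is correct, i.e., it is a proof net with cuts.
   Context: Write ⅋ for par and $\odot$ for the cut connective. MLL formulas over atoms: $\mathcal A\mid\mathcal A^\perp\mid\mathsf1\mid\bot\mid F\otimes F\mid F⅋F$, with negation $a^{\perp\perp}=a$, $\mathsf1^\perp=\bot$, $\bot^\perp=\mathsf1$, $(A\otimes B)^\perp=B^\perp⅋A^\perp$, $(A⅋B)^\perp=B^\perp\otimes A^\perp$. Linkings: $\mathsf1\mid a\otimes a^\perp\mid a^\perp\otimes a\mid\bot\otimes L\mid L\otimes\bot\mid L⅋L$. A cut is a formula $A\odot A^\perp$; a sequent with cuts may contain cuts only as roots. A pre-proof graph with cuts is a linking tree $P$ and a sequent with cuts $\Gamma$ sharing the same leaves. A switching deletes at each ⅋-node one child edge ($\odot$-nodes behave like $\otimes$-nodes); correct means every switching is connected and acyclic. Pre-proof nets are classes under the equivalence $\sim$ generated by commutativity/associativity of ⅋ in the linking, commutativity of $\otimes$, $\bot_i\otimes(Q\otimes\bot_j)\sim(\bot_i\otimes Q)\otimes\bot_j$, and $Q⅋(R\otimes\bot_i)\sim(Q⅋R)\otimes\bot_i$ provided no node of $Q$ is connected to $\bot_i$ in any switching with the edge from $\bot_i$ to its parent also removed. Sequent proofs (with rules id, exchange, $\mathsf1$, $\bot$, ⅋, $\otimes$, cut) translate into pre-proof graphs: id $\mapsto\langle a\otimes a^\perp\mid a,a^\perp\rangle$; $\mathsf1\mapsto\langle\mathsf1\mid\mathsf1\rangle$; $\bot$: $\langle P\mid\Gamma\rangle\mapsto\langle\bot\otimes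 P\mid\bot,\Gamma\rangle$; ⅋: $\langle P\mid A,B,\Gamma\rangle\mapsto\langle P\mid A⅋B,\Gamma\rangle$; $\otimes$: from $\langle P\mid\Gamma,A\rangle,\langle Q\mid B,\Delta\rangle$ to $\langle P⅋Q\mid\Gamma,A\otimes B,\Delta\rangle$; cut: from $\langle P\mid\Gamma,A\rangle,\langle Q\mid A^\perp,\Delta\rangle$ to $\langle P⅋Q\mid\Gamma,A\odot A^\perp,\Delta\rangle$. Sequentializable means some representative arises this way. *)

theory Defs
  imports Main "HOL-Library.Multiset"
begin

text \<open>Leaf labels: an atom a, a negated atom a^perp, the unit 1, or bottom.\<close>
datatype 'a lab = LA 'a | LNA 'a | L1 | LB

text \<open>Trees whose leaves carry a label and a leaf identifier (nat); inner
  nodes are tensor (Tn) or par (Pr).  Every such tree is an MLL formula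
  (with identified leaf occurrences); linkings are the trees satisfying
  is_linking below.\<close>
datatype 'a tree = Lf "'a lab" nat | Tn "'a tree" "'a tree" | Pr "'a tree" "'a tree"

text \<open>Roots of a sequent with cuts: a formula, or a cut A (cut) B.\<close>
datatype 'a root = RF "'a tree" | RC "'a tree" "'a tree"

fun neglab :: "'a lab \<Rightarrow> 'a lab" where
  "neglab (LA a) = LNA a"
| "neglab (LNA a) = LA a"
| "neglab L1 = LB"
| "neglab LB = L1"

text \<open>is_dual A B: B is the negation of A (leaf identifiers ignored):
  (A tensor B)^perp = B^perp par A^perp, (A par B)^perp = B^perp tensor A^perp.\<close>
fun is_dual :: "'a tree \<Rightarrow> 'a tree \<Rightarrow> bool" where
  "is_dual (Lf l m) (Lf l' n) = (l' = neglab l)"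
| "is_dual (Tn a b) (Pr c d) = (is_dual b c \<and> is_dual a d)"
| "is_dual (Pr a b) (Tn c d) = (is_dual b c \<and> is_dual a d)"
| "is_dual _ _ = False"

inductive is_linking :: "'a tree \<Rightarrow> bool" where
  lk_one: "is_linking (Lf L1 n)"
| lk_ax1: "is_linking (Tn (Lf (LA a) m) (Lf (LNA a) n))"
| lk_ax2: "is_linking (Tn (Lf (LNA a) m) (Lf (LA a) n))"
| lk_botl: "is_linking L \<Longrightarrow> is_linking (Tn (Lf LB n) L)"
| lk_botr: "is_linking L \<Longrightarrow> is_linking (Tn L (Lf LB n))"
| lk_par: "is_linking L \<Longrightarrow> is_linking M \<Longrightarrow> is_linking (Pr L M)"

fun leaves :: "'a tree \<Rightarrow> ('a lab \<times> nat) list" where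
  "leaves (Lf l n) = [(l, n)]"
| "leaves (Tn a b) = leaves a @ leaves b"
| "leaves (Pr a b) = leaves a @ leaves b"

fun rleaves :: "'a root \<Rightarrow> ('a lab \<times> nat) list" where
  "rleaves (RF A) = leaves A"
| "rleaves (RC A B) = leaves A @ leaves B"

definition ids :: "'a tree \<Rightarrow> nat set" where
  "ids t = snd ` set (leaves t)"

definition seq_leaves :: "'a root list \<Rightarrow> ('a lab \<times> nat) list" where
  "seq_leaves \<Gamma> = concat (map rleaves \<Gamma>)"

definition pre_proof_graph :: "'a tree \<Rightarrow> 'a root list \<Rightarrow> bool" where
  "pre_proof_graph P \<Gamma> \<longleftrightarrow>
     is_linking P \<and>
     (\<forall>r\<in>set \<Gamma>. case r of RC A B \<Rightarrow> is_dual A B | RF A \<Rightarrow> True) \<and>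
     distinct (map snd (leaves P)) \<and>
     distinct (map snd (seq_leaves \<Gamma>)) \<and>
     set (leaves P) = set (seq_leaves \<Gamma>)"

text \<open>Vertices: shared leaves (by identifier), inner nodes of the linking
  (by path), inner nodes of the i-th root of Gamma (by path; for a cut root,
  path [] is the cut node).\<close>
datatype vert = VL nat | VP "bool list" | VG nat "bool list"

text \<open>Edges (child, parent, side, parent_is_par): side = True means the
  right child edge.\<close>
type_synonym edge = "vert \<times> vert \<times> bool \<times> bool"

fun vtx :: "(bool list \<Rightarrow> vert) \<Rightarrow> bool list \<Rightarrow> 'a tree \<Rightarrow> vert" where
  "vtx f p (Lf l n) = VL n"
| "vtx f p (Tn a b) = f p"
| "vtx f p (Pr a b) = f p"

fun tverts :: "(bool list \<Rightarrow> vert) \<Rightarrow> bool list \<Rightarrow> 'a tree \<Rightarrow> vert set" where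
  "tverts f p (Lf l n) = {VL n}"
| "tverts f p (Tn a b) = insert (f p) (tverts f (p @ [False]) a \<union> tverts f (p @ [True]) b)"
| "tverts f p (Pr a b) = insert (f p) (tverts f (p @ [False]) a \<union> tverts f (p @ [True]) b)"

fun tedges :: "(bool list \<Rightarrow> vert) \<Rightarrow> bool list \<Rightarrow> 'a tree \<Rightarrow> edge set" where
  "tedges f p (Lf l n) = {}"
| "tedges f p (Tn a b) =
     {(vtx f (p @ [False]) a, f p, False, False), (vtx f (p @ [True]) b, f p, True, False)}
     \<union> tedges f (p @ [False]) a \<union> tedges f (p @ [True]) b"
| "tedges f p (Pr a b) =
     {(vtx f (p @ [False]) a, f p, False, True), (vtx f (p @ [True]) b, f p, True, True)}
     \<union> tedges f (p @ [False]) a \<union> tedges f (p @ [True]) b"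

fun rverts :: "nat \<Rightarrow> 'a root \<Rightarrow> vert set" where
  "rverts i (RF A) = tverts (VG i) [] A"
| "rverts i (RC A B) = insert (VG i []) (tverts (VG i) [False] A \<union> tverts (VG i) [True] B)"

text \<open>Cut nodes behave like tensor nodes (flag False).\<close>
fun redges :: "nat \<Rightarrow> 'a root \<Rightarrow> edge set" where
  "redges i (RF A) = tedges (VG i) [] A"
| "redges i (RC A B) =
     {(vtx (VG i) [False] A, VG i [], False, False), (vtx (VG i) [True] B, VG i [], True, False)}
     \<union> tedges (VG i) [False] A \<union> tedges (VG i) [True] B"

definition graph_verts :: "'a tree \<Rightarrow> 'a root list \<Rightarrow> vert set" where
  "graph_verts P \<Gamma> = tverts VP [] P \<union> (\<Union>i<length \<Gamma>. rverts i (\<Gamma> ! i))"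

definition graph_edges :: "'a tree \<Rightarrow> 'a root list \<Rightarrow> edge set" where
  "graph_edges P \<Gamma> = tedges VP [] P \<union> (\<Union>i<length \<Gamma>. redges i (\<Gamma> ! i))"

text \<open>A switching s chooses, at each par node v, the child edge to keep
  (s v = side kept); the other child edge is deleted.\<close>
definition switched :: "edge set \<Rightarrow> (vert \<Rightarrow> bool) \<Rightarrow> edge set" where
  "switched E s = {(u, v, d, k) \<in> E. \<not> k \<or> s v = d}"

definition adj :: "edge set \<Rightarrow> vert \<Rightarrow> vert \<Rightarrow> bool" where
  "adj E u v \<longleftrightarrow> (\<exists>d k. (u, v, d, k) \<in> E \<or> (v, u, d, k) \<in> E)"

definition connected_graph :: "vert set \<Rightarrow> edge set \<Rightarrow> bool" where
  "connected_graph V E \<longleftrightarrow> (\<forall>u\<in>V. \<forall>v\<in>V. (adj E)\<^sup>*\<^sup>* u v)"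

definition acyclic_graph :: "vert set \<Rightarrow> edge set \<Rightarrow> bool" where
  "acyclic_graph V E \<longleftrightarrow>
     \<not> (\<exists>vs. length vs \<ge> 3 \<and> distinct vs \<and> set vs \<subseteq> V \<and>
            (\<forall>i. Suc i < length vs \<longrightarrow> adj E (vs ! i) (vs ! Suc i)) \<and>
            adj E (last vs) (hd vs))"

definition correct :: "'a tree \<Rightarrow> 'a root list \<Rightarrow> bool" where
  "correct P \<Gamma> \<longleftrightarrow>
     (\<forall>s. connected_graph (graph_verts P \<Gamma>) (switched (graph_edges P \<Gamma>) s) \<and>
          acyclic_graph (graph_verts P \<Gamma>) (switched (graph_edges P \<Gamma>) s))"

fun subt :: "'a tree \<Rightarrow> bool list \<Rightarrow> 'a tree option" where
  "subt t [] = Some t"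
| "subt (Tn a b) (d # p) = (if d then subt b p else subt a p)"
| "subt (Pr a b) (d # p) = (if d then subt b p else subt a p)"
| "subt (Lf l n) (d # p) = None"

fun repl :: "'a tree \<Rightarrow> bool list \<Rightarrow> 'a tree \<Rightarrow> 'a tree" where
  "repl t [] u = u"
| "repl (Tn a b) (d # p) u = (if d then Tn a (repl b p u) else Tn (repl a p u) b)"
| "repl (Pr a b) (d # p) u = (if d then Pr a (repl b p u) else Pr (repl a p u) b)"
| "repl (Lf l n) (d # p) u = Lf l n"

inductive lrw :: "'a tree \<Rightarrow> 'a tree \<Rightarrow> bool" where
  par_comm: "lrw (Pr Q R) (Pr R Q)"
| par_assoc: "lrw (Pr (Pr Q R) S) (Pr Q (Pr R S))"
| tens_comm: "lrw (Tn Q R) (Tn R Q)"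
| bot_assoc: "lrw (Tn (Lf LB i) (Tn Q (Lf LB j))) (Tn (Tn (Lf LB i) Q) (Lf LB j))"

text \<open>Side condition for Q par (R tensor bot_i) ~ (Q par R) tensor bot_i, where
  the left-hand side sits at position p of the linking P: no node of Q is
  connected to bot_i in any switching of the graph of (P, Gamma) in which the
  edge from bot_i to its parent (in the linking) is also removed.\<close>
definition bot_cond :: "'a root list \<Rightarrow> 'a tree \<Rightarrow> bool list \<Rightarrow> 'a tree \<Rightarrow> nat \<Rightarrow> bool" where
  "bot_cond \<Gamma> P p Q i \<longleftrightarrow>
     (\<forall>s. \<forall>x\<in>tverts VP (p @ [False]) Q.
        \<not> (adj (switched (graph_edges P \<Gamma> - {(VL i, VP (p @ [True]), True, False)}) s))\<^sup>*\<^sup>* x (VL i))"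

definition eq_step :: "'a root list \<Rightarrow> 'a tree \<Rightarrow> 'a tree \<Rightarrow> bool" where
  "eq_step \<Gamma> P P' \<longleftrightarrow>
     (\<exists>p t u. subt P p = Some t \<and> P' = repl P p u \<and>
        (lrw t u \<or>
         (\<exists>Q R i. t = Pr Q (Tn R (Lf LB i)) \<and> u = Tn (Pr Q R) (Lf LB i) \<and> bot_cond \<Gamma> P p Q i)))"

definition lk_equiv :: "'a root list \<Rightarrow> 'a tree \<Rightarrow> 'a tree \<Rightarrow> bool" where
  "lk_equiv \<Gamma> = (\<lambda>P P'. eq_step \<Gamma> P P' \<or> eq_step \<Gamma> P' P)\<^sup>*\<^sup>*"

text \<open>seqz P Gamma: the pre-proof graph (P, Gamma) is the translation of some
  sequent proof (with fresh leaves; identifiers are arbitrary).\<close>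
inductive seqz :: "'a tree \<Rightarrow> 'a root list \<Rightarrow> bool" where
  sq_id: "m \<noteq> n \<Longrightarrow> seqz (Tn (Lf (LA (a::'a)) m) (Lf (LNA a) n)) [RF (Lf (LA a) m), RF (Lf (LNA a) n)]"
| sq_exch: "seqz P \<Gamma> \<Longrightarrow> mset \<Gamma>' = mset \<Gamma> \<Longrightarrow> seqz P \<Gamma>'"
| sq_one: "seqz (Lf L1 n :: 'a tree) [RF (Lf L1 n)]"
| sq_bot: "seqz P \<Gamma> \<Longrightarrow> n \<notin> ids P \<Longrightarrow> seqz (Tn (Lf LB n) P) (RF (Lf LB n) # \<Gamma>)"
| sq_par: "seqz P (RF A # RF B # \<Gamma>) \<Longrightarrow> seqz P (RF (Pr A B) # \<Gamma>)"
| sq_tens: "seqz P (\<Gamma> @ [RF A]) \<Longrightarrow> seqz Q (RF B # \<Delta>) \<Longrightarrow> ids P \<inter> ids Q = {} \<Longrightarrow>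
            seqz (Pr P Q) (\<Gamma> @ [RF (Tn A B)] @ \<Delta>)"
| sq_cut: "seqz P (\<Gamma> @ [RF A]) \<Longrightarrow> seqz Q (RF B # \<Delta>) \<Longrightarrow> is_dual A B \<Longrightarrow> ids P \<inter> ids Q = {} \<Longrightarrow>
            seqz (Pr P Q) (\<Gamma> @ [RC A B] @ \<Delta>)"

definition sequentializable :: "'a tree \<Rightarrow> 'a root list \<Rightarrow> bool" where
  "sequentializable P \<Gamma> \<longleftrightarrow> (\<exists>P'. lk_equiv \<Gamma> P P' \<and> seqz P' \<Gamma>)"

end

theory Submission
  imports Defs
begin

text \<open>A leaf set S is read as a 2-colouring of the leaves. In a switched graph it is a union of
  connected components on leaves iff every tensor (or cut) node has equally coloured subtrees,
  where a par node takes the colour of the premise that is kept. Hence "every switching is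
  connected" means that only trivial colourings extend to the whole graph, and, given
  connectedness, acyclicity amounts to the counting identity
  "number of leaves = number of tensors and cuts + 1".

  In a correct graph a bottom attached to a par node of the linking can always be moved to either
  premise of that par, and the side condition on moving it back out says precisely that the
  result is correct. So all bottoms can be gathered at the axioms, and the linking becomes a par
  of clusters. A sequent whose roots are all tensors, cuts or leaves is then split at a tensor
  A * B whose empire (the least leaf set containing A that is closed under clusters and under all
  other tensors) is maximal.\<close>

section \<open>Graphs and closed vertex sets\<close>

text \<open>A bottom step is guarded by a condition on the whole graph, so an equivalence proved for
  a subnet need not survive in a larger sequent. Inward moves of bottoms escape this: they keep
  correct graphs correct, and correctness before the move yields the condition for undoing it. All
  rewriting is therefore done by inward moves between correct graphs, which pass through every
  context. A bottom is extracted against this direction, by exhibiting the graph from which inward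
  moves lead to the given one.

  Switchings choose by position, and rewriting changes positions. Hence a tree is replaced by the
  set of all pairs (leaf standing for the root, links between leaves) that its switchings produce.

  Empires need leaf sets stable under intersection. The reading that puts a par inside a set when
  both premises are inside has this property; that it can still separate the premises of a tensor
  root is the hard point, settled by a minimal choice over all switchings.

  The count also yields acyclicity of the two halves: connectedness bounds the leaves of each, and
  the bounds add up to the known total.\<close>

definition resp :: "'v set \<Rightarrow> ('v \<times> 'v) set \<Rightarrow> bool" where
  "resp S E \<longleftrightarrow> (\<forall>(x, y)\<in>E. x \<in> S \<longleftrightarrow> y \<in> S)"

definition con :: "'v set \<Rightarrow> ('v \<times> 'v) set \<Rightarrow> bool" where
  "con V E \<longleftrightarrow> (\<forall>S. resp S E \<longrightarrow> V \<inter> S = {} \<or> V \<subseteq> S)"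

lemma resp_simps [simp]:
  "resp S {}"
  "resp S (insert (x, y) E) \<longleftrightarrow> (x \<in> S \<longleftrightarrow> y \<in> S) \<and> resp S E"
  "resp S (E \<union> F) \<longleftrightarrow> resp S E \<and> resp S F"
  by (auto simp: resp_def)

lemma resp_UN: "resp S (\<Union>i\<in>I. E i) \<longleftrightarrow> (\<forall>i\<in>I. resp S (E i))"
  by (auto simp: resp_def)

lemma resp_mono: "resp S F \<Longrightarrow> E \<subseteq> F \<Longrightarrow> resp S E"
  by (auto simp: resp_def)

lemma resp_Compl: "resp S E \<Longrightarrow> resp (- S) E"
  by (auto simp: resp_def)

lemma resp_Int: "resp S E \<Longrightarrow> resp S' E \<Longrightarrow> resp (S \<inter> S') E"
  by (auto simp: resp_def)

lemma resp_Diff: "resp S E \<Longrightarrow> resp S' E \<Longrightarrow> resp (S - S') E"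
  by (auto simp: resp_def)

lemma resp_Inter: "(\<And>S. S \<in> \<S> \<Longrightarrow> resp S E) \<Longrightarrow> resp (\<Inter>\<S>) E"
  by (fastforce simp: resp_def)

lemma resp_vimage: "resp S (map_prod f f ` E) \<longleftrightarrow> resp (f -` S) E"
  by (force simp: resp_def)

text \<open>Contraction of the edge from \<open>x\<close> to \<open>y\<close>, the induction step of
  both counting lemmas.\<close>

definition merge :: "'v \<Rightarrow> 'v \<Rightarrow> 'v \<Rightarrow> 'v" where
  "merge x y z = (if z = y then x else z)"

lemma resp_merge:
  assumes "(x, y) \<in> E" "resp S (map_prod (merge x y) (merge x y) ` (E - {(x, y)}))"
  shows "resp (merge x y -` S) E"
proof -
  have "resp (merge x y -` S) (E - {(x, y)})"
    using assms(2) by (simp add: resp_vimage)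
  moreover have "E = insert (x, y) (E - {(x, y)})" using assms(1) by blast
  moreover have "merge x y x = merge x y y" by (simp add: merge_def)
  ultimately show ?thesis by (metis resp_simps(2) vimage_eq)
qed

text \<open>Contracting an edge preserves connectedness, removes at least one edge and at most one
  vertex. Without edges every singleton is closed, so at most one vertex remains.\<close>

lemma con_card:
  assumes "finite E" "finite V" "con V E"
  shows "card V \<le> card E + 1"
  using assms
proof (induction "card E" arbitrary: E V rule: less_induct)
  case less
  show ?case
  proof (cases "E = {}")
    case True
    with \<open>con V E\<close> have "V \<subseteq> {v}" if "v \<in> V" for v
      using that by (auto simp: con_def dest: spec[of _ "{v}"])
    then have "\<exists>v. V \<subseteq> {v}" by blast
    then obtain v where "V \<subseteq> {v}" ..
    then show ?thesis using card_mono[of "{v}" V] by simp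
  next
    case False
    then obtain x y where xy: "(x, y) \<in> E" by auto
    define E' where "E' = map_prod (merge x y) (merge x y) ` (E - {(x, y)})"
    define V' where "V' = merge x y ` V"
    have "card (E - {(x, y)}) < card E" using less.prems xy by (meson card_Diff1_less)
    moreover have "card E' \<le> card (E - {(x, y)})"
      unfolding E'_def using less.prems(1) by (intro card_image_le) simp
    ultimately have cE': "card E' < card E" by simp
    have fin: "finite E'" "finite V'" using less.prems by (auto simp: E'_def V'_def)
    have "con V' E'"
      unfolding con_def
    proof (intro allI impI)
      fix S assume "resp S E'"
      then have "resp (merge x y -` S) E"
        unfolding E'_def by (rule resp_merge[OF xy])
      then have "V \<inter> merge x y -` S = {} \<or> V \<subseteq> merge x y -` S"
        using less.prems by (simp add: con_def)
      then show "V' \<inter> S = {} \<or> V' \<subseteq> S" by (auto simp: V'_def)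
    qed
    then have "card V' \<le> card E' + 1" using less.hyps[OF cE'] fin by simp
    moreover have "V \<subseteq> insert y V'" by (auto simp: V'_def merge_def image_iff)
    then have "card V \<le> card (insert y V')" using fin(2) by (intro card_mono) auto
    then have "card V \<le> Suc (card V')" using fin(2) by (simp add: card_insert_if split: if_splits)
    ultimately show ?thesis using cE' by simp
  qed
qed

text \<open>The last hypothesis says that every edge is a bridge: some set becomes closed only when
  that edge is removed. Contracting a bridge removes exactly one vertex and one edge, and the other
  edges remain bridges.\<close>

lemma bridges_card:
  assumes "finite E" "finite V" "V \<noteq> {}" "E \<subseteq> V \<times> V"
    and "\<And>x y. (x, y) \<in> E \<Longrightarrow> \<exists>S. resp S (E - {(x, y)}) \<and> \<not> resp S E"
  shows "card E + 1 \<le> card V"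
  using assms
proof (induction "card E" arbitrary: E V rule: less_induct)
  case less
  show ?case
  proof (cases "E = {}")
    case True
    then show ?thesis using less.prems by (simp add: Suc_leI card_gt_0_iff)
  next
    case False
    then obtain x y where xy: "(x, y) \<in> E" by auto
    let ?m = "map_prod (merge x y) (merge x y)"
    define E' where "E' = ?m ` (E - {(x, y)})"
    have bridge: "\<exists>S. resp S (E - {e}) \<and> \<not> resp S E" if "e \<in> E" for e
      using less.prems(5)[of "fst e" "snd e"] that by simp
    from bridge[OF xy] have "x \<noteq> y" by (auto simp: resp_def)
    have xyV: "x \<in> V" "y \<in> V" using xy less.prems(4) by auto
    \<comment> \<open>The contraction is invisible to a set that has \<open>x\<close> and
      \<open>y\<close> on the same side, so closedness transfers in both directions.\<close>
    have lift: "resp (merge x y -` S) F = resp S F" if "x \<in> S \<longleftrightarrow> y \<in> S" for S F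
    proof -
      have "merge x y -` S = S" using that by (auto simp: merge_def split: if_splits)
      then show ?thesis by simp
    qed
    \<comment> \<open>Edges identified by the contraction lie on a common cycle: if \<open>S\<close>
      is violated by \<open>e\<close> alone, then \<open>x\<close> and \<open>y\<close> agree and so
      do the ends of \<open>f\<close>, which forces the ends of \<open>e\<close> to agree.\<close>
    have inj: "inj_on ?m (E - {(x, y)})"
    proof (rule inj_onI, rule ccontr)
      fix e f assume ef: "e \<in> E - {(x, y)}" "f \<in> E - {(x, y)}" "?m e = ?m f" "e \<noteq> f"
      then obtain S where S: "resp S (E - {e})" "\<not> resp S E" using bridge[of e] by blast
      have xyS: "x \<in> S \<longleftrightarrow> y \<in> S" using S(1) xy ef by (auto simp: resp_def)
      have "resp S {f}" using S(1) ef by (auto simp: resp_def)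
      then have "resp S (?m ` {f})" using lift[OF xyS, of "{f}"] by (simp only: resp_vimage)
      then have "resp S (?m ` {e})" using ef by simp
      then have "resp S {e}" using lift[OF xyS, of "{e}"] by (simp only: resp_vimage)
      then have "resp S ((E - {e}) \<union> {e})" using S(1) by (auto simp: resp_def)
      then show False using S(2) ef by (simp add: insert_absorb)
    qed
    have cE: "card E' + 1 = card E"
      using card_image[OF inj] xy less.prems(1) by (simp add: E'_def card_Suc_Diff1 del: card_Diff_insert)
    have "card E' + 1 \<le> card (V - {y})"
    proof (rule less.hyps)
      show "card E' < card E" using cE by simp
      show "finite E'" "finite (V - {y})" using less.prems by (auto simp: E'_def)
      show "V - {y} \<noteq> {}" using xyV \<open>x \<noteq> y\<close> by auto
      show "E' \<subseteq> (V - {y}) \<times> (V - {y})"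
      proof -
        have "merge x y z \<in> V - {y}" if "z \<in> V" for z
          using that xyV \<open>x \<noteq> y\<close> by (simp add: merge_def)
        then show ?thesis using less.prems(4) unfolding E'_def by blast
      qed
    next
      fix u v assume "(u, v) \<in> E'"
      then obtain e where "(u, v) = ?m e" "e \<in> E - {(x, y)}" unfolding E'_def by (rule imageE)
      note e = this(2,1)
      obtain S where S: "resp S (E - {e})" "\<not> resp S E" using bridge e by blast
      have xyS: "x \<in> S \<longleftrightarrow> y \<in> S" using S(1) xy e by (auto simp: resp_def)
      have "?m ` (E - {(x, y)} - {e}) = ?m ` (E - {(x, y)}) - ?m ` {e}"
        by (rule inj_on_image_set_diff[OF inj]) (use e(1) in blast)+
      then have "E' - {(u, v)} = ?m ` (E - {(x, y)} - {e})"
        unfolding E'_def e(2) by simp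
      moreover have "resp S (E - {(x, y)} - {e})" using S(1) by (auto simp: resp_def)
      ultimately have "resp S (E' - {(u, v)})" using lift[OF xyS] by (simp only: resp_vimage)
      moreover have "\<not> resp S (E - {(x, y)})"
        using S(2) xyS by (auto simp: resp_def)
      then have "\<not> resp S E'" unfolding E'_def using lift[OF xyS] by (simp only: resp_vimage not_False_eq_True)
      ultimately show "\<exists>S. resp S (E' - {(u, v)}) \<and> \<not> resp S E'" by blast
    qed
    then show ?thesis using cE xyV less.prems(2) by simp
  qed
qed

section \<open>Forgetting edge labels; acyclicity as an edge count\<close>

definition epairs :: "edge set \<Rightarrow> (vert \<times> vert) set" where
  "epairs W = (\<lambda>(u, v, d, k). (u, v)) ` W"

lemma epairs_simps [simp]:
  "epairs {} = {}"
  "epairs (insert (u, v, d, k) W) = insert (u, v) (epairs W)"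
  "epairs (W \<union> W') = epairs W \<union> epairs W'"
  by (simp_all add: epairs_def image_Un)

lemma adj_epairs: "adj W u v \<longleftrightarrow> (u, v) \<in> epairs W \<or> (v, u) \<in> epairs W"
  by (force simp: adj_def epairs_def)

lemma adj_sym: "adj W u v \<Longrightarrow> adj W v u"
  by (auto simp: adj_def)

lemma reach_sym: "(adj W)\<^sup>*\<^sup>* u v \<Longrightarrow> (adj W)\<^sup>*\<^sup>* v u"
  by (rule sympD[OF symp_rtranclp]) (auto simp: symp_def adj_sym)

lemma resp_reach:
  assumes "resp S (epairs W)" "(adj W)\<^sup>*\<^sup>* u v" "u \<in> S"
  shows "v \<in> S"
  using assms(2,3,1) by (induction) (auto simp: adj_epairs resp_def)

lemma resp_component: "resp {v. (adj W)\<^sup>*\<^sup>* u v} (epairs W)"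
proof -
  have "(adj W)\<^sup>*\<^sup>* u x \<longleftrightarrow> (adj W)\<^sup>*\<^sup>* u y" if "(x, y) \<in> epairs W" for x y
  proof -
    have "adj W x y" "adj W y x" using that by (auto simp: adj_epairs)
    then show ?thesis by (meson rtranclp.rtrancl_into_rtrancl)
  qed
  then show ?thesis by (auto simp: resp_def)
qed

lemma connected_iff_con: "connected_graph V W \<longleftrightarrow> con V (epairs W)"
proof
  assume *: "connected_graph V W"
  show "con V (epairs W)"
    unfolding con_def
  proof (intro allI impI)
    fix S assume "resp S (epairs W)"
    then show "V \<inter> S = {} \<or> V \<subseteq> S"
      using * resp_reach by (auto simp: connected_graph_def) metis
  qed
next
  assume *: "con V (epairs W)"
  show "connected_graph V W"
    unfolding connected_graph_def
  proof (intro ballI)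
    fix u v assume "u \<in> V" "v \<in> V"
    then show "(adj W)\<^sup>*\<^sup>* u v"
      using * resp_component[of W u] by (auto simp: con_def)
  qed
qed

lemma rtranclp_distinct_path:
  assumes "r\<^sup>*\<^sup>* u v"
  shows "\<exists>vs. vs \<noteq> [] \<and> hd vs = u \<and> last vs = v \<and> distinct vs \<and>
    (\<forall>i. Suc i < length vs \<longrightarrow> r (vs ! i) (vs ! Suc i))"
  using assms
proof (induction)
  case base
  show ?case by (rule exI[of _ "[u]"]) simp
next
  case (step y z)
  then obtain vs where vs: "vs \<noteq> []" "hd vs = u" "last vs = y" "distinct vs"
    "\<forall>i. Suc i < length vs \<longrightarrow> r (vs ! i) (vs ! Suc i)" by blast
  show ?case
  proof (cases "z \<in> set vs")
    case True
    then obtain as bs where ab: "vs = as @ z # bs" by (meson split_list)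
    show ?thesis
    proof (intro exI[of _ "as @ [z]"] conjI allI impI)
      show "hd (as @ [z]) = u" using vs(2) ab by (cases as) auto
      show "distinct (as @ [z])" using vs(4) ab by auto
      fix i assume "Suc i < length (as @ [z])"
      then show "r ((as @ [z]) ! i) ((as @ [z]) ! Suc i)"
        using vs(5)[rule_format, of i] ab by (auto simp: nth_append split: if_splits)
    qed auto
  next
    case False
    show ?thesis
    proof (intro exI[of _ "vs @ [z]"] conjI allI impI)
      show "hd (vs @ [z]) = u" using vs by simp
      show "distinct (vs @ [z])" using vs False by simp
      fix i assume i: "Suc i < length (vs @ [z])"
      show "r ((vs @ [z]) ! i) ((vs @ [z]) ! Suc i)"
      proof (cases "Suc i < length vs")
        case True
        then show ?thesis using vs(5) by (simp add: nth_append)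
      next
        case False
        then have "Suc i = length vs" using i by simp
        then have "vs ! i = y" using vs(1,3) by (metis diff_Suc_1 last_conv_nth)
        then show ?thesis using \<open>Suc i = length vs\<close> step(2) by (simp add: nth_append)
      qed
    qed auto
  qed
qed

text \<open>In an acyclic graph every edge is a bridge, because a path around it would close to a
  cycle. Conversely, a cycle allows its closing edge to be dropped without losing connectedness,
  which leaves too few edges. \<open>acyclic_graph\<close> sees only cycles through at least three
  vertices; \<open>asym\<close> excludes loops and pairs of opposite edges.\<close>

lemma acyclic_iff_card:
  assumes fin: "finite V" "finite W" and ne: "V \<noteq> {}" and sub: "epairs W \<subseteq> V \<times> V"
    and asym: "\<And>u v. (u, v) \<in> epairs W \<Longrightarrow> (v, u) \<notin> epairs W"
    and con: "con V (epairs W)"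
  shows "acyclic_graph V W \<longleftrightarrow> card V = card (epairs W) + 1"
proof
  have finp: "finite (epairs W)" using fin by (simp add: epairs_def)
  have le: "card V \<le> card (epairs W) + 1" using con_card finp fin con by blast
  {
    assume ac: "acyclic_graph V W"
    have "card (epairs W) + 1 \<le> card V"
    proof (rule bridges_card[OF finp fin(1) ne sub])
      fix x y assume xy: "(x, y) \<in> epairs W"
      show "\<exists>S. resp S (epairs W - {(x, y)}) \<and> \<not> resp S (epairs W)"
      proof (rule ccontr)
        assume no: "\<not> ?thesis"
        let ?W = "{e \<in> W. (fst e, fst (snd e)) \<noteq> (x, y)}"
        have eW: "epairs ?W = epairs W - {(x, y)}" by (force simp: epairs_def)
        have "resp {v. (adj ?W)\<^sup>*\<^sup>* x v} (epairs W)"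
          using no resp_component[of ?W x] unfolding eW by blast
        then have "(adj ?W)\<^sup>*\<^sup>* x y" using xy by (auto simp: resp_def)
        from rtranclp_distinct_path[OF this]
        obtain vs where vs: "vs \<noteq> []" "hd vs = x" "last vs = y" "distinct vs"
          "\<forall>i. Suc i < length vs \<longrightarrow> adj ?W (vs ! i) (vs ! Suc i)" by blast
        have "x \<noteq> y" using asym xy by blast
        have nadj: "\<not> adj ?W x y" using asym xy unfolding adj_epairs eW by blast
        \<comment> \<open>A shorter path would be the removed edge itself or its reverse, and
          \<open>asym\<close> excludes the latter.\<close>
        have len: "length vs \<ge> 3"
        proof -
          obtain vs' where "vs = x # vs'" using vs by (cases vs) auto
          moreover have "vs' \<noteq> []" using calculation vs \<open>x \<noteq> y\<close> by auto
          then obtain z vs'' where "vs' = z # vs''" by (cases vs') auto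
          moreover have "vs'' \<noteq> []" using calculation vs(3) vs(5)[rule_format, of 0] nadj by auto
          ultimately show ?thesis by (cases vs'') auto
        qed
        have adjW: "adj W u v" if "adj ?W u v" for u v using that by (auto simp: adj_def)
        have "vs ! i \<in> V" if "i < length vs" for i
        proof (cases "Suc i < length vs")
          case True
          then have "adj W (vs ! i) (vs ! Suc i)" using vs(5) adjW by blast
          then show ?thesis using sub by (auto simp: adj_epairs)
        next
          case False
          then have "vs ! i = y" using that vs(1,3) by (metis Suc_lessI diff_Suc_1 last_conv_nth)
          then show ?thesis using sub xy by auto
        qed
        then have "set vs \<subseteq> V" by (auto simp: in_set_conv_nth)
        moreover have "adj W (last vs) (hd vs)" using vs xy by (auto simp: adj_epairs)
        ultimately show False using ac len vs adjW by (auto simp: acyclic_graph_def)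
      qed
    qed
    then show "card V = card (epairs W) + 1" using le by simp
  }
  assume eq: "card V = card (epairs W) + 1"
  show "acyclic_graph V W"
    unfolding acyclic_graph_def
  proof (rule notI, elim exE conjE)
    fix vs assume vs: "length vs \<ge> 3" "distinct vs" "set vs \<subseteq> V"
      "\<forall>i. Suc i < length vs \<longrightarrow> adj W (vs ! i) (vs ! Suc i)" "adj W (last vs) (hd vs)"
    \<comment> \<open>Both orientations are removed, since \<open>adj\<close> does not tell which
      one is present. The rest of the cycle still connects the two ends.\<close>
    let ?D = "{(last vs, hd vs), (hd vs, last vs)}"
    let ?E = "epairs W - ?D"
    have ne: "vs \<noteq> []" using vs by auto
    have "con V ?E"
      unfolding con_def
    proof (intro allI impI)
      fix S assume S: "resp S ?E"
      have hd: "hd vs = vs ! 0" and la: "last vs = vs ! (length vs - 1)"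
        using ne by (simp_all add: hd_conv_nth last_conv_nth)
      have "(vs ! i \<in> S) = (hd vs \<in> S)" if "i < length vs" for i
        using that
      proof (induction i)
        case 0
        then show ?case using hd by simp
      next
        case (Suc i)
        have len: "i < length vs" "0 < length vs" "length vs - 1 < length vs" using Suc.prems by auto
        note eqs = nth_eq_iff_index_eq[OF vs(2) len(1,2)] nth_eq_iff_index_eq[OF vs(2) len(1,3)]
          nth_eq_iff_index_eq[OF vs(2) Suc.prems len(2)] nth_eq_iff_index_eq[OF vs(2) Suc.prems len(3)]
        have "(vs ! i, vs ! Suc i) \<notin> ?D" "(vs ! Suc i, vs ! i) \<notin> ?D"
          unfolding hd la insert_iff empty_iff prod.inject eqs using vs(1) by arith+
        moreover have "adj W (vs ! i) (vs ! Suc i)" using vs(4) Suc.prems by blast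
        ultimately have "(vs ! i \<in> S) = (vs ! Suc i \<in> S)"
          using S unfolding adj_epairs resp_def by blast
        then show ?case using Suc by simp
      qed
      from this[of "length vs - 1"] have "(last vs \<in> S) = (hd vs \<in> S)" using la ne by simp
      then have "resp S (epairs W)" using S by (auto simp: resp_def)
      then show "V \<inter> S = {} \<or> V \<subseteq> S" using con by (simp add: con_def)
    qed
    then have "card V \<le> card ?E + 1" using con_card[OF _ fin(1)] finp by simp
    moreover have "card ?E < card (epairs W)"
      using vs(5) finp by (intro psubset_card_mono) (auto simp: adj_epairs)
    ultimately show False using eq by simp
  qed
qed

section \<open>Switched trees contracted to their leaves\<close>

fun tens :: "'a tree \<Rightarrow> nat" where
  "tens (Lf l n) = 0"
| "tens (Tn a b) = Suc (tens a + tens b)"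
| "tens (Pr a b) = tens a + tens b"

fun pars :: "'a tree \<Rightarrow> nat" where
  "pars (Lf l n) = 0"
| "pars (Tn a b) = pars a + pars b"
| "pars (Pr a b) = Suc (pars a + pars b)"

lemma ids_simps [simp]:
  "ids (Lf l n) = {n}"
  "ids (Tn a b) = ids a \<union> ids b"
  "ids (Pr a b) = ids a \<union> ids b"
  by (auto simp: ids_def)

lemma finite_ids [simp]: "finite (ids t)"
  by (simp add: ids_def)

lemma ids_ne [simp]: "ids t \<noteq> {}"
  by (induction t) auto

text \<open>The leaf into which the root is contracted. At a par the switch dictates the premise. At
  a tensor both child edges survive, so either premise is right; letting \<open>s\<close> decide
  there too allows every leaf to stand for the root under some switching.\<close>

fun rep :: "(vert \<Rightarrow> bool) \<Rightarrow> (bool list \<Rightarrow> vert) \<Rightarrow> bool list \<Rightarrow> 'a tree \<Rightarrow> nat" where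
  "rep s f p (Lf l n) = n"
| "rep s f p (Tn a b) = (if s (f p) then rep s f (p @ [True]) b else rep s f (p @ [False]) a)"
| "rep s f p (Pr a b) = (if s (f p) then rep s f (p @ [True]) b else rep s f (p @ [False]) a)"

text \<open>What remains of the kept edges after contraction: the kept edge of a par disappears,
  while of the two edges of a tensor one is contracted and the other becomes a link between the
  representatives of the premises.\<close>

fun links :: "(vert \<Rightarrow> bool) \<Rightarrow> (bool list \<Rightarrow> vert) \<Rightarrow> bool list \<Rightarrow> 'a tree \<Rightarrow> (nat \<times> nat) set" where
  "links s f p (Lf l n) = {}"
| "links s f p (Tn a b) = insert (rep s f (p @ [False]) a, rep s f (p @ [True]) b)
     (links s f (p @ [False]) a \<union> links s f (p @ [True]) b)"
| "links s f p (Pr a b) = links s f (p @ [False]) a \<union> links s f (p @ [True]) b"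

text \<open>The pairs of \<open>rep\<close> and \<open>links\<close> for all switchings, described
  without positions, so that replacing a subtree renames nothing.\<close>

fun sw :: "'a tree \<Rightarrow> (nat \<times> (nat \<times> nat) set) set" where
  "sw (Lf l n) = {(n, {})}"
| "sw (Tn a b) = {(r, insert (ra, rb) (Ea \<union> Eb)) | r ra rb Ea Eb.
     (ra, Ea) \<in> sw a \<and> (rb, Eb) \<in> sw b \<and> (r = ra \<or> r = rb)}"
| "sw (Pr a b) = {(r, Ea \<union> Eb) | r ra rb Ea Eb.
     (ra, Ea) \<in> sw a \<and> (rb, Eb) \<in> sw b \<and> (r = ra \<or> r = rb)}"

lemma sw_Tn:
  "(ra, Ea) \<in> sw a \<Longrightarrow> (rb, Eb) \<in> sw b \<Longrightarrow> r = ra \<or> r = rb \<Longrightarrow>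
    (r, insert (ra, rb) (Ea \<union> Eb)) \<in> sw (Tn a b)"
  by (simp only: sw.simps mem_Collect_eq) blast

lemma sw_Pr:
  "(ra, Ea) \<in> sw a \<Longrightarrow> (rb, Eb) \<in> sw b \<Longrightarrow> r = ra \<or> r = rb \<Longrightarrow>
    (r, Ea \<union> Eb) \<in> sw (Pr a b)"
  by (simp only: sw.simps mem_Collect_eq) blast

lemma sw_TnE:
  assumes "(r, E) \<in> sw (Tn a b)"
  obtains ra rb Ea Eb where "(ra, Ea) \<in> sw a" "(rb, Eb) \<in> sw b" "r = ra \<or> r = rb"
    "E = insert (ra, rb) (Ea \<union> Eb)"
  using assms by (simp only: sw.simps mem_Collect_eq prod.inject) blast

lemma sw_PrE:
  assumes "(r, E) \<in> sw (Pr a b)"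
  obtains ra rb Ea Eb where "(ra, Ea) \<in> sw a" "(rb, Eb) \<in> sw b" "r = ra \<or> r = rb"
    "E = Ea \<union> Eb"
  using assms by (simp only: sw.simps mem_Collect_eq prod.inject) blast

declare sw.simps(2,3) [simp del]

lemma rep_links_sw: "(rep s f p t, links s f p t) \<in> sw t"
  by (induction t arbitrary: p) (auto intro!: sw_Tn sw_Pr)

lemma rep_ids: "rep s f p t \<in> ids t"
  by (induction t arbitrary: p) auto

lemma sw_finite: "(r, E) \<in> sw t \<Longrightarrow> finite E"
  by (induction t arbitrary: r E) (auto elim!: sw_TnE sw_PrE)

lemma sw_card: "(r, E) \<in> sw t \<Longrightarrow> card E \<le> tens t"
proof (induction t arbitrary: r E)
  case (Tn a b)
  from Tn.prems obtain ra rb Ea Eb where E: "(ra, Ea) \<in> sw a" "(rb, Eb) \<in> sw b" "E = insert (ra, rb) (Ea \<union> Eb)"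
    by (rule sw_TnE)
  have "card E \<le> Suc (card (Ea \<union> Eb))"
    unfolding E(3) using sw_finite[OF E(1)] sw_finite[OF E(2)] by (simp add: card_insert_if)
  also have "card (Ea \<union> Eb) \<le> card Ea + card Eb" by (rule card_Un_le)
  finally show ?case using Tn.IH(1)[OF E(1)] Tn.IH(2)[OF E(2)] by simp
next
  case (Pr a b)
  from Pr.prems obtain ra rb Ea Eb where E: "(ra, Ea) \<in> sw a" "(rb, Eb) \<in> sw b" "E = Ea \<union> Eb"
    by (rule sw_PrE)
  then have "card E \<le> card Ea + card Eb" by (simp add: card_Un_le)
  then show ?case using Pr.IH(1)[OF E(1)] Pr.IH(2)[OF E(2)] by simp
qed auto

lemma sw_ids: "(r, E) \<in> sw t \<Longrightarrow> r \<in> ids t \<and> E \<subseteq> ids t \<times> ids t"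
  by (induction t arbitrary: r E) (auto elim!: sw_TnE sw_PrE, blast+)

lemma sw_ne: "\<exists>r E. (r, E) \<in> sw t"
  using rep_links_sw by blast

lemma sw_rep_any: "x \<in> ids t \<Longrightarrow> \<exists>E. (x, E) \<in> sw t"
proof (induction t)
  case (Tn a b)
  then obtain ra Ea rb Eb where "(ra, Ea) \<in> sw a" "(rb, Eb) \<in> sw b" "x = ra \<or> x = rb"
    using sw_ne[of a] sw_ne[of b] unfolding ids_simps by blast
  from sw_Tn[OF this] show ?case by blast
next
  case (Pr a b)
  then obtain ra Ea rb Eb where "(ra, Ea) \<in> sw a" "(rb, Eb) \<in> sw b" "x = ra \<or> x = rb"
    using sw_ne[of a] sw_ne[of b] unfolding ids_simps by blast
  from sw_Pr[OF this] show ?case by blast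
qed auto

text \<open>The colours that the root can take when the leaf colouring \<open>S\<close> is extended
  to the tree under a suitable switching; empty if no switching admits an extension. A par may show
  the colour of either premise, but both premises must admit an extension.\<close>

fun col :: "nat set \<Rightarrow> 'a tree \<Rightarrow> bool set" where
  "col S (Lf l n) = {n \<in> S}"
| "col S (Tn a b) = col S a \<inter> col S b"
| "col S (Pr a b) = (if col S a = {} \<or> col S b = {} then {} else col S a \<union> col S b)"

lemma col_sw: "b \<in> col S t \<longleftrightarrow> (\<exists>r E. (r, E) \<in> sw t \<and> resp S E \<and> (r \<in> S) = b)"
proof (induction t arbitrary: b)
  case (Tn t u)
  show ?case
  proof
    assume "b \<in> col S (Tn t u)"
    then have b: "b \<in> col S t" "b \<in> col S u" by auto
    from b(1) obtain r E where 1: "(r, E) \<in> sw t" "resp S E" "(r \<in> S) = b" unfolding Tn.IH by blast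
    from b(2) obtain r' E' where 2: "(r', E') \<in> sw u" "resp S E'" "(r' \<in> S) = b" unfolding Tn.IH by blast
    have "(r, insert (r, r') (E \<union> E')) \<in> sw (Tn t u)" "resp S (insert (r, r') (E \<union> E'))"
      using sw_Tn[OF 1(1) 2(1)] 1 2 by auto
    then show "\<exists>r E. (r, E) \<in> sw (Tn t u) \<and> resp S E \<and> (r \<in> S) = b" using 1(3) by blast
  next
    assume "\<exists>r E. (r, E) \<in> sw (Tn t u) \<and> resp S E \<and> (r \<in> S) = b"
    then obtain r E where rE: "(r, E) \<in> sw (Tn t u)" "resp S E" "(r \<in> S) = b" by blast
    from rE(1) obtain ra rb Ea Eb where E: "(ra, Ea) \<in> sw t" "(rb, Eb) \<in> sw u" "r = ra \<or> r = rb"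
      "E = insert (ra, rb) (Ea \<union> Eb)" by (rule sw_TnE)
    then have "(ra \<in> S) \<in> col S t" "(rb \<in> S) \<in> col S u" using rE(2) unfolding Tn.IH by auto
    then show "b \<in> col S (Tn t u)" using E(3,4) rE(2,3) by auto
  qed
next
  case (Pr t u)
  have iff: "b \<in> col S (Pr t u) \<longleftrightarrow> (\<exists>c d. c \<in> col S t \<and> d \<in> col S u \<and> (b = c \<or> b = d))"
    by auto
  show ?case
  proof
    assume "b \<in> col S (Pr t u)"
    then obtain c d where b: "c \<in> col S t" "d \<in> col S u" "b = c \<or> b = d" unfolding iff by blast
    from b(1) obtain r E where 1: "(r, E) \<in> sw t" "resp S E" "(r \<in> S) = c" unfolding Pr.IH by blast
    from b(2) obtain r' E' where 2: "(r', E') \<in> sw u" "resp S E'" "(r' \<in> S) = d" unfolding Pr.IH by blast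
    have "(r, E \<union> E') \<in> sw (Pr t u)" "(r', E \<union> E') \<in> sw (Pr t u)" "resp S (E \<union> E')"
      using sw_Pr[OF 1(1) 2(1)] 1 2 by auto
    then show "\<exists>r E. (r, E) \<in> sw (Pr t u) \<and> resp S E \<and> (r \<in> S) = b" using 1(3) 2(3) b(3) by blast
  next
    assume "\<exists>r E. (r, E) \<in> sw (Pr t u) \<and> resp S E \<and> (r \<in> S) = b"
    then obtain r E where rE: "(r, E) \<in> sw (Pr t u)" "resp S E" "(r \<in> S) = b" by blast
    from rE(1) obtain ra rb Ea Eb where E: "(ra, Ea) \<in> sw t" "(rb, Eb) \<in> sw u" "r = ra \<or> r = rb"
      "E = Ea \<union> Eb" by (rule sw_PrE)
    then have "(ra \<in> S) \<in> col S t" "(rb \<in> S) \<in> col S u" using rE(2) unfolding Pr.IH by auto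
    then show "b \<in> col S (Pr t u)" unfolding iff using E(3) rE(3) by blast
  qed
qed auto

section \<open>Switched graphs on leaves\<close>

lemma switched_simps [simp]:
  "switched {} s = {}"
  "switched (insert (u, v, d, k) E) s =
     (if \<not> k \<or> s v = d then insert (u, v, d, k) (switched E s) else switched E s)"
  "switched (E \<union> F) s = switched E s \<union> switched F s"
  by (auto simp: switched_def)

lemma switched_UN: "switched (\<Union>i\<in>I. E i) s = (\<Union>i\<in>I. switched (E i) s)"
  by (auto simp: switched_def)

lemma epairs_UN: "epairs (\<Union>i\<in>I. E i) = (\<Union>i\<in>I. epairs (E i))"
  unfolding epairs_def by (rule image_UN)

lemma epairs_mono: "E \<subseteq> F \<Longrightarrow> epairs E \<subseteq> epairs F"
  unfolding epairs_def by (rule image_mono)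

lemma switched_subset: "switched E s \<subseteq> E"
  by (auto simp: switched_def)

lemma finite_tedges: "finite (tedges f p t)"
  by (induction t arbitrary: p) auto

text \<open>Each vertex takes the colour of its representing leaf. A kept edge is then either
  contracted or parallel to a link, hence monochromatic. Together with \<open>resp_leaves\<close>
  this matches colourings of the switched tree with colourings of its leaves. The map
  \<open>\<phi>\<close> is left abstract so that one map can serve the linking and all
  roots.\<close>

lemma resp_retract:
  assumes "\<And>q t'. subt t q = Some t' \<Longrightarrow> \<phi> (vtx f (p @ q) t') = rep s f (p @ q) t'"
    and "resp S (links s f p t)"
  shows "resp (\<phi> -` S) (epairs (switched (tedges f p t) s))"
  using assms
proof (induction t arbitrary: p)
  case (Tn a b)
  have 1: "resp (\<phi> -` S) (epairs (switched (tedges f (p @ [False]) a) s))"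
    using Tn.prems(1)[of "False # _"] Tn.prems(2) by (intro Tn.IH(1)) auto
  have 2: "resp (\<phi> -` S) (epairs (switched (tedges f (p @ [True]) b) s))"
    using Tn.prems(1)[of "True # _"] Tn.prems(2) by (intro Tn.IH(2)) auto
  have "\<phi> (vtx f (p @ [False]) a) = rep s f (p @ [False]) a"
    "\<phi> (vtx f (p @ [True]) b) = rep s f (p @ [True]) b"
    "\<phi> (f p) = rep s f p (Tn a b)"
    using Tn.prems(1)[of "[False]"] Tn.prems(1)[of "[True]"] Tn.prems(1)[of "[]"] by auto
  then show ?case using 1 2 Tn.prems(2) by auto
next
  case (Pr a b)
  have 1: "resp (\<phi> -` S) (epairs (switched (tedges f (p @ [False]) a) s))"
    using Pr.prems(1)[of "False # _"] Pr.prems(2) by (intro Pr.IH(1)) auto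
  have 2: "resp (\<phi> -` S) (epairs (switched (tedges f (p @ [True]) b) s))"
    using Pr.prems(1)[of "True # _"] Pr.prems(2) by (intro Pr.IH(2)) auto
  have "\<phi> (vtx f (p @ [False]) a) = rep s f (p @ [False]) a"
    "\<phi> (vtx f (p @ [True]) b) = rep s f (p @ [True]) b"
    "\<phi> (f p) = rep s f p (Pr a b)"
    using Pr.prems(1)[of "[False]"] Pr.prems(1)[of "[True]"] Pr.prems(1)[of "[]"] by auto
  then show ?case using 1 2 by auto
qed auto

lemma resp_leaves:
  assumes "resp S (epairs (switched (tedges f p t) s))"
  shows "(vtx f p t \<in> S \<longleftrightarrow> VL (rep s f p t) \<in> S) \<and> resp {n. VL n \<in> S} (links s f p t)"
  using assms by (induction t arbitrary: p) (auto split: if_splits)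

lemma resp_cover:
  assumes "resp S (epairs (switched (tedges f p t) s))" "VL ` ids t \<subseteq> S"
  shows "tverts f p t \<subseteq> S"
  using assms
proof (induction t arbitrary: p)
  case (Tn a b)
  have "f p \<in> S" using resp_leaves[OF Tn.prems(1)] subsetD[OF Tn.prems(2) imageI[OF rep_ids]] by (metis vtx.simps(2))
  moreover have "VL ` ids a \<subseteq> S" "VL ` ids b \<subseteq> S" using Tn.prems(2) by (auto simp: image_Un)
  ultimately show ?case using Tn by (auto split: if_splits simp del: vtx.simps)
next
  case (Pr a b)
  have "f p \<in> S" using resp_leaves[OF Pr.prems(1)] subsetD[OF Pr.prems(2) imageI[OF rep_ids]] by (metis vtx.simps(3))
  moreover have "VL ` ids a \<subseteq> S" "VL ` ids b \<subseteq> S" using Pr.prems(2) by (auto simp: image_Un)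
  ultimately show ?case using Pr by (auto split: if_splits simp del: vtx.simps)
qed auto

fun inner :: "(bool list \<Rightarrow> vert) \<Rightarrow> bool list \<Rightarrow> 'a tree \<Rightarrow> vert set" where
  "inner f p (Lf l n) = {}"
| "inner f p (Tn a b) = insert (f p) (inner f (p @ [False]) a \<union> inner f (p @ [True]) b)"
| "inner f p (Pr a b) = insert (f p) (inner f (p @ [False]) a \<union> inner f (p @ [True]) b)"

lemma tverts_inner: "tverts f p t = VL ` ids t \<union> inner f p t"
  by (induction t arbitrary: p) auto

lemma inner_sub: "v \<in> inner f p t \<Longrightarrow> \<exists>q. v = f (p @ q)"
proof (induction t arbitrary: p)
  case (Tn a b)
  then consider "v = f (p @ [])" | q where "v = f (p @ False # q)" | q where "v = f (p @ True # q)"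
    by fastforce
  then show ?case by cases blast+
next
  case (Pr a b)
  then consider "v = f (p @ [])" | q where "v = f (p @ False # q)" | q where "v = f (p @ True # q)"
    by fastforce
  then show ?case by cases blast+
qed auto

lemma finite_inner [simp]: "finite (inner f p t)"
  by (induction t arbitrary: p) auto

lemma inner_disjoint:
  assumes "inj f"
  shows "f p \<notin> inner f (p @ [d]) a" "inner f (p @ [False]) a \<inter> inner f (p @ [True]) b = {}"
  using assms by (auto dest!: inner_sub dest: injD)

lemma card_inner:
  assumes f: "inj f"
  shows "card (inner f p t) = tens t + pars t"
proof (induction t arbitrary: p)
  case (Tn a b)
  have "f p \<notin> inner f (p @ [False]) a" "f p \<notin> inner f (p @ [True]) b"
    "inner f (p @ [False]) a \<inter> inner f (p @ [True]) b = {}"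
    using inner_disjoint[OF f] by blast+
  then show ?case using Tn by (simp add: card_Un_disjoint)
next
  case (Pr a b)
  have "f p \<notin> inner f (p @ [False]) a" "f p \<notin> inner f (p @ [True]) b"
    "inner f (p @ [False]) a \<inter> inner f (p @ [True]) b = {}"
    using inner_disjoint[OF f] by blast+
  then show ?case using Pr by (simp add: card_Un_disjoint)
qed auto

lemma vtx_tverts: "vtx f p t \<in> tverts f p t" "(\<exists>n. vtx f p t = VL n) \<or> vtx f p t = f p"
  by (cases t; simp)+

lemma tedges_parent:
  fixes t :: "'a tree"
  assumes "(u, v) \<in> epairs (tedges f p t)"
  shows "v \<in> inner f p t \<and> u \<in> tverts f p t \<and> (\<exists>q d. v = f (p @ q) \<and> ((\<exists>n. u = VL n) \<or> u = f (p @ q @ [d])))"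
proof -
  define R where "R p = (\<exists>q d. v = f (p @ q) \<and> ((\<exists>n. u = VL n) \<or> u = f (p @ q @ [d])))" for p
  have up: "R p" if "R (p @ [d])" for p d
  proof -
    from that obtain q d' where "v = f (p @ d # q)" "(\<exists>n. u = VL n) \<or> u = f (p @ (d # q) @ [d'])"
      unfolding R_def by auto
    then show ?thesis unfolding R_def by blast
  qed
  have edge: "R p" if "v = f p" "u = vtx f (p @ [d]) a" for p d and a :: "'a tree"
    using vtx_tverts(2)[of f "p @ [d]" a] that unfolding R_def by (metis append_Nil append_Nil2)
  have "v \<in> inner f p t \<and> u \<in> tverts f p t \<and> R p"
    using assms
  proof (induction t arbitrary: p)
    case (Tn a b)
    from Tn.prems consider "v = f p" "u = vtx f (p @ [False]) a" | "v = f p" "u = vtx f (p @ [True]) b"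
      | "(u, v) \<in> epairs (tedges f (p @ [False]) a)" | "(u, v) \<in> epairs (tedges f (p @ [True]) b)" by auto
    then show ?case
    proof cases
      case 1
      then show ?thesis using edge vtx_tverts(1)[of f "p @ [False]" a] by simp
    next
      case 2
      then show ?thesis using edge vtx_tverts(1)[of f "p @ [True]" b] by simp
    next
      case 3
      from Tn.IH(1)[OF this] show ?thesis using up by auto
    next
      case 4
      from Tn.IH(2)[OF this] show ?thesis using up by auto
    qed
  next
    case (Pr a b)
    from Pr.prems consider "v = f p" "u = vtx f (p @ [False]) a" | "v = f p" "u = vtx f (p @ [True]) b"
      | "(u, v) \<in> epairs (tedges f (p @ [False]) a)" | "(u, v) \<in> epairs (tedges f (p @ [True]) b)" by auto
    then show ?case
    proof cases
      case 1
      then show ?thesis using edge vtx_tverts(1)[of f "p @ [False]" a] by simp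
    next
      case 2
      then show ?thesis using edge vtx_tverts(1)[of f "p @ [True]" b] by simp
    next
      case 3
      from Pr.IH(1)[OF this] show ?thesis using up by auto
    next
      case 4
      from Pr.IH(2)[OF this] show ?thesis using up by auto
    qed
  qed simp
  then show ?thesis unfolding R_def .
qed

lemma epairs_switched: "epairs (switched E s) \<subseteq> epairs E"
  by (intro epairs_mono switched_subset)

text \<open>A tensor keeps two child edges and a par one, whatever the switching. Distinct leaf
  identifiers make the two children of a tensor different vertices, so that its edges are not
  identified by \<open>epairs\<close>.\<close>

lemma card_tedges:
  assumes f: "inj f" "\<And>q n. f q \<noteq> VL n" and d: "distinct (map snd (leaves t))"
  shows "card (epairs (switched (tedges f p t) s)) = 2 * tens t + pars t"
  using d
proof (induction t arbitrary: p)
  case (Tn a b)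
  let ?A = "epairs (switched (tedges f (p @ [False]) a) s)"
  let ?B = "epairs (switched (tedges f (p @ [True]) b) s)"
  have sub: "snd ` ?A \<subseteq> inner f (p @ [False]) a" "snd ` ?B \<subseteq> inner f (p @ [True]) b"
    using tedges_parent epairs_switched by fastforce+
  have "f p \<notin> snd ` ?A" using sub(1) inner_disjoint(1)[OF f(1), of p False a] by (rule contra_subsetD)
  moreover have "f p \<notin> snd ` ?B" using sub(2) inner_disjoint(1)[OF f(1), of p True b] by (rule contra_subsetD)
  moreover have "snd ` ?A \<inter> snd ` ?B = {}"
    using Int_mono[OF sub] inner_disjoint(2)[OF f(1), of p a b] by simp
  ultimately have disj: "(u, f p) \<notin> ?A" "(u, f p) \<notin> ?B" "?A \<inter> ?B = {}" for u
    by (metis image_eqI snd_conv, metis image_eqI snd_conv, blast)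
  have fin: "finite ?A" "finite ?B"
    by (auto simp: epairs_def intro: finite_subset[OF switched_subset finite_tedges])
  have "ids a \<inter> ids b = {}" using Tn.prems by (auto simp: ids_def)
  moreover have "f (p @ [False]) \<noteq> f (p @ [True])" using f(1) by (auto dest: injD)
  moreover have "VL n \<noteq> f q" for q n using f(2)[of q n] by simp
  ultimately have "vtx f (p @ [False]) a \<noteq> vtx f (p @ [True]) b"
    using f(2) by (cases a; cases b) simp_all
  then show ?case using Tn disj fin by (simp add: card_Un_disjoint)
next
  case (Pr a b)
  let ?A = "epairs (switched (tedges f (p @ [False]) a) s)"
  let ?B = "epairs (switched (tedges f (p @ [True]) b) s)"
  have sub: "snd ` ?A \<subseteq> inner f (p @ [False]) a" "snd ` ?B \<subseteq> inner f (p @ [True]) b"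
    using tedges_parent epairs_switched by fastforce+
  have "f p \<notin> snd ` ?A" using sub(1) inner_disjoint(1)[OF f(1), of p False a] by (rule contra_subsetD)
  moreover have "f p \<notin> snd ` ?B" using sub(2) inner_disjoint(1)[OF f(1), of p True b] by (rule contra_subsetD)
  moreover have "snd ` ?A \<inter> snd ` ?B = {}"
    using Int_mono[OF sub] inner_disjoint(2)[OF f(1), of p a b] by simp
  ultimately have disj: "(u, f p) \<notin> ?A" "(u, f p) \<notin> ?B" "?A \<inter> ?B = {}" for u
    by (metis image_eqI snd_conv, metis image_eqI snd_conv, blast)
  have fin: "finite ?A" "finite ?B"
    by (auto simp: epairs_def intro: finite_subset[OF switched_subset finite_tedges])
  show ?case using Pr disj fin by (simp add: card_Un_disjoint)
qed auto


section \<open>Linking and sequent joined at their leaves, with cuts read as tensors\<close>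

fun rtree :: "'a root \<Rightarrow> 'a tree" where
  "rtree (RF A) = A"
| "rtree (RC A B) = Tn A B"

lemma redges_rtree: "redges i r = tedges (VG i) [] (rtree r)"
  by (cases r) auto

lemma rverts_rtree: "rverts i r = tverts (VG i) [] (rtree r)"
  by (cases r) auto

lemma rleaves_rtree: "rleaves r = leaves (rtree r)"
  by (cases r) auto

definition shared :: "'a tree \<Rightarrow> 'a tree list \<Rightarrow> bool" where
  "shared P ts \<longleftrightarrow> distinct (map snd (leaves P)) \<and> distinct (map snd (concat (map leaves ts))) \<and>
     set (leaves P) = set (concat (map leaves ts))"

lemma ppg_shared:
  fixes P :: "'a tree"
  shows "pre_proof_graph P rs \<Longrightarrow> shared P (map rtree rs)"
proof -
  have "rleaves = (\<lambda>r. leaves (rtree r :: 'a tree))" by (simp add: fun_eq_iff rleaves_rtree)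
  then show "pre_proof_graph P rs \<Longrightarrow> shared P (map rtree rs)"
    by (simp add: pre_proof_graph_def shared_def seq_leaves_def o_def)
qed

lemma shared_ids: "shared P ts \<Longrightarrow> ids P = (\<Union>t\<in>set ts. ids t)"
  by (auto simp: shared_def ids_def image_UN)

lemma shared_distinct: "shared P ts \<Longrightarrow> t \<in> set ts \<Longrightarrow> distinct (map snd (leaves t))"
  by (auto simp: shared_def map_concat distinct_concat_iff o_def)

definition seq_links :: "(vert \<Rightarrow> bool) \<Rightarrow> 'a tree list \<Rightarrow> (nat \<times> nat) set" where
  "seq_links s ts = (\<Union>i<length ts. links s (VG i) [] (ts ! i))"

lemma switched_graph: "epairs (switched (graph_edges P rs) s) =
   epairs (switched (tedges VP [] P) s) \<union>
   (\<Union>i<length rs. epairs (switched (tedges (VG i) [] (rtree (rs ! i))) s))"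
  by (simp add: graph_edges_def switched_UN epairs_UN redges_rtree)

lemma graph_verts_rtree: "graph_verts P rs =
   tverts VP [] P \<union> (\<Union>i<length rs. tverts (VG i) [] (rtree (rs ! i)))"
  by (simp add: graph_verts_def rverts_rtree)

text \<open>The map \<open>\<phi>\<close> of \<open>resp_retract\<close> for all trees of the graph
  at once.\<close>

fun retract :: "(vert \<Rightarrow> bool) \<Rightarrow> 'a tree \<Rightarrow> 'a tree list \<Rightarrow> vert \<Rightarrow> nat" where
  "retract s P ts (VL n) = n"
| "retract s P ts (VP q) = rep s VP q (the (subt P q))"
| "retract s P ts (VG i q) = rep s (VG i) q (the (subt (ts ! i) q))"

lemma resp_retract_graph:
  assumes "resp S (links s VP [] P \<union> seq_links s (map rtree rs))"
  shows "resp (retract s P (map rtree rs) -` S) (epairs (switched (graph_edges P rs) s))"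
proof -
  let ?r = "retract s P (map rtree rs)"
  have 1: "?r (vtx VP q t') = rep s VP q t'" if "subt P q = Some t'" for q t'
    using that by (cases t') auto
  have 2: "?r (vtx (VG i) q t') = rep s (VG i) q t'"
    if "subt (rtree (rs ! i)) q = Some t'" "i < length rs" for i q t'
    using that by (cases t') auto
  show ?thesis
    unfolding switched_graph resp_simps resp_UN
    using assms 1 2 by (auto intro!: resp_retract simp: seq_links_def resp_UN)
qed

lemma resp_leaves_graph:
  assumes "resp S (epairs (switched (graph_edges P rs) s))"
  shows "resp {n. VL n \<in> S} (links s VP [] P \<union> seq_links s (map rtree rs))"
  using assms resp_leaves[of S] by (fastforce simp: switched_graph resp_UN seq_links_def)

lemma leaf_tverts: "n \<in> ids t \<Longrightarrow> VL n \<in> tverts f p t"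
  by (simp add: tverts_inner)

lemma resp_cover_graph:
  assumes "resp S (epairs (switched (graph_edges P rs) s))" "VL ` ids P \<subseteq> S" "shared P (map rtree rs)"
  shows "graph_verts P rs \<subseteq> S"
proof -
  have "VL ` ids (rtree (rs ! i)) \<subseteq> S" if "i < length rs" for i
    using assms(2) shared_ids[OF assms(3)] that by (fastforce simp: in_set_conv_nth)
  then have "tverts (VG i) [] (rtree (rs ! i)) \<subseteq> S" if "i < length rs" for i
    using assms(1) that unfolding switched_graph resp_simps resp_UN by (intro resp_cover) auto
  moreover have "tverts VP [] P \<subseteq> S"
    using assms(1,2) unfolding switched_graph resp_simps by (intro resp_cover) auto
  ultimately show ?thesis unfolding graph_verts_rtree by auto
qed

lemma con_graph_iff:
  assumes "shared P (map rtree rs)"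
  shows "con (graph_verts P rs) (epairs (switched (graph_edges P rs) s)) \<longleftrightarrow>
    con (ids P) (links s VP [] P \<union> seq_links s (map rtree rs))" (is "con ?V ?E \<longleftrightarrow> con ?X ?F")
proof
  have sub: "VL ` ?X \<subseteq> ?V" unfolding graph_verts_rtree using leaf_tverts by fast
  {
    assume *: "con ?V ?E"
    show "con ?X ?F"
      unfolding con_def
    proof (intro allI impI)
      fix S assume "resp S ?F"
      from resp_retract_graph[OF this] *
      have "?V \<inter> retract s P (map rtree rs) -` S = {} \<or> ?V \<subseteq> retract s P (map rtree rs) -` S"
        by (simp add: con_def)
      moreover have "VL n \<in> retract s P (map rtree rs) -` S \<longleftrightarrow> n \<in> S" for n by simp
      moreover have "VL n \<in> ?V" if "n \<in> ?X" for n using sub that by blast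
      ultimately show "?X \<inter> S = {} \<or> ?X \<subseteq> S" by blast
    qed
  }
  assume *: "con ?X ?F"
  show "con ?V ?E"
    unfolding con_def
  proof (intro allI impI)
    fix S assume S: "resp S ?E"
    have "?X \<inter> {n. VL n \<in> S} = {} \<or> ?X \<subseteq> {n. VL n \<in> S}"
      using * resp_leaves_graph[OF S] by (simp add: con_def)
    then have "VL ` ?X \<subseteq> - S \<or> VL ` ?X \<subseteq> S" by auto
    then show "?V \<inter> S = {} \<or> ?V \<subseteq> S"
      using resp_cover_graph[OF S _ assms] resp_cover_graph[OF resp_Compl[OF S] _ assms] by blast
  qed
qed

fun vlen :: "vert \<Rightarrow> nat" where
  "vlen (VL n) = 0"
| "vlen (VP q) = length q"
| "vlen (VG i q) = length q"

lemma inj_VP [simp]: "inj VP" and inj_VG [simp]: "inj (VG i)"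
  by (auto intro: injI)

text \<open>An edge leads from a leaf or from a path that is one step longer, and never ends in a
  leaf. Hence no two edges are opposite, as the acyclicity count demands.\<close>

lemma edges_graph_depth:
  assumes "(u, v) \<in> epairs (graph_edges P rs)"
  shows "u \<in> graph_verts P rs" "v \<in> graph_verts P rs" "\<And>n. v \<noteq> VL n"
    "(\<exists>n. u = VL n) \<or> vlen u = Suc (vlen v)"
proof -
  have "epairs (graph_edges P rs) = epairs (tedges VP [] P) \<union>
    (\<Union>i<length rs. epairs (tedges (VG i) [] (rtree (rs ! i))))"
    by (simp add: graph_edges_def epairs_UN redges_rtree)
  then consider "(u, v) \<in> epairs (tedges VP [] P)"
    | i where "i < length rs" "(u, v) \<in> epairs (tedges (VG i) [] (rtree (rs ! i)))"
    using assms by auto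
  then have "u \<in> graph_verts P rs \<and> v \<in> graph_verts P rs \<and> (\<forall>n. v \<noteq> VL n) \<and>
    ((\<exists>n. u = VL n) \<or> vlen u = Suc (vlen v))"
  proof cases
    case 1
    from tedges_parent[OF this] show ?thesis by (auto simp: graph_verts_rtree tverts_inner)
  next
    case 2
    from tedges_parent[OF this(2)] 2(1) show ?thesis by (auto simp: graph_verts_rtree tverts_inner)
  qed
  then show "u \<in> graph_verts P rs" "v \<in> graph_verts P rs" "\<And>n. v \<noteq> VL n"
    "(\<exists>n. u = VL n) \<or> vlen u = Suc (vlen v)" by auto
qed

lemma card_graph_verts:
  assumes "shared P (map rtree rs)"
  shows "card (graph_verts P rs) = card (ids P) + tens P + pars P +
    (\<Sum>i<length rs. tens (rtree (rs ! i)) + pars (rtree (rs ! i)))"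
proof -
  let ?G = "\<Union>i<length rs. inner (VG i) [] (rtree (rs ! i))"
  have "graph_verts P rs = VL ` ids P \<union> inner VP [] P \<union> ?G"
    using shared_ids[OF assms] unfolding graph_verts_rtree tverts_inner by (fastforce simp: in_set_conv_nth)
  moreover have "VL ` ids P \<inter> inner VP [] P = {}" "(VL ` ids P \<union> inner VP [] P) \<inter> ?G = {}"
    by (auto dest!: inner_sub)
  moreover have "card ?G = (\<Sum>i<length rs. card (inner (VG i) [] (rtree (rs ! i))))"
    by (rule card_UN_disjoint) (auto dest!: inner_sub)
  moreover have "card (VL ` ids P) = card (ids P)" by (simp add: card_image inj_on_def)
  ultimately show ?thesis by (simp add: card_Un_disjoint card_inner)
qed

lemma card_graph_edges:
  assumes "shared P (map rtree rs)"
  shows "card (epairs (switched (graph_edges P rs) s)) = 2 * tens P + pars P +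
    (\<Sum>i<length rs. 2 * tens (rtree (rs ! i)) + pars (rtree (rs ! i)))"
proof -
  let ?E = "\<lambda>f (t :: 'a tree). epairs (switched (tedges f [] t) s)"
  let ?G = "\<Union>i<length rs. ?E (VG i) (rtree (rs ! i))"
  have par: "\<exists>q. v = f q" if "(u, v) \<in> ?E f t" for u v f and t :: "'a tree"
    using tedges_parent[OF subsetD[OF epairs_switched that]] by auto
  have fin: "finite (?E f t)" for f and t :: "'a tree"
    by (auto simp: epairs_def intro: finite_subset[OF switched_subset finite_tedges])
  have "?E VP P \<inter> ?G = {}" by (auto dest!: par)
  moreover have "card ?G = (\<Sum>i<length rs. card (?E (VG i) (rtree (rs ! i))))"
  proof (rule card_UN_disjoint)
    show "\<forall>i\<in>{..<length rs}. \<forall>j\<in>{..<length rs}. i \<noteq> j \<longrightarrow>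
        ?E (VG i) (rtree (rs ! i)) \<inter> ?E (VG j) (rtree (rs ! j)) = {}"
    proof (intro ballI impI)
      fix i j :: nat assume "i \<noteq> j"
      then show "?E (VG i) (rtree (rs ! i)) \<inter> ?E (VG j) (rtree (rs ! j)) = {}"
        by (auto dest!: par)
    qed
  qed (auto simp: fin)
  moreover have "card (?E VP P) = 2 * tens P + pars P"
    using assms by (intro card_tedges) (auto simp: shared_def)
  moreover have "card (?E (VG i) (rtree (rs ! i))) = 2 * tens (rtree (rs ! i)) + pars (rtree (rs ! i))"
    if "i < length rs" for i
    using shared_distinct[OF assms] that by (intro card_tedges) auto
  ultimately show ?thesis unfolding switched_graph by (simp add: card_Un_disjoint fin)
qed

text \<open>There are as many inner vertices as tensors plus pars, and as many kept edges as twice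
  the tensors plus pars. So "vertices = edges + 1" becomes "leaves = tensors + 1", for every
  switching alike.\<close>

lemma correct_switching_iff:
  assumes "shared P (map rtree rs)"
  shows "connected_graph (graph_verts P rs) (switched (graph_edges P rs) s) \<and>
      acyclic_graph (graph_verts P rs) (switched (graph_edges P rs) s) \<longleftrightarrow>
    con (ids P) (links s VP [] P \<union> seq_links s (map rtree rs)) \<and>
      card (ids P) = tens P + (\<Sum>i<length rs. tens (rtree (rs ! i))) + 1"
proof -
  let ?V = "graph_verts P rs" and ?W = "switched (graph_edges P rs) s"
  have "finite ?V" unfolding graph_verts_rtree by (simp add: tverts_inner)
  moreover have "finite ?W"
    by (rule finite_subset[OF switched_subset]) (simp add: graph_edges_def redges_rtree finite_tedges)
  moreover have "?V \<noteq> {}" unfolding graph_verts_rtree by (simp add: tverts_inner)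
  moreover have "epairs ?W \<subseteq> ?V \<times> ?V"
    using edges_graph_depth(1,2)[OF subsetD[OF epairs_switched]] by auto
  moreover have "(v, u) \<notin> epairs ?W" if "(u, v) \<in> epairs ?W" for u v
  proof
    assume "(v, u) \<in> epairs ?W"
    note 1 = edges_graph_depth(3,4)[OF subsetD[OF epairs_switched this]]
    note 2 = edges_graph_depth(3,4)[OF subsetD[OF epairs_switched that]]
    from 1 2 show False by auto
  qed
  ultimately have "con ?V (epairs ?W) \<Longrightarrow> acyclic_graph ?V ?W \<longleftrightarrow> card ?V = card (epairs ?W) + 1"
    using acyclic_iff_card by blast
  then have "connected_graph ?V ?W \<and> acyclic_graph ?V ?W \<longleftrightarrow>
    con (ids P) (links s VP [] P \<union> seq_links s (map rtree rs)) \<and> card ?V = card (epairs ?W) + 1"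
    unfolding connected_iff_con con_graph_iff[OF assms] by auto
  also have "card ?V = card (epairs ?W) + 1 \<longleftrightarrow>
      card (ids P) = tens P + (\<Sum>i<length rs. tens (rtree (rs ! i))) + 1"
    unfolding card_graph_verts[OF assms] card_graph_edges[OF assms]
    by (simp only: sum.distrib sum_distrib_left[symmetric]) arith
  finally show ?thesis .
qed

section \<open>Realising abstract switchings by concrete ones\<close>

lemma rep_links_cong:
  assumes "\<And>z. s (f (p @ z)) = s' (f (p @ z))"
  shows "rep s f p t = rep s' f p t \<and> links s f p t = links s' f p t"
  using assms
proof (induction t arbitrary: p)
  case (Tn a b)
  have "s (f ((p @ [d]) @ z)) = s' (f ((p @ [d]) @ z))" for d z using Tn.prems[of "d # z"] by simp
  note this[THEN Tn.IH(1)] this[THEN Tn.IH(2)]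
  then show ?case using Tn.prems[of "[]"] by simp
next
  case (Pr a b)
  have "s (f ((p @ [d]) @ z)) = s' (f ((p @ [d]) @ z))" for d z using Pr.prems[of "d # z"] by simp
  note this[THEN Pr.IH(1)] this[THEN Pr.IH(2)]
  then show ?case using Pr.prems[of "[]"] by simp
qed simp

lemma glue_switchings:
  assumes "inj (f :: bool list \<Rightarrow> vert)"
  obtains s where "s (f q) = c" "\<And>z. s (f ((q @ [False]) @ z)) = s1 (f ((q @ [False]) @ z))"
    "\<And>z. s (f ((q @ [True]) @ z)) = s2 (f ((q @ [True]) @ z))"
proof -
  let ?s = "\<lambda>v. if v = f q then c else if \<exists>z. v = f (q @ False # z) then s1 v else s2 v"
  show thesis
    by (rule that[of ?s]) (use assms in \<open>auto dest: injD\<close>)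
qed

lemma realize_node:
  assumes f: "inj f"
    and a: "rep s1 f (q @ [False]) a = ra" "links s1 f (q @ [False]) a = Ea"
    and b: "rep s2 f (q @ [True]) b = rb" "links s2 f (q @ [True]) b = Eb"
    and r: "r = ra \<or> r = rb"
  obtains s where "\<And>z. s (f ((q @ [False]) @ z)) = s1 (f ((q @ [False]) @ z))"
    "\<And>z. s (f ((q @ [True]) @ z)) = s2 (f ((q @ [True]) @ z))"
    "rep s f q (Tn a b) = r" "links s f q (Tn a b) = insert (ra, rb) (Ea \<union> Eb)"
    "rep s f q (Pr a b) = r" "links s f q (Pr a b) = Ea \<union> Eb"
proof -
  obtain s where s: "s (f q) = (r \<noteq> ra)" "\<And>z. s (f ((q @ [False]) @ z)) = s1 (f ((q @ [False]) @ z))"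
    "\<And>z. s (f ((q @ [True]) @ z)) = s2 (f ((q @ [True]) @ z))"
    using glue_switchings[OF f, of q "r \<noteq> ra" s1 s2] by blast
  note ca = rep_links_cong[of s f "q @ [False]" s1 a, OF s(2)]
  note cb = rep_links_cong[of s f "q @ [True]" s2 b, OF s(3)]
  show thesis
    by (rule that[of s]) (use ca cb s a b r in auto)
qed

lemma sw_realize:
  assumes f: "inj f"
  shows "(r, E) \<in> sw t \<Longrightarrow> \<exists>s. rep s f q t = r \<and> links s f q t = E"
proof (induction t arbitrary: q r E)
  case (Tn a b)
  from Tn.prems obtain ra rb Ea Eb where E: "(ra, Ea) \<in> sw a" "(rb, Eb) \<in> sw b" "r = ra \<or> r = rb"
    "E = insert (ra, rb) (Ea \<union> Eb)" by (rule sw_TnE)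
  from Tn.IH(1)[OF E(1)] obtain s1 where s1: "rep s1 f (q @ [False]) a = ra" "links s1 f (q @ [False]) a = Ea" by blast
  from Tn.IH(2)[OF E(2)] obtain s2 where s2: "rep s2 f (q @ [True]) b = rb" "links s2 f (q @ [True]) b = Eb" by blast
  show ?case using realize_node[OF f s1 s2 E(3)] E(4) by metis
next
  case (Pr a b)
  from Pr.prems obtain ra rb Ea Eb where E: "(ra, Ea) \<in> sw a" "(rb, Eb) \<in> sw b" "r = ra \<or> r = rb"
    "E = Ea \<union> Eb" by (rule sw_PrE)
  from Pr.IH(1)[OF E(1)] obtain s1 where s1: "rep s1 f (q @ [False]) a = ra" "links s1 f (q @ [False]) a = Ea" by blast
  from Pr.IH(2)[OF E(2)] obtain s2 where s2: "rep s2 f (q @ [True]) b = rb" "links s2 f (q @ [True]) b = Eb" by blast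
  show ?case using realize_node[OF f s1 s2 E(3)] E(4) by metis
qed auto

lemma subt_Cons_cases:
  assumes "subt P (d # p) = Some t"
  obtains a b where "P = Tn a b" "subt (if d then b else a) p = Some t"
  | a b where "P = Pr a b" "subt (if d then b else a) p = Some t"
  using assms by (cases P; cases d) auto

text \<open>Realisation through a context when the tree \<open>t\<close> in the hole has a node at
  relative path \<open>z\<close> that must be switched to its left premise. In the intended use
  \<open>t\<close> carries a bottom below that node, \<open>u\<close> is the same tree with the
  bottom dropped, and the switching turns away from the bottom.\<close>

lemma sw_realize_repl:
  assumes f: "inj f"
    and u: "\<And>q' r' E'. q' = q @ p \<Longrightarrow> (r', E') \<in> sw u \<Longrightarrow> \<exists>s. \<not> s (f (q' @ z)) \<and> rep s f q' t = r' \<and> links s f q' t = E'"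
  shows "subt P p = Some t0 \<Longrightarrow> (r, E) \<in> sw (repl P p u) \<Longrightarrow>
    \<exists>s. \<not> s (f (q @ p @ z)) \<and> rep s f q (repl P p t) = r \<and> links s f q (repl P p t) = E"
  using u
proof (induction p arbitrary: P q r E)
  case Nil
  then show ?case by auto
next
  case (Cons d p)
  have node: "\<exists>s. \<not> s (f (q @ (d # p) @ z)) \<and>
     rep s f q (Tn (if d then a else repl a p t) (if d then repl b p t else b)) = r' \<and>
     links s f q (Tn (if d then a else repl a p t) (if d then repl b p t else b)) = insert (ra, rb) (Ea \<union> Eb) \<and>
     rep s f q (Pr (if d then a else repl a p t) (if d then repl b p t else b)) = r' \<and>
     links s f q (Pr (if d then a else repl a p t) (if d then repl b p t else b)) = Ea \<union> Eb"
    if ab: "(ra, Ea) \<in> sw (if d then a else repl a p u)" "(rb, Eb) \<in> sw (if d then repl b p u else b)"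
      "r' = ra \<or> r' = rb" "subt (if d then b else a) p = Some t0" for a b ra rb Ea Eb r'
  proof (cases d)
    case True
    from sw_realize[OF f, of ra Ea a "q @ [False]"] ab True obtain s1
      where s1: "rep s1 f (q @ [False]) a = ra" "links s1 f (q @ [False]) a = Ea" by auto
    from Cons.IH[of b rb Eb "q @ [True]"] ab True Cons.prems(3) obtain s2
      where s2: "rep s2 f (q @ [True]) (repl b p t) = rb" "links s2 f (q @ [True]) (repl b p t) = Eb"
        "\<not> s2 (f ((q @ [True]) @ p @ z))" by auto
    obtain s where s: "\<And>z. s (f ((q @ [True]) @ z)) = s2 (f ((q @ [True]) @ z))"
       "rep s f q (Tn a (repl b p t)) = r'" "links s f q (Tn a (repl b p t)) = insert (ra, rb) (Ea \<union> Eb)"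
       "rep s f q (Pr a (repl b p t)) = r'" "links s f q (Pr a (repl b p t)) = Ea \<union> Eb"
      using realize_node[OF f s1 s2(1,2) ab(3)] by metis
    then show ?thesis using s2(3) True s(1)[of "p @ z"] by (auto intro!: exI[of _ s])
  next
    case False
    from sw_realize[OF f, of rb Eb b "q @ [True]"] ab False obtain s2
      where s2: "rep s2 f (q @ [True]) b = rb" "links s2 f (q @ [True]) b = Eb" by auto
    from Cons.IH[of a ra Ea "q @ [False]"] ab False Cons.prems(3) obtain s1
      where s1: "rep s1 f (q @ [False]) (repl a p t) = ra" "links s1 f (q @ [False]) (repl a p t) = Ea"
        "\<not> s1 (f ((q @ [False]) @ p @ z))" by auto
    obtain s where s: "\<And>z. s (f ((q @ [False]) @ z)) = s1 (f ((q @ [False]) @ z))"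
       "rep s f q (Tn (repl a p t) b) = r'" "links s f q (Tn (repl a p t) b) = insert (ra, rb) (Ea \<union> Eb)"
       "rep s f q (Pr (repl a p t) b) = r'" "links s f q (Pr (repl a p t) b) = Ea \<union> Eb"
      using realize_node[OF f s1(1,2) s2 ab(3)] by metis
    then show ?thesis using s1(3) False s(1)[of "p @ z"] by (auto intro!: exI[of _ s])
  qed
  from Cons.prems(1) show ?case
  proof (cases rule: subt_Cons_cases)
    case (1 a b)
    then have "(r, E) \<in> sw (Tn (if d then a else repl a p u) (if d then repl b p u else b))"
      using Cons.prems(2) by (auto split: if_splits)
    then obtain ra rb Ea Eb where *: "(ra, Ea) \<in> sw (if d then a else repl a p u)"
      "(rb, Eb) \<in> sw (if d then repl b p u else b)" "r = ra \<or> r = rb" "E = insert (ra, rb) (Ea \<union> Eb)"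
      by (rule sw_TnE)
    have "repl P (d # p) t = Tn (if d then a else repl a p t) (if d then repl b p t else b)"
      using 1 by simp
    then show ?thesis using node[OF *(1-3) 1(2)] *(4) by metis
  next
    case (2 a b)
    then have "(r, E) \<in> sw (Pr (if d then a else repl a p u) (if d then repl b p u else b))"
      using Cons.prems(2) by (auto split: if_splits)
    then obtain ra rb Ea Eb where *: "(ra, Ea) \<in> sw (if d then a else repl a p u)"
      "(rb, Eb) \<in> sw (if d then repl b p u else b)" "r = ra \<or> r = rb" "E = Ea \<union> Eb"
      by (rule sw_PrE)
    have "repl P (d # p) t = Pr (if d then a else repl a p t) (if d then repl b p t else b)"
      using 2 by simp
    then show ?thesis using node[OF *(1-3) 2(2)] *(4) by metis
  qed
qed

lemma rep_links_repl:
  assumes "subt P p = Some t0" "(rep s f (q @ p) t, links s f (q @ p) t) \<in> sw u"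
  shows "(rep s f q (repl P p t), links s f q (repl P p t)) \<in> sw (repl P p u)"
  using assms
proof (induction p arbitrary: P q)
  case (Cons d p)
  from Cons.prems(1) show ?case
  proof (cases rule: subt_Cons_cases)
    case (1 a b)
    then show ?thesis using Cons.IH[OF 1(2), of "q @ [d]"] Cons.prems(2) rep_links_sw[of s f "q @ [False]" a]
        rep_links_sw[of s f "q @ [True]" b]
      by (cases d) (auto intro!: sw_Tn)
  next
    case (2 a b)
    then show ?thesis using Cons.IH[OF 2(2), of "q @ [d]"] Cons.prems(2) rep_links_sw[of s f "q @ [False]" a]
        rep_links_sw[of s f "q @ [True]" b]
      by (cases d) (auto intro!: sw_Pr)
  qed
qed auto

text \<open>Representatives of the roots are forgotten, since no edge leaves a root.\<close>

definition swl :: "'a tree list \<Rightarrow> (nat \<times> nat) set set" where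
  "swl ts = {\<Union>i<length ts. E i | E. \<forall>i<length ts. \<exists>r. (r, E i) \<in> sw (ts ! i)}"

lemma seq_links_swl: "seq_links s ts \<in> swl ts"
proof -
  have "\<forall>i<length ts. \<exists>r. (r, links s (VG i) [] (ts ! i)) \<in> sw (ts ! i)"
    using rep_links_sw by blast
  then show ?thesis
    unfolding swl_def seq_links_def by (intro CollectI exI[of _ "\<lambda>i. links s (VG i) [] (ts ! i)"]) auto
qed

text \<open>Vertices of the linking and of the roots have different constructors, so a choice for
  the sequent can be combined with any given choice \<open>s\<close> for the linking.\<close>

lemma swl_realize:
  assumes "F \<in> swl ts"
  obtains s' where "seq_links s' ts = F" "\<And>q. s' (VP q) = s (VP q)"
proof -
  from assms obtain E where E: "\<forall>i<length ts. \<exists>r. (r, E i) \<in> sw (ts ! i)" "F = (\<Union>i<length ts. E i)"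
    by (auto simp: swl_def)
  have "\<exists>s. links s (VG i) [] (ts ! i) = E i" if "i < length ts" for i
    using E(1) that sw_realize[of "VG i"] by fastforce
  then obtain S where S: "\<And>i. i < length ts \<Longrightarrow> links (S i) (VG i) [] (ts ! i) = E i" by metis
  define s' where "s' v = (case v of VG i q \<Rightarrow> S i v | _ \<Rightarrow> s v)" for v
  have "links s' (VG i) [] (ts ! i) = E i" if "i < length ts" for i
    using rep_links_cong[of s' "VG i" "[]" "S i" "ts ! i"] S[OF that] by (simp add: s'_def)
  then have "seq_links s' ts = F" by (simp add: seq_links_def E(2))
  then show thesis using that[of s'] by (simp add: s'_def)
qed

lemma swl_finite: "F \<in> swl ts \<Longrightarrow> finite F"
  by (auto simp: swl_def dest: sw_finite)

lemma swl_card: 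
  assumes "F \<in> swl ts" shows "card F \<le> sum_list (map tens ts)"
proof -
  from assms obtain E where E: "\<forall>i<length ts. \<exists>r. (r, E i) \<in> sw (ts ! i)" "F = (\<Union>i<length ts. E i)"
    by (auto simp: swl_def)
  have "card F \<le> (\<Sum>i<length ts. card (E i))" unfolding E(2) by (rule card_UN_le) simp
  also have "\<dots> \<le> (\<Sum>i<length ts. tens (ts ! i))" using E(1) by (intro sum_mono) (auto dest: sw_card)
  also have "\<dots> = sum_list (map tens ts)" by (simp add: sum_list_sum_nth atLeast0LessThan)
  finally show ?thesis .
qed

lemma swl_col: "(\<forall>t\<in>set ts. col S t \<noteq> {}) \<longleftrightarrow> (\<exists>F\<in>swl ts. resp S F)"
proof -
  have ne: "col S t \<noteq> {} \<longleftrightarrow> (\<exists>E r. (r, E) \<in> sw t \<and> resp S E)" for t :: "'a tree"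
    using col_sw[of _ S t] by blast
  have "(\<forall>t\<in>set ts. col S t \<noteq> {}) \<longleftrightarrow> (\<forall>i<length ts. \<exists>E. (\<exists>r. (r, E) \<in> sw (ts ! i)) \<and> resp S E)"
    unfolding ne by (auto simp: all_set_conv_all_nth) 
  also have "\<dots> \<longleftrightarrow> (\<exists>E. \<forall>i<length ts. (\<exists>r. (r, E i) \<in> sw (ts ! i)) \<and> resp S (E i))"
    by metis
  also have "\<dots> \<longleftrightarrow> (\<exists>F\<in>swl ts. resp S F)"
  proof
    assume "\<exists>E. \<forall>i<length ts. (\<exists>r. (r, E i) \<in> sw (ts ! i)) \<and> resp S (E i)"
    then obtain E where E: "\<forall>i<length ts. (\<exists>r. (r, E i) \<in> sw (ts ! i)) \<and> resp S (E i)" ..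
    then have "(\<Union>i<length ts. E i) \<in> swl ts" "resp S (\<Union>i<length ts. E i)"
      by (auto simp: swl_def resp_UN)
    then show "\<exists>F\<in>swl ts. resp S F" by blast
  next
    assume "\<exists>F\<in>swl ts. resp S F"
    then obtain E where "\<forall>i<length ts. \<exists>r. (r, E i) \<in> sw (ts ! i)" "resp S (\<Union>i<length ts. E i)"
      by (auto simp: swl_def)
    then show "\<exists>E. \<forall>i<length ts. (\<exists>r. (r, E i) \<in> sw (ts ! i)) \<and> resp S (E i)"
      by (auto simp: resp_UN intro!: exI[of _ E])
  qed
  finally show ?thesis .
qed

definition corr :: "'a tree \<Rightarrow> 'a tree list \<Rightarrow> bool" where
  "corr P ts \<longleftrightarrow>
     (\<forall>S. col S P \<noteq> {} \<longrightarrow> (\<forall>t\<in>set ts. col S t \<noteq> {}) \<longrightarrow> ids P \<inter> S = {} \<or> ids P \<subseteq> S) \<and>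
     card (ids P) = tens P + sum_list (map tens ts) + 1"

lemma corr_sw: "corr P ts \<longleftrightarrow>
   (\<forall>r E F. (r, E) \<in> sw P \<longrightarrow> F \<in> swl ts \<longrightarrow> con (ids P) (E \<union> F)) \<and>
   card (ids P) = tens P + sum_list (map tens ts) + 1"
proof -
  have "col S P \<noteq> {} \<longleftrightarrow> (\<exists>E r. (r, E) \<in> sw P \<and> resp S E)" for S
    using col_sw[of _ S P] by blast
  then show ?thesis unfolding corr_def swl_col con_def resp_simps by blast
qed

text \<open>From here on the graph is replaced by colourings of leaves and a count; positions return
  only with the side condition on bottoms.\<close>

theorem correct_corr:
  assumes "shared P (map rtree rs)"
  shows "correct P rs \<longleftrightarrow> corr P (map rtree rs)"
proof -
  have sum: "(\<Sum>i<length rs. tens (rtree (rs ! i))) = sum_list (map tens (map rtree rs))"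
    by (simp add: sum_list_sum_nth atLeast0LessThan)
  have "(\<forall>s. con (ids P) (links s VP [] P \<union> seq_links s (map rtree rs))) \<longleftrightarrow>
     (\<forall>r E F. (r, E) \<in> sw P \<longrightarrow> F \<in> swl (map rtree rs) \<longrightarrow> con (ids P) (E \<union> F))"
  proof (intro iffI allI impI)
    fix r E F
    assume *: "\<forall>s. con (ids P) (links s VP [] P \<union> seq_links s (map rtree rs))" "(r, E) \<in> sw P" "F \<in> swl (map rtree rs)"
    obtain s where s: "links s VP [] P = E" using sw_realize[OF inj_VP *(2), of "[]"] by blast
    obtain s' where s': "seq_links s' (map rtree rs) = F" "\<And>q. s' (VP q) = s (VP q)"
      using swl_realize[OF *(3), of s] by blast
    have "links s' VP [] P = E" using s rep_links_cong[of s' VP "[]" s P] s' by simp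
    then show "con (ids P) (E \<union> F)" using *(1) s' by metis
  next
    fix s
    assume "\<forall>r E F. (r, E) \<in> sw P \<longrightarrow> F \<in> swl (map rtree rs) \<longrightarrow> con (ids P) (E \<union> F)"
    then show "con (ids P) (links s VP [] P \<union> seq_links s (map rtree rs))"
      using rep_links_sw seq_links_swl by blast
  qed
  then show ?thesis
    unfolding correct_def correct_switching_iff[OF assms] corr_sw sum by auto
qed

section \<open>Moving bottoms\<close>

lemma subt_append: "subt P p = Some t \<Longrightarrow> subt P (p @ q) = subt t q"
proof (induction p arbitrary: P)
  case (Cons d p)
  from Cons.prems show ?case by (cases rule: subt_Cons_cases) (use Cons.IH in \<open>cases d; auto\<close>)+
qed auto

lemma repl_subt: "subt P p = Some t \<Longrightarrow> repl P p t = P"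
proof (induction p arbitrary: P)
  case (Cons d p)
  from Cons.prems show ?case by (cases rule: subt_Cons_cases) (use Cons.IH in \<open>cases d; auto\<close>)+
qed auto

lemma subt_repl: "subt P p = Some t0 \<Longrightarrow> subt (repl P p t) p = Some t"
proof (induction p arbitrary: P)
  case (Cons d p)
  from Cons.prems show ?case by (cases rule: subt_Cons_cases) (use Cons.IH in \<open>cases d; auto\<close>)+
qed auto

lemma repl_repl: "subt P p = Some t0 \<Longrightarrow> repl (repl P p t) p u = repl P p u"
proof (induction p arbitrary: P)
  case (Cons d p)
  from Cons.prems show ?case by (cases rule: subt_Cons_cases) (use Cons.IH in \<open>cases d; auto\<close>)+
qed auto

lemma tens_repl: "subt P p = Some t0 \<Longrightarrow> tens (repl P p u) + tens v = tens (repl P p v) + tens u"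
proof (induction p arbitrary: P)
  case (Cons d p)
  from Cons.prems show ?case by (cases rule: subt_Cons_cases) (use Cons.IH in \<open>cases d; fastforce\<close>)+
qed auto

lemma mset_leaves_repl: "subt P p = Some t0 \<Longrightarrow>
  mset (leaves (repl P p u)) + mset (leaves v) = mset (leaves (repl P p v)) + mset (leaves u)"
proof (induction p arbitrary: P)
  case (Cons d p)
  from Cons.prems show ?case 
    by (cases rule: subt_Cons_cases) (use Cons.IH in \<open>cases d; fastforce simp: ac_simps\<close>)+
qed auto

lemma col_repl: "col S t = col S u \<Longrightarrow> col S (repl P p t) = col S (repl P p u)"
proof (induction p arbitrary: P)
  case (Cons d p)
  then show ?case by (cases P; cases d) auto
qed auto

lemma ids_mset: "mset (leaves t) = mset (leaves u) \<Longrightarrow> ids t = ids u"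
  unfolding ids_def by (metis mset_eq_setD)

lemma shared_mset:
  assumes "mset (leaves t) = mset (leaves u)"
  shows "shared t ts = shared u ts"
proof -
  have "mset (map snd (leaves t)) = mset (map snd (leaves u))" using assms by (simp add: mset_map)
  then have "distinct (map snd (leaves t)) = distinct (map snd (leaves u))" by (rule mset_eq_imp_distinct_iff)
  then show ?thesis using mset_eq_setD[OF assms] by (simp add: shared_def)
qed

section \<open>One-hole contexts acting on switchings\<close>

definition node :: "(nat \<Rightarrow> nat \<Rightarrow> (nat \<times> nat) set) \<Rightarrow> (nat \<times> (nat \<times> nat) set) set \<Rightarrow>
    (nat \<times> (nat \<times> nat) set) set \<Rightarrow> (nat \<times> (nat \<times> nat) set) set" where
  "node J A B = {(r, J ra rb \<union> (Ea \<union> Eb)) | r ra rb Ea Eb. (ra, Ea) \<in> A \<and> (rb, Eb) \<in> B \<and> (r = ra \<or> r = rb)}"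

text \<open>The flipped versions let the hole of a context always be the second argument.\<close>

lemma sw_node:
  "sw (Tn a b) = node (\<lambda>x y. {(x, y)}) (sw a) (sw b)"
  "sw (Tn a b) = node (\<lambda>x y. {(y, x)}) (sw b) (sw a)"
  "sw (Pr a b) = node (\<lambda>x y. {}) (sw a) (sw b)"
  "sw (Pr a b) = node (\<lambda>x y. {}) (sw b) (sw a)"
proof -
  show "sw (Tn a b) = node (\<lambda>x y. {(x, y)}) (sw a) (sw b)" "sw (Pr a b) = node (\<lambda>x y. {}) (sw a) (sw b)"
    by (simp_all only: sw.simps node_def insert_is_Un[symmetric] Un_empty_left)
  show "sw (Tn a b) = node (\<lambda>x y. {(y, x)}) (sw b) (sw a)" "sw (Pr a b) = node (\<lambda>x y. {}) (sw b) (sw a)"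
    unfolding sw.simps node_def insert_is_Un[symmetric] Un_empty_left
    by (rule Collect_cong; metis Un_commute)+
qed

text \<open>A context acts on the root leaf r of its hole through g (new root leaf) and h (new
  edges). The following closure property is all that is needed about the dependence on r.\<close>
definition uniform :: "(nat \<Rightarrow> nat) \<Rightarrow> (nat \<Rightarrow> (nat \<times> nat) set) \<Rightarrow> bool" where
  "uniform g h \<longleftrightarrow> (\<forall>S1 S2 r1 r2 r. (r \<in> S1 \<inter> S2 \<longleftrightarrow> r1 \<in> S1 \<and> r2 \<in> S2) \<longrightarrow>
     (g r \<in> S1 \<inter> S2 \<longleftrightarrow> g r1 \<in> S1 \<and> g r2 \<in> S2) \<and>
     (resp S1 (h r1) \<longrightarrow> resp S2 (h r2) \<longrightarrow> resp (S1 \<inter> S2) (h r)))"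

lemma uniformD:
  assumes "uniform g h" "r \<in> S1 \<inter> S2 \<longleftrightarrow> r1 \<in> S1 \<and> r2 \<in> S2"
  shows "g r \<in> S1 \<inter> S2 \<longleftrightarrow> g r1 \<in> S1 \<and> g r2 \<in> S2"
    "resp S1 (h r1) \<Longrightarrow> resp S2 (h r2) \<Longrightarrow> resp (S1 \<inter> S2) (h r)"
  using assms unfolding uniform_def by blast+

definition plug :: "((nat \<Rightarrow> nat) \<times> (nat \<Rightarrow> (nat \<times> nat) set)) set \<Rightarrow>
    (nat \<times> (nat \<times> nat) set) set \<Rightarrow> (nat \<times> (nat \<times> nat) set) set" where
  "plug K B = {(g r, h r \<union> E) | g h r E. (g, h) \<in> K \<and> (r, E) \<in> B}"

lemma plugI: "(g, h) \<in> K \<Longrightarrow> (r, E) \<in> B \<Longrightarrow> (g r, h r \<union> E) \<in> plug K B"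
  unfolding plug_def by blast

text \<open>One more node is wrapped around a context. The flag \<open>c\<close> records whether the
  new root is represented by the leaf \<open>ra\<close> of the sibling or by that of the filled
  context; the hypothesis on \<open>J\<close> keeps the new link uniform.\<close>

lemma node_plug:
  assumes Ku: "\<forall>(g, h)\<in>K. uniform g h"
    and J: "\<And>S1 S2 x y y1 y2. (y \<in> S1 \<inter> S2 \<longleftrightarrow> y1 \<in> S1 \<and> y2 \<in> S2) \<Longrightarrow>
      resp S1 (J x y1) \<Longrightarrow> resp S2 (J x y2) \<Longrightarrow> resp (S1 \<inter> S2) (J x y)"
  shows "\<exists>K'. (\<forall>B. node J A (plug K B) = plug K' B) \<and> (\<forall>(g, h)\<in>K'. uniform g h)"
proof (intro exI[of _ "{(\<lambda>r. if c then ra else g r, \<lambda>r. J ra (g r) \<union> (Ea \<union> h r)) | c ra Ea g h.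
    (ra, Ea) \<in> A \<and> (g, h) \<in> K}"] conjI allI ballI)
  fix B
  let ?K' = "{(\<lambda>r. if c then ra else g r, \<lambda>r. J ra (g r) \<union> (Ea \<union> h r)) | c ra Ea g h. (ra, Ea) \<in> A \<and> (g, h) \<in> K}"
  show "node J A (plug K B) = plug ?K' B"
  proof (intro equalityI subsetI)
    fix e assume "e \<in> node J A (plug K B)"
    then obtain r ra Ea g h r0 E where e: "e = (r, J ra (g r0) \<union> (Ea \<union> (h r0 \<union> E)))" "(ra, Ea) \<in> A"
      "(g, h) \<in> K" "(r0, E) \<in> B" "r = ra \<or> r = g r0"
      unfolding node_def plug_def by blast
    have "(\<lambda>x. if r = ra then ra else g x, \<lambda>x. J ra (g x) \<union> (Ea \<union> h x)) \<in> ?K'"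
      using e(2,3) by blast
    from plugI[OF this e(4)] show "e \<in> plug ?K' B"
      using e(1,5) by (simp add: Un_assoc split: if_splits)
  next
    fix e assume "e \<in> plug ?K' B"
    then obtain c ra Ea g h r0 E where e: "e = (if c then ra else g r0, (J ra (g r0) \<union> (Ea \<union> h r0)) \<union> E)"
      "(ra, Ea) \<in> A" "(g, h) \<in> K" "(r0, E) \<in> B"
      unfolding plug_def by blast
    then have "e = (if c then ra else g r0, J ra (g r0) \<union> (Ea \<union> (h r0 \<union> E)))" by (simp add: Un_assoc)
    moreover have "(g r0, h r0 \<union> E) \<in> plug K B" using e unfolding plug_def by blast
    moreover have "(if c then ra else g r0) = ra \<or> (if c then ra else g r0) = g r0" by simp
    ultimately show "e \<in> node J A (plug K B)" unfolding node_def using e(2) by blast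
  qed
next
  fix gh assume "gh \<in> {(\<lambda>r. if c then ra else g r, \<lambda>r. J ra (g r) \<union> (Ea \<union> h r)) | c ra Ea g h. (ra, Ea) \<in> A \<and> (g, h) \<in> K}"
  then obtain c ra Ea g h where gh: "gh = (\<lambda>r. if c then ra else g r, \<lambda>r. J ra (g r) \<union> (Ea \<union> h r))" "(g, h) \<in> K"
    by blast
  show "case gh of (g, h) \<Rightarrow> uniform g h"
    unfolding gh prod.case uniform_def
    using uniformD[OF bspec[OF Ku gh(2), simplified]] J by (auto simp: resp_Int)
qed

text \<open>\<open>K\<close> depends on the surroundings of the hole only. Switchings of two
  different fillings can therefore be compared by feeding both to the same pair
  \<open>(g, h)\<close>.\<close>

lemma sw_context:
  "subt P p = Some t0 \<Longrightarrow> \<exists>K. (\<forall>t. sw (repl P p t) = plug K (sw t)) \<and> (\<forall>(g, h)\<in>K. uniform g h)"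
proof (induction p arbitrary: P)
  case Nil
  show ?case
    by (rule exI[of _ "{(\<lambda>r. r, \<lambda>r. {})}"]) (auto simp: plug_def uniform_def)
next
  case (Cons d p)
  have J: "resp (S1 \<inter> S2) {(x, y)}" "resp (S1 \<inter> S2) {(y, x)}"
    if "y \<in> S1 \<inter> S2 \<longleftrightarrow> y1 \<in> S1 \<and> y2 \<in> S2" "x \<in> S1 \<longleftrightarrow> y1 \<in> S1" "x \<in> S2 \<longleftrightarrow> y2 \<in> S2"
    for S1 S2 :: "nat set" and x y y1 y2
    using that by auto
  from Cons.prems show ?case
  proof (cases rule: subt_Cons_cases)
    case (1 a b)
    from Cons.IH[OF 1(2)] obtain K where K: "\<And>t. sw (repl (if d then b else a) p t) = plug K (sw t)"
      "\<forall>(g, h)\<in>K. uniform g h" by fast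
    show ?thesis
    proof (cases d)
      case True
      then have "sw (repl P (d # p) t) = node (\<lambda>x y. {(x, y)}) (sw a) (plug K (sw t))" for t
        using 1 K(1) by (simp add: sw_node(1))
      with node_plug[OF K(2), where J = "\<lambda>x y. {(x, y)}" and A = "sw a"] show ?thesis using J(1) by auto
    next
      case False
      then have "sw (repl P (d # p) t) = node (\<lambda>x y. {(y, x)}) (sw b) (plug K (sw t))" for t
        using 1 K(1) by (simp add: sw_node(2))
      with node_plug[OF K(2), where J = "\<lambda>x y. {(y, x)}" and A = "sw b"] show ?thesis using J(2) by auto
    qed
  next
    case (2 a b)
    from Cons.IH[OF 2(2)] obtain K where K: "\<And>t. sw (repl (if d then b else a) p t) = plug K (sw t)"
      "\<forall>(g, h)\<in>K. uniform g h" by fast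
    have "sw (repl P (d # p) t) = node (\<lambda>x y. {}) (sw (if d then a else b)) (plug K (sw t))" for t
      using 2 K(1)[of t] sw_node(3)[of a "repl b p t"] sw_node(4)[of "repl a p t" b] by (cases d) simp_all
    with node_plug[OF K(2), where J = "\<lambda>x y. {}" and A = "sw (if d then a else b)"] show ?thesis by auto
  qed
qed

lemma corr_con: "corr P ts \<Longrightarrow> (r, E) \<in> sw P \<Longrightarrow> F \<in> swl ts \<Longrightarrow> con (ids P) (E \<union> F)"
  by (simp add: corr_sw)

text \<open>The link between the bottom and the par below the same tensor is a bridge. If the bottom
  could be reached from \<open>Q\<close> or \<open>R\<close> without it, some switching would
  contain a redundant link, against the count. The difficulty is that the links \<open>h r0\<close>
  of the context vary with the leaf that stands for the hole; uniformity bridges the gap between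
  \<open>r0\<close> and an arbitrary leaf \<open>y\<close> of the hole.\<close>

lemma bot_bridge:
  assumes sub: "subt P p = Some t0" and corr: "corr (repl P p (Tn (Pr Q R) (Lf l i))) ts"
    and E: "(r, E) \<in> sw (repl P p (Pr Q R))" and F: "F \<in> swl ts" and x: "x \<in> ids Q \<union> ids R"
  shows "\<exists>S. resp S (E \<union> F) \<and> i \<in> S \<and> x \<notin> S"
proof -
  let ?P' = "repl P p (Tn (Pr Q R) (Lf l i))"
  obtain K where K: "\<And>t. sw (repl P p t) = plug K (sw t)" "\<And>g h. (g, h) \<in> K \<Longrightarrow> uniform g h"
    using sw_context[OF sub] by fast
  from E obtain g h r0 E0 where gh: "(g, h) \<in> K" and E0: "(r0, E0) \<in> sw (Pr Q R)" and Eq: "E = h r0 \<union> E0"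
    unfolding K(1) plug_def by blast
  \<comment> \<open>If \<open>i\<close> and \<open>y\<close> could not be separated, the link
    between them could be dropped without losing connectedness, leaving one link fewer than
    \<open>con_card\<close> requires.\<close>
  have noconn: "\<exists>S. resp S (h y) \<and> resp S F \<and> i \<in> S \<and> y \<notin> S" if y: "(y, E1) \<in> sw (Pr Q R)" for y E1
  proof (rule ccontr)
    assume no: "\<not> ?thesis"
    have yi: "y \<in> S \<longleftrightarrow> i \<in> S" if "resp S (h y)" "resp S F" for S
      using no that resp_Compl[OF that(1)] resp_Compl[OF that(2)] by blast
    have "(y, insert (y, i) (E1 \<union> {})) \<in> sw (Tn (Pr Q R) (Lf l i))"
      using y by (intro sw_Tn) auto
    from corr_con[OF corr plugI[OF gh this, folded K(1)] F] have "con (ids ?P') (h y \<union> insert (y, i) E1 \<union> F)"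
      by (simp add: Un_ac)
    then have "con (ids ?P') (h y \<union> E1 \<union> F)"
      using yi unfolding con_def by auto
    moreover have *: "(g y, h y \<union> E1) \<in> sw (repl P p (Pr Q R))" unfolding K(1) by (rule plugI[OF gh y])
    ultimately have "card (ids ?P') \<le> card (h y \<union> E1 \<union> F) + 1"
      using sw_finite[OF *] swl_finite[OF F] by (intro con_card) auto
    also have "card (h y \<union> E1 \<union> F) \<le> tens (repl P p (Pr Q R)) + sum_list (map tens ts)"
      using card_Un_le[of "h y \<union> E1" F] sw_card[OF *] swl_card[OF F] by linarith
    finally show False
      using corr tens_repl[OF sub, of "Tn (Pr Q R) (Lf l i)" "Pr Q R"] unfolding corr_def by simp
  qed
  \<comment> \<open>The component of \<open>i\<close> under the links outside the hole, for the
    given representative \<open>r0\<close>.\<close>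
  define K0 where "K0 = \<Inter>{S. resp S (h r0 \<union> F) \<and> i \<in> S}"
  have K0: "resp K0 (h r0 \<union> F)" unfolding K0_def by (rule resp_Inter) blast
  have iK0: "i \<in> K0" by (simp add: K0_def)
  have least: "K0 \<subseteq> S" if "resp S (h r0)" "resp S F" "i \<in> S" for S
    using that by (auto simp: K0_def)
  have "K0 \<inter> (ids Q \<union> ids R) = {}"
  proof (rule ccontr)
    assume "K0 \<inter> (ids Q \<union> ids R) \<noteq> {}"
    then obtain y where y: "y \<in> K0" "y \<in> ids (Pr Q R)" by auto
    have r0: "r0 \<notin> K0" using noconn[OF E0] least by blast
    \<comment> \<open>The leaf \<open>y\<close> is made the representative of the hole. Since
      \<open>r0\<close> is outside \<open>K0\<close>, and \<open>y\<close> is outside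
      \<open>S\<close>, uniformity makes the intersection closed for the representative
      \<open>r0\<close>; minimality of \<open>K0\<close> then puts \<open>y\<close> into
      \<open>S\<close>.\<close>
    from sw_rep_any[OF y(2)] noconn obtain S where S: "resp S (h y)" "resp S F" "i \<in> S" "y \<notin> S" by blast
    have "resp (K0 \<inter> S) (h r0)"
      using uniformD(2)[OF K(2)[OF gh], of r0 K0 S r0 y] K0 S r0 by simp
    moreover have "resp (K0 \<inter> S) F" using K0 S by (simp add: resp_Int)
    ultimately have "K0 \<subseteq> K0 \<inter> S" using least iK0 S by blast
    then show False using y S by blast
  qed
  moreover have "E0 \<subseteq> ids (Pr Q R) \<times> ids (Pr Q R)" using sw_ids[OF E0] by blast
  ultimately have "resp K0 E0" by (fastforce simp: resp_def)
  then have "resp K0 (E \<union> F)" using K0 by (simp add: Eq)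
  then show ?thesis using iK0 x \<open>K0 \<inter> (ids Q \<union> ids R) = {}\<close> by blast
qed

text \<open>The leaf-level form of \<open>bot_cond\<close>. The bottom is absent from the linking
  \<open>P\<close> here: once its edge is deleted, it hangs on the graph only through the
  sequent.\<close>

definition separated :: "'a tree \<Rightarrow> 'a tree list \<Rightarrow> 'a tree \<Rightarrow> nat \<Rightarrow> bool" where
  "separated P ts Q i \<longleftrightarrow> (\<forall>r E F. (r, E) \<in> sw P \<longrightarrow> F \<in> swl ts \<longrightarrow>
     (\<forall>x\<in>ids Q. \<exists>S. resp S (E \<union> F) \<and> i \<in> S \<and> x \<notin> S))"

lemma bot_tens_ids:
  assumes "subt P p = Some t0"
  shows "tens (repl P p (Tn (Pr Q R) (Lf l i))) = tens (repl P p (Pr Q (Tn R (Lf l i))))"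
    "ids (repl P p (Tn (Pr Q R) (Lf l i))) = ids (repl P p (Pr Q (Tn R (Lf l i))))"
proof -
  show "tens (repl P p (Tn (Pr Q R) (Lf l i))) = tens (repl P p (Pr Q (Tn R (Lf l i))))"
    using tens_repl[OF assms, of "Tn (Pr Q R) (Lf l i)" "Pr Q (Tn R (Lf l i))"] by simp
  show "ids (repl P p (Tn (Pr Q R) (Lf l i))) = ids (repl P p (Pr Q (Tn R (Lf l i))))"
    by (rule ids_mset)
      (use mset_leaves_repl[OF assms, of "Tn (Pr Q R) (Lf l i)" "Pr Q (Tn R (Lf l i))"] in simp)
qed

lemma ids_repl: "subt P p = Some t0 \<Longrightarrow> ids t \<subseteq> ids (repl P p t)"
proof (induction p arbitrary: P)
  case (Cons d p)
  from Cons.prems show ?case by (cases rule: subt_Cons_cases) (use Cons.IH in \<open>cases d; fastforce\<close>)+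
qed auto

text \<open>Before the move the bottom is linked to whichever premise the par shows, afterwards
  always to \<open>R\<close>. Only switchings that show \<open>Q\<close> differ. For these,
  subtracting the set provided by \<open>bot_bridge\<close> turns an offending colouring of the new
  graph into one of the old graph.\<close>

lemma corr_inward:
  assumes sub: "subt P p = Some t0" and corr: "corr (repl P p (Tn (Pr Q R) (Lf l i))) ts"
  shows "corr (repl P p (Pr Q (Tn R (Lf l i)))) ts"
  unfolding corr_sw
proof (intro conjI allI impI)
  let ?X = "ids (repl P p (Pr Q (Tn R (Lf l i))))"
  note eq = bot_tens_ids[OF sub, of Q R l i]
  show "card ?X = tens (repl P p (Pr Q (Tn R (Lf l i)))) + sum_list (map tens ts) + 1"
    using corr eq by (simp add: corr_def)
  fix r E F assume E: "(r, E) \<in> sw (repl P p (Pr Q (Tn R (Lf l i))))" and F: "F \<in> swl ts"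
  obtain K where K: "\<And>t. sw (repl P p t) = plug K (sw t)" "\<And>g h. (g, h) \<in> K \<Longrightarrow> uniform g h"
    using sw_context[OF sub] by fast
  from E obtain g h r0 E0 where gh: "(g, h) \<in> K" and E0: "(r0, E0) \<in> sw (Pr Q (Tn R (Lf l i)))"
    and Eq: "E = h r0 \<union> E0"
    unfolding K(1) plug_def by blast
  from E0 obtain rQ EQ rT ET where 1: "(rQ, EQ) \<in> sw Q" "(rT, ET) \<in> sw (Tn R (Lf l i))" "r0 = rQ \<or> r0 = rT"
    "E0 = EQ \<union> ET" by (rule sw_PrE)
  from 1(2) obtain rR ER where 2: "(rR, ER) \<in> sw R" "rT = rR \<or> rT = i" "ET = insert (rR, i) ER"
    by (rule sw_TnE) auto
  have X: "rQ \<in> ?X" "rR \<in> ?X" "i \<in> ?X"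
    using ids_repl[OF sub, of "Pr Q (Tn R (Lf l i))"] sw_ids[OF 1(1)] sw_ids[OF 2(1)] by auto
  have triv: "?X \<inter> S = {} \<or> ?X \<subseteq> S"
    if "y = rQ \<or> y = rR" "z = y \<or> z = i" "resp S (h z)" "y \<in> S \<longleftrightarrow> i \<in> S" "resp S EQ" "resp S ER" "resp S F"
    for S y z
  proof -
    have "(y, EQ \<union> ER) \<in> sw (Pr Q R)" using sw_Pr[OF 1(1) 2(1) that(1)] .
    then have "(z, insert (y, i) (EQ \<union> ER \<union> {})) \<in> sw (Tn (Pr Q R) (Lf l i))"
      using that(2) by (intro sw_Tn) auto
    from corr_con[OF corr plugI[OF gh this, folded K(1)] F] have "con ?X (h z \<union> insert (y, i) (EQ \<union> ER) \<union> F)"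
      by (simp add: eq Un_ac)
    then show ?thesis using that by (auto simp: con_def)
  qed
  have PrQR: "(rQ, EQ \<union> ER) \<in> sw (Pr Q R)" using sw_Pr[OF 1(1) 2(1)] by blast
  show "con ?X (E \<union> F)"
    unfolding con_def
  proof (intro allI impI)
    fix S assume S: "resp S (E \<union> F)"
    then have S': "resp S (h r0)" "resp S EQ" "resp S ER" "resp S F" "rR \<in> S \<longleftrightarrow> i \<in> S"
      by (auto simp: Eq 1 2)
    consider "r0 = rT" | "r0 = rQ" "rQ \<in> S \<longleftrightarrow> i \<in> S" | "r0 = rQ" "rQ \<in> S \<longleftrightarrow> i \<notin> S" using 1(3) by blast
    then show "?X \<inter> S = {} \<or> ?X \<subseteq> S"
    proof cases
      case 1
      then show ?thesis using triv[of rR r0 S] S' 2(2) by blast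
    next
      case 2
      then show ?thesis using triv[of rQ r0 S] S' by blast
    next
      case 3
      have hQ: "(g rQ, h rQ \<union> (EQ \<union> ER)) \<in> sw (repl P p (Pr Q R))" unfolding K(1) by (rule plugI[OF gh PrQR])
      have "rR \<in> ids Q \<union> ids R" using sw_ids[OF 2(1)] by blast
      from bot_bridge[OF sub corr hQ F this] obtain S2 where
        S2: "resp S2 (h rQ)" "resp S2 EQ" "resp S2 ER" "resp S2 F" "i \<in> S2" "rR \<notin> S2" by auto
      \<comment> \<open>Otherwise \<open>S2\<close> would obey the old link from \<open>rQ\<close>
        to \<open>i\<close> and yet be nontrivial, containing \<open>i\<close> but not
        \<open>rR\<close>.\<close>
      have rQ: "rQ \<notin> S2" using triv[of rQ rQ S2] S2 X by blast
      \<comment> \<open>\<open>S\<close> is oriented to contain \<open>i\<close>. Removing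
        \<open>S2\<close> leaves \<open>rR\<close> inside and both \<open>rQ\<close> and
        \<open>i\<close> outside: a nontrivial colouring that obeys the old link.\<close>
      define S3 where "S3 = (if i \<in> S then S else - S)"
      have S3: "resp S3 (h rQ)" "resp S3 EQ" "resp S3 ER" "resp S3 F" "i \<in> S3" "rR \<in> S3" "rQ \<notin> S3"
        using S' 3 by (auto simp: S3_def resp_Compl)
      have "?X \<inter> (S3 - S2) = {} \<or> ?X \<subseteq> S3 - S2"
        by (rule triv[of rQ rQ]) (use S2 S3 rQ in \<open>auto intro: resp_Diff\<close>)
      then show ?thesis using S3 S2 X by blast
    qed
  qed
qed

text \<open>The mirror image of \<open>corr_inward\<close>. The separating set, which
  \<open>bot_bridge\<close> provides there, is supplied by \<open>separated\<close> here.\<close>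

lemma corr_outward:
  assumes sub: "subt P p = Some t0" and corr: "corr (repl P p (Pr Q (Tn R (Lf l i)))) ts"
    and sep: "separated (repl P p (Pr Q R)) ts Q i"
  shows "corr (repl P p (Tn (Pr Q R) (Lf l i))) ts"
  unfolding corr_sw
proof (intro conjI allI impI)
  let ?X = "ids (repl P p (Tn (Pr Q R) (Lf l i)))"
  note eq = bot_tens_ids[OF sub, of Q R l i]
  show "card ?X = tens (repl P p (Tn (Pr Q R) (Lf l i))) + sum_list (map tens ts) + 1"
    using corr eq by (simp add: corr_def)
  fix r E F assume E: "(r, E) \<in> sw (repl P p (Tn (Pr Q R) (Lf l i)))" and F: "F \<in> swl ts"
  obtain K where K: "\<And>t. sw (repl P p t) = plug K (sw t)" "\<And>g h. (g, h) \<in> K \<Longrightarrow> uniform g h"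
    using sw_context[OF sub] by fast
  from E obtain g h z E0 where gh: "(g, h) \<in> K" and E0: "(z, E0) \<in> sw (Tn (Pr Q R) (Lf l i))"
    and Eq: "E = h z \<union> E0"
    unfolding K(1) plug_def by blast
  from E0 obtain y E1 where 0: "(y, E1) \<in> sw (Pr Q R)" "z = y \<or> z = i" "E0 = insert (y, i) E1"
    by (rule sw_TnE) auto
  from 0(1) obtain rQ EQ rR ER where 1: "(rQ, EQ) \<in> sw Q" "(rR, ER) \<in> sw R" "y = rQ \<or> y = rR"
    "E1 = EQ \<union> ER" by (rule sw_PrE)
  have X: "rQ \<in> ?X" "rR \<in> ?X" "i \<in> ?X"
    using ids_repl[OF sub, of "Tn (Pr Q R) (Lf l i)"] sw_ids[OF 1(1)] sw_ids[OF 1(2)] by auto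
  have triv: "?X \<inter> S = {} \<or> ?X \<subseteq> S"
    if "z = rQ \<or> z = rR \<or> z = i" "resp S (h z)" "rR \<in> S \<longleftrightarrow> i \<in> S" "resp S EQ" "resp S ER" "resp S F"
    for S z
  proof -
    \<comment> \<open>\<open>w\<close> stands for the inner tensor. When the outer par shows
      \<open>rQ\<close>, the tensor may be represented by either of its sides, and \<open>rR\<close>
      is taken.\<close>
    define w where "w = (if z = rQ then rR else z)"
    have w: "(w, insert (rR, i) (ER \<union> {})) \<in> sw (Tn R (Lf l i))"
      using that(1) 1(2) by (intro sw_Tn) (auto simp: w_def)
    have "(z, EQ \<union> insert (rR, i) (ER \<union> {})) \<in> sw (Pr Q (Tn R (Lf l i)))"
      using sw_Pr[OF 1(1) w, of z] by (simp add: w_def)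
    from corr_con[OF corr plugI[OF gh this, folded K(1)] F] have "con ?X (h z \<union> (EQ \<union> insert (rR, i) ER) \<union> F)"
      by (simp add: eq Un_ac)
    then show ?thesis using that by (auto simp: con_def)
  qed
  have PrQR: "(rQ, EQ \<union> ER) \<in> sw (Pr Q R)" using sw_Pr[OF 1(1) 1(2)] by blast
  show "con ?X (E \<union> F)"
    unfolding con_def
  proof (intro allI impI)
    fix S assume S: "resp S (E \<union> F)"
    then have S': "resp S (h z)" "resp S EQ" "resp S ER" "resp S F" "y \<in> S \<longleftrightarrow> i \<in> S"
      by (auto simp: Eq 0 1)
    show "?X \<inter> S = {} \<or> ?X \<subseteq> S"
    proof (cases "rR \<in> S \<longleftrightarrow> i \<in> S")
      case True
      then show ?thesis using triv[of z S] S' 0(2) 1(3) by blast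
    next
      case False
      then have y: "y = rQ" using 1(3) S'(5) by blast
      have hQ: "(g rQ, h rQ \<union> (EQ \<union> ER)) \<in> sw (repl P p (Pr Q R))" unfolding K(1) by (rule plugI[OF gh PrQR])
      have "rQ \<in> ids Q" using sw_ids[OF 1(1)] by blast
      then have "\<exists>S. resp S (h rQ \<union> (EQ \<union> ER) \<union> F) \<and> i \<in> S \<and> rQ \<notin> S"
        using sep hQ F unfolding separated_def by blast
      then obtain S2 where
        S2: "resp S2 (h rQ)" "resp S2 EQ" "resp S2 ER" "resp S2 F" "i \<in> S2" "rQ \<notin> S2"
        by auto
      have rR: "rR \<notin> S2" using triv[of rQ S2] S2 X by blast
      \<comment> \<open>The representative \<open>z\<close> is \<open>rQ\<close> or
        \<open>i\<close>, which \<open>S\<close> colours alike; uniformity with \<open>S\<close>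
        taken twice exchanges it for \<open>rQ\<close>.\<close>
      have "resp S (h rQ)"
        using uniformD(2)[OF K(2)[OF gh], of rQ S S z z] S' 0(2) y by auto
      define S3 where "S3 = (if i \<in> S then S else - S)"
      have S3: "resp S3 (h rQ)" "resp S3 EQ" "resp S3 ER" "resp S3 F" "i \<in> S3" "rR \<notin> S3" "rQ \<in> S3"
        using S' \<open>resp S (h rQ)\<close> False y by (auto simp: S3_def resp_Compl)
      have "?X \<inter> (S3 - S2) = {} \<or> ?X \<subseteq> S3 - S2"
        by (rule triv[of rQ]) (use S2 S3 in \<open>auto intro: resp_Diff\<close>)
      then show ?thesis using S3 S2 X by blast
    qed
  qed
qed

section \<open>The side condition as separation\<close>

lemma vtx_repl:
  assumes "subt P p = Some t0" "\<And>q. vtx f q t = vtx f q t0"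
  shows "vtx f q (repl P p t) = vtx f q P"
proof (cases p)
  case Nil
  then show ?thesis using assms by auto
next
  case (Cons d p')
  with assms(1) have "subt P (d # p') = Some t0" by simp
  then show ?thesis by (cases rule: subt_Cons_cases) (use Cons in auto)
qed

lemma tedges_subt: "subt P p = Some t \<Longrightarrow> tedges f (q @ p) t \<subseteq> tedges f q P"
proof (induction p arbitrary: P q)
  case (Cons d p)
  from Cons.prems show ?case
  proof (cases rule: subt_Cons_cases)
    case (1 a b)
    with Cons.IH[OF 1(2), of "q @ [d]"] show ?thesis by (cases d) auto
  next
    case (2 a b)
    with Cons.IH[OF 2(2), of "q @ [d]"] show ?thesis by (cases d) auto
  qed
qed auto

lemma tedges_other_parent:
  assumes "v \<notin> inner f p t"
  shows "tedges f p t - {(u, v, d, k)} = tedges f p t"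
    "(\<And>w. w \<noteq> v \<Longrightarrow> s' w = s w) \<Longrightarrow> switched (tedges f p t) s' = switched (tedges f p t) s"
proof -
  have *: "w \<noteq> v" if "(u', w, d', k') \<in> tedges f p t" for u' w d' k'
  proof -
    have "(u', w) \<in> epairs (tedges f p t)" using that by (force simp: epairs_def)
    from tedges_parent[OF this] show ?thesis using assms by auto
  qed
  then show "tedges f p t - {(u, v, d, k)} = tedges f p t" by blast
  show "switched (tedges f p t) s' = switched (tedges f p t) s" if "\<And>w. w \<noteq> v \<Longrightarrow> s' w = s w"
    using * that by (auto simp: switched_def)
qed

text \<open>Deleting the edge from bottom to its tensor parent has the same effect as turning this
  parent into a par node that is switched to its other child.\<close>
lemma tedges_cut_bot:
  assumes f: "inj f" and sub: "subt P p = Some (Pr Q (Tn R (Lf l i)))"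
    and s': "\<not> s' (f (q @ p @ [True]))" "\<And>w. w \<noteq> f (q @ p @ [True]) \<Longrightarrow> s' w = s w"
  shows "epairs (switched (tedges f q P - {(VL i, f (q @ p @ [True]), True, False)}) s) =
    epairs (switched (tedges f q (repl P p (Pr Q (Pr R (Lf l i))))) s')"
  using sub s'
proof (induction p arbitrary: P q)
  case Nil
  let ?v = "f (q @ [True])" and ?e = "(VL i, f (q @ [True]), True, False)"
  have nQ: "?v \<notin> inner f (q @ [False]) Q" using f by (auto dest!: inner_sub dest: injD)
  have nR: "?v \<notin> inner f (q @ [True, False]) R" using f by (auto dest!: inner_sub dest: injD)
  have neq: "f q \<noteq> ?v" using f by (auto dest: injD)
  have s': "\<not> s' ?v" "\<And>w. w \<noteq> ?v \<Longrightarrow> s' w = s w" using Nil by auto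
  note sw' = tedges_other_parent(2)[OF nQ s'(2)] tedges_other_parent(2)[OF nR s'(2)]
  have P: "P = Pr Q (Tn R (Lf l i))" using Nil by simp
  show ?case
    using neq s'(1) s'(2)[OF neq]
    by (simp add: P insert_Diff_if Un_Diff tedges_other_parent(1)[OF nQ] tedges_other_parent(1)[OF nR] sw')
next
  case (Cons d p)
  let ?v = "f (q @ (d # p) @ [True])"
  have neq: "f q \<noteq> ?v" using f by (auto dest: injD)
  note s' = Cons.prems(2,3)
  have s'q: "s' (f q) = s (f q)" using s'(2)[OF neq] .
  have other: "tedges f (q @ [\<not> d]) t - {(VL i, ?v, True, False)} = tedges f (q @ [\<not> d]) t"
     "switched (tedges f (q @ [\<not> d]) t) s' = switched (tedges f (q @ [\<not> d]) t) s" for t :: "'a tree"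
  proof -
    have nv: "?v \<notin> inner f (q @ [\<not> d]) t" using f by (auto dest!: inner_sub dest: injD)
    show "tedges f (q @ [\<not> d]) t - {(VL i, ?v, True, False)} = tedges f (q @ [\<not> d]) t"
      by (rule tedges_other_parent(1)[OF nv])
    show "switched (tedges f (q @ [\<not> d]) t) s' = switched (tedges f (q @ [\<not> d]) t) s"
      by (rule tedges_other_parent(2)[OF nv s'(2)])
  qed
  have vt: "vtx f q' (repl c p (Pr Q (Pr R (Lf l i)))) = vtx f q' c"
    if "subt c p = Some (Pr Q (Tn R (Lf l i)))" for c q'
    by (rule vtx_repl[OF that]) simp
  from Cons.prems(1) show ?case
  proof (cases rule: subt_Cons_cases)
    case (1 a b)
    with Cons.IH[OF 1(2), of "q @ [d]"] s' neq s'q vt[OF 1(2)] other show ?thesis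
      by (cases d) (simp_all add: insert_Diff_if Un_Diff)
  next
    case (2 a b)
    with Cons.IH[OF 2(2), of "q @ [d]"] s' neq s'q vt[OF 2(2)] other show ?thesis
      by (cases d) (simp_all add: insert_Diff_if Un_Diff)
  qed
qed

lemma switched_mono: "E \<subseteq> F \<Longrightarrow> switched E s \<subseteq> switched F s"
  by (auto simp: switched_def)

lemma switched_cong: "(\<And>u v d k. (u, v, d, k) \<in> E \<Longrightarrow> s v = s' v) \<Longrightarrow> switched E s = switched E s'"
  by (auto simp: switched_def)

lemma bot_graph_cut:
  fixes P :: "'a tree"
  assumes sub: "subt P p = Some (Pr Q (Tn R (Lf l i)))"
  shows "epairs (switched (graph_edges P rs - {(VL i, VP (p @ [True]), True, False)}) s) =
    epairs (switched (graph_edges (repl P p (Pr Q (Pr R (Lf l i)))) rs) (s(VP (p @ [True]) := False)))"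
proof -
  let ?e = "(VL i, VP (p @ [True]), True, False)"
  let ?R = "\<Union>j<length rs. redges j (rs ! j)"
  have par: "w \<noteq> VP (p @ [True])" if "(u, w, d, k) \<in> ?R" for u w d k
  proof -
    from that obtain j where "(u, w, d, k) \<in> tedges (VG j) [] (rtree (rs ! j))" by (auto simp: redges_rtree)
    then have "(u, w) \<in> epairs (tedges (VG j) [] (rtree (rs ! j)))" by (force simp: epairs_def)
    from tedges_parent[OF this] show ?thesis by auto
  qed
  have "?R - {?e} = ?R" using par by blast
  moreover have "switched ?R s = switched ?R (s(VP (p @ [True]) := False))"
    by (rule switched_cong) (use par in auto)
  ultimately show ?thesis
    using tedges_cut_bot[OF inj_VP sub, of "s(VP (p @ [True]) := False)" "[]" s] by (simp add: graph_edges_def Un_Diff)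
qed

text \<open>In \<open>?P0\<close> the bottom hangs from a par. Turned away from it, the switchings
  of \<open>?P0\<close> have the same effect on leaves as those of the linking without the bottom,
  and the same components as the graph in \<open>bot_cond\<close>. The component of \<open>i\<close>
  serves as separating set in one direction; in the other, a separating set refutes
  reachability.\<close>

lemma bot_cond_iff:
  fixes P :: "'a tree"
  assumes shared: "shared P (map rtree rs)" and sub: "subt P p = Some (Pr Q (Tn R (Lf LB i)))"
  shows "bot_cond rs P p Q i \<longleftrightarrow> separated (repl P p (Pr Q R)) (map rtree rs) Q i"
proof -
  let ?v = "VP (p @ [True])"
  let ?P0 = "repl P p (Pr Q (Pr R (Lf LB i)))"
  define G where "G s = switched (graph_edges ?P0 rs) s" for s
  have adj: "adj (switched (graph_edges P rs - {(VL i, ?v, True, False)}) s) = adj (G (s(?v := False)))" for s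
    unfolding G_def by (simp add: fun_eq_iff adj_epairs bot_graph_cut[OF sub])
  have subQ: "subt ?P0 (p @ [False]) = Some Q"
    using subt_append[OF subt_repl[OF sub], of _ "[False]"] by simp
  show ?thesis
  proof
    assume bc: "bot_cond rs P p Q i"
    show "separated (repl P p (Pr Q R)) (map rtree rs) Q i"
      unfolding separated_def
    proof (intro allI impI ballI)
      fix r E F x assume E: "(r, E) \<in> sw (repl P p (Pr Q R))" and F: "F \<in> swl (map rtree rs)" and x: "x \<in> ids Q"
      have "\<exists>s. \<not> s (VP ([] @ p @ [True])) \<and> rep s VP [] ?P0 = r \<and> links s VP [] ?P0 = E"
      proof (rule sw_realize_repl[OF inj_VP _ sub E])
        fix q' r' E' assume "(r', E') \<in> sw (Pr Q R)"
        then obtain rQ EQ rR ER where 1: "(rQ, EQ) \<in> sw Q" "(rR, ER) \<in> sw R" "r' = rQ \<or> r' = rR" "E' = EQ \<union> ER"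
          by (rule sw_PrE)
        obtain s1 where s1: "rep s1 VP (q' @ [False]) Q = rQ" "links s1 VP (q' @ [False]) Q = EQ"
          using sw_realize[OF inj_VP 1(1)] by blast
        obtain s2 where s2: "rep s2 VP (q' @ [True, False]) R = rR" "links s2 VP (q' @ [True, False]) R = ER"
          using sw_realize[OF inj_VP 1(2)] by blast
        let ?s = "s2(VP (q' @ [True]) := False)"
        have "rep ?s VP (q' @ [True, False]) R = rR" "links ?s VP (q' @ [True, False]) R = ER"
          using rep_links_cong[of ?s VP "q' @ [True, False]" s2 R] s2 by auto
        then have s3: "rep ?s VP (q' @ [True]) (Pr R (Lf LB i)) = rR" "links ?s VP (q' @ [True]) (Pr R (Lf LB i)) = ER"
          by simp_all
        obtain s where "\<And>z. s (VP ((q' @ [True]) @ z)) = ?s (VP ((q' @ [True]) @ z))"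
          "rep s VP q' (Pr Q (Pr R (Lf LB i))) = r'" "links s VP q' (Pr Q (Pr R (Lf LB i))) = EQ \<union> ER"
          using realize_node[OF inj_VP s1 s3 1(3)] by metis
        from this(2,3) this(1)[of "[]"]
        show "\<exists>s. \<not> s (VP (q' @ [True])) \<and> rep s VP q' (Pr Q (Pr R (Lf LB i))) = r' \<and>
            links s VP q' (Pr Q (Pr R (Lf LB i))) = E'"
          using 1(4) by (intro exI[of _ s]) simp
      qed
      then obtain s where s: "\<not> s ?v" "links s VP [] ?P0 = E" by auto
      obtain s' where s': "seq_links s' (map rtree rs) = F" "\<And>q. s' (VP q) = s (VP q)"
        using swl_realize[OF F, of s] by blast
      have E': "links s' VP [] ?P0 = E" using rep_links_cong[of s' VP "[]" s ?P0] s s' by simp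
      \<comment> \<open>The realised switching is already turned away from the bottom, so the update
        in \<open>adj\<close> changes nothing and \<open>bot_cond\<close> speaks about this
        graph.\<close>
      have upd: "s'(?v := False) = s'" by (rule fun_upd_idem) (simp add: s s'(2))
      let ?C = "{w. (adj (G s'))\<^sup>*\<^sup>* (VL i) w}"
      have "VL x \<notin> ?C"
      proof
        assume "VL x \<in> ?C"
        then have "(adj (G s'))\<^sup>*\<^sup>* (VL x) (VL i)" using reach_sym by blast
        moreover have "VL x \<in> tverts VP (p @ [False]) Q" by (rule leaf_tverts[OF x])
        moreover from bc have "\<not> (adj (G (s'(?v := False))))\<^sup>*\<^sup>* y (VL i)" if "y \<in> tverts VP (p @ [False]) Q" for y
          using that unfolding bot_cond_def adj by blast
        ultimately show False unfolding upd by blast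
      qed
      moreover have "resp {n. VL n \<in> ?C} (E \<union> F)"
        using resp_leaves_graph[OF resp_component[of "G s'" "VL i", unfolded G_def]] E' s'(1) by (simp add: G_def)
      ultimately show "\<exists>S. resp S (E \<union> F) \<and> i \<in> S \<and> x \<notin> S"
        by (intro exI[of _ "{n. VL n \<in> ?C}"]) auto
    qed
  next
    assume sep: "separated (repl P p (Pr Q R)) (map rtree rs) Q i"
    show "bot_cond rs P p Q i"
      unfolding bot_cond_def
    proof (intro allI ballI notI)
      fix s x
      assume x: "x \<in> tverts VP (p @ [False]) Q"
        and "(adj (switched (graph_edges P rs - {(VL i, ?v, True, False)}) s))\<^sup>*\<^sup>* x (VL i)"
      then have reach: "(adj (G (s(?v := False))))\<^sup>*\<^sup>* (VL i) x" unfolding adj by (rule_tac reach_sym)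
      let ?s = "s(?v := False)"
      let ?C = "{w. (adj (G ?s))\<^sup>*\<^sup>* (VL i) w}"
      have resp: "resp ?C (epairs (G ?s))" by (rule resp_component)
      have subE: "epairs (switched (tedges VP (p @ [False]) Q) ?s) \<subseteq> epairs (G ?s)"
        unfolding G_def
        by (intro epairs_mono switched_mono) (use tedges_subt[OF subQ, of VP "[]"] in \<open>auto simp: graph_edges_def\<close>)
      \<comment> \<open>Separation speaks of leaves while \<open>bot_cond\<close> speaks of all
        nodes of \<open>Q\<close>; but a component that misses every leaf of \<open>Q\<close> misses
        every node of it.\<close>
      have "\<exists>n\<in>ids Q. VL n \<in> ?C"
      proof (rule ccontr)
        assume "\<not> ?thesis"
        then have "VL ` ids Q \<subseteq> - ?C" by blast
        then have "tverts VP (p @ [False]) Q \<subseteq> - ?C"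
          using resp_cover[OF resp_mono[OF resp_Compl[OF resp] subE]] by blast
        then show False using x reach by blast
      qed
      then obtain n where n: "n \<in> ids Q" "(adj (G ?s))\<^sup>*\<^sup>* (VL i) (VL n)" by blast
      have "(rep ?s VP p (Pr Q (Pr R (Lf LB i))), links ?s VP p (Pr Q (Pr R (Lf LB i)))) \<in> sw (Pr Q R)"
        using sw_Pr[OF rep_links_sw rep_links_sw, of _ ?s VP "p @ [False]" Q ?s VP "p @ [True, False]" R] by auto
      then have "(rep ?s VP [] ?P0, links ?s VP [] ?P0) \<in> sw (repl P p (Pr Q R))"
        using rep_links_repl[OF sub, of ?s VP "[]"] by simp
      then obtain S where S: "resp S (links ?s VP [] ?P0 \<union> seq_links ?s (map rtree rs))" "i \<in> S" "n \<notin> S"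
        using sep n(1) seq_links_swl unfolding separated_def by blast
      from resp_reach[OF resp_retract_graph[OF S(1)] n(2)[unfolded G_def]] S(2,3) show False by simp
    qed
  qed
qed

section \<open>Rewriting linkings\<close>

text \<open>As an equation of multisets, sharing can be rewritten, cancelled and filtered.\<close>

lemma shared_iff: "shared P ts \<longleftrightarrow> distinct (map snd (leaves P)) \<and> mset (leaves P) = mset (concat (map leaves ts))"
proof -
  have "mset (leaves P) = mset (concat (map leaves ts)) \<longleftrightarrow>
      distinct (map snd (concat (map leaves ts))) \<and> set (leaves P) = set (concat (map leaves ts))"
    if d: "distinct (map snd (leaves P))"
  proof
    assume eq: "mset (leaves P) = mset (concat (map leaves ts))"
    then have "mset (map snd (leaves P)) = mset (map snd (concat (map leaves ts)))" by (simp only: mset_map)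
    then show "distinct (map snd (concat (map leaves ts))) \<and> set (leaves P) = set (concat (map leaves ts))"
      using d mset_eq_imp_distinct_iff mset_eq_setD[OF eq] by blast
  next
    assume "distinct (map snd (concat (map leaves ts))) \<and> set (leaves P) = set (concat (map leaves ts))"
    then show "mset (leaves P) = mset (concat (map leaves ts))"
      using d by (metis distinct_map set_eq_iff_mset_eq_distinct)
  qed
  then show ?thesis unfolding shared_def by blast
qed

lemma corr_cong:
  assumes "\<And>S. col S P = col S P'" "tens P = tens P'" "ids P = ids P'"
  shows "corr P ts = corr P' ts"
  using assms by (simp add: corr_def)

lemma corr_perm: "mset ts = mset ts' \<Longrightarrow> corr P ts = corr P ts'"
proof -
  assume eq: "mset ts = mset ts'"
  then have "sum_list (map tens ts) = sum_list (map tens ts')"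
    by (metis mset_map sum_mset_sum_list)
  then show ?thesis using mset_eq_setD[OF eq] by (simp add: corr_def)
qed

lemma lrw_inv:
  assumes "lrw t u"
  shows "col S t = col S u" "tens t = tens u" "mset (leaves t) = mset (leaves u)"
  using assms by (induction) auto

lemma lrw_repl:
  assumes "subt P p = Some t" "lrw t u \<or> lrw u t"
  shows "corr (repl P p u) ts = corr P ts" "mset (leaves (repl P p u)) = mset (leaves P)"
    "tens (repl P p u) = tens P"
proof -
  have P: "P = repl P p t" using repl_subt[OF assms(1)] by simp
  have inv: "\<And>S. col S t = col S u" "tens t = tens u" "mset (leaves t) = mset (leaves u)"
    using assms(2) lrw_inv by metis+
  show m: "mset (leaves (repl P p u)) = mset (leaves P)"
    using mset_leaves_repl[OF assms(1), of u t] inv P by simp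
  show t: "tens (repl P p u) = tens P"
    using tens_repl[OF assms(1), of u t] inv P by simp
  have "col S (repl P p u) = col S P" for S
    using col_repl[OF inv(1), of S P p] P by simp
  then show "corr (repl P p u) ts = corr P ts" by (rule corr_cong[OF _ t ids_mset[OF m]])
qed

lemma bot_repl:
  assumes "subt P p = Some (Pr Q (Tn R (Lf l i)))"
  shows "mset (leaves (repl P p (Tn (Pr Q R) (Lf l i)))) = mset (leaves P)"
    "tens (repl P p (Tn (Pr Q R) (Lf l i))) = tens P"
  using mset_leaves_repl[OF assms, of "Tn (Pr Q R) (Lf l i)" "Pr Q (Tn R (Lf l i))"]
    tens_repl[OF assms, of "Tn (Pr Q R) (Lf l i)" "Pr Q (Tn R (Lf l i))"]
    repl_subt[OF assms] by auto

text \<open>The commutativity and associativity steps do not change \<open>col\<close>. The bottom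
  step preserves correctness inwards unconditionally, and outwards by its side condition.\<close>

lemma eq_step_inv:
  assumes "eq_step rs P P'"
  shows "shared P ts = shared P' ts" "shared P (map rtree rs) \<Longrightarrow> corr P (map rtree rs) = corr P' (map rtree rs)"
proof -
  from assms obtain p t u where sub: "subt P p = Some t" and P': "P' = repl P p u" and
    *: "lrw t u \<or> (\<exists>Q R i. t = Pr Q (Tn R (Lf LB i)) \<and> u = Tn (Pr Q R) (Lf LB i) \<and> bot_cond rs P p Q i)"
    by (auto simp: eq_step_def)
  have "mset (leaves P') = mset (leaves P)"
    using * sub lrw_repl(2)[OF sub] bot_repl(1) unfolding P' by blast
  then show "shared P ts = shared P' ts" by (metis shared_mset)
  assume shared: "shared P (map rtree rs)"
  from * show "corr P (map rtree rs) = corr P' (map rtree rs)"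
  proof (elim disjE exE conjE)
    assume "lrw t u"
    then show ?thesis using lrw_repl(1)[OF sub] unfolding P' by blast
  next
    fix Q R i assume t: "t = Pr Q (Tn R (Lf LB i))" and u: "u = Tn (Pr Q R) (Lf LB i)" and bc: "bot_cond rs P p Q i"
    note sub' = sub[unfolded t]
    have P: "repl P p (Pr Q (Tn R (Lf LB i))) = P" by (rule repl_subt[OF sub'])
    have "separated (repl P p (Pr Q R)) (map rtree rs) Q i"
      using bc unfolding bot_cond_iff[OF shared sub'] .
    then show ?thesis
      using corr_outward[OF sub', of Q R LB i "map rtree rs"] corr_inward[OF sub', of Q R LB i "map rtree rs"]
      unfolding P P' u by blast
  qed
qed

lemma lk_equiv_inv:
  assumes "lk_equiv rs P P'" "shared P (map rtree rs)"
  shows "shared P' (map rtree rs)" "corr P (map rtree rs) = corr P' (map rtree rs)"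
proof -
  have "shared P' (map rtree rs) \<and> corr P (map rtree rs) = corr P' (map rtree rs)"
    using assms(1) unfolding lk_equiv_def
  proof (induction)
    case base
    then show ?case using assms by simp
  next
    case (step y z)
    then show ?case using eq_step_inv by metis
  qed
  then show "shared P' (map rtree rs)" "corr P (map rtree rs) = corr P' (map rtree rs)" by auto
qed

section \<open>Soundness of the sequent rules\<close>

lemma col_mono: "ids t \<subseteq> S \<Longrightarrow> col S t = {True}" "ids t \<inter> S = {} \<Longrightarrow> col S t = {False}"
  by (induction t) (auto simp: Int_Un_distrib2)

lemma col_cong: "S \<inter> ids t = S' \<inter> ids t \<Longrightarrow> col S t = col S' t"
proof (induction t)
  case (Lf l n)
  then show ?case by (auto simp: set_eq_iff)
next
  case (Tn a b)
  then have "S \<inter> ids a = S' \<inter> ids a" "S \<inter> ids b = S' \<inter> ids b" by auto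
  then show ?case using Tn.IH by simp
next
  case (Pr a b)
  then have "S \<inter> ids a = S' \<inter> ids a" "S \<inter> ids b = S' \<inter> ids b" by auto
  then show ?case using Pr.IH by simp
qed

lemma corrD:
  "corr P ts \<Longrightarrow> col S P \<noteq> {} \<Longrightarrow> (\<And>t. t \<in> set ts \<Longrightarrow> col S t \<noteq> {}) \<Longrightarrow> ids P \<inter> S = {} \<or> ids P \<subseteq> S"
  unfolding corr_def by blast

lemma corr_bot:
  assumes "corr P ts" "n \<notin> ids P"
  shows "corr (Tn (Lf l n) P) (Lf l n # ts)"
  unfolding corr_def
proof (intro conjI allI impI)
  show "card (ids (Tn (Lf l n) P)) = tens (Tn (Lf l n) P) + sum_list (map tens (Lf l n # ts)) + 1"
    using assms by (simp add: corr_def)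
  fix S assume 1: "col S (Tn (Lf l n) P) \<noteq> {}" and 2: "\<forall>t\<in>set (Lf l n # ts). col S t \<noteq> {}"
  then have P: "(n \<in> S) \<in> col S P" by auto
  then have "ids P \<inter> S = {} \<or> ids P \<subseteq> S" using corrD[OF assms(1), of S] 2 by auto
  then show "ids (Tn (Lf l n) P) \<inter> S = {} \<or> ids (Tn (Lf l n) P) \<subseteq> S"
    using P col_mono[of P S] by auto
qed

lemma corr_par: "corr P (Pr A B # ts) \<longleftrightarrow> corr P (A # B # ts)"
proof -
  have "col S (Pr A B) \<noteq> {} \<longleftrightarrow> col S A \<noteq> {} \<and> col S B \<noteq> {}" for S by auto
  then show ?thesis unfolding corr_def by (simp add: add.assoc)
qed

text \<open>Each half is monochromatic by its own correctness and contains one premise of the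
  tensor. A common colour of \<open>A\<close> and \<open>B\<close> is therefore the colour of both
  halves.\<close>

lemma corr_tens:
  assumes P: "corr P (A # rs)" and Q: "corr Q (B # ds)" and disj: "ids P \<inter> ids Q = {}"
    and A: "ids A \<subseteq> ids P" and B: "ids B \<subseteq> ids Q"
  shows "corr (Pr P Q) (Tn A B # rs @ ds)"
  unfolding corr_def
proof (intro conjI allI impI)
  show "card (ids (Pr P Q)) = tens (Pr P Q) + sum_list (map tens (Tn A B # rs @ ds)) + 1"
    using P Q disj by (simp add: corr_def card_Un_disjoint)
  fix S assume 1: "col S (Pr P Q) \<noteq> {}" and 2: "\<forall>t\<in>set (Tn A B # rs @ ds). col S t \<noteq> {}"
  have ne: "col S P \<noteq> {}" "col S Q \<noteq> {}" using 1 by auto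
  obtain c where c: "c \<in> col S A" "c \<in> col S B" using 2 by auto
  have "ids P \<inter> S = {} \<or> ids P \<subseteq> S"
    by (rule corrD[OF P ne(1)]) (use 2 c in auto)
  moreover have "ids Q \<inter> S = {} \<or> ids Q \<subseteq> S"
    by (rule corrD[OF Q ne(2)]) (use 2 c in auto)
  moreover have "c = True" if "ids P \<subseteq> S \<or> ids Q \<subseteq> S"
    using that c A B col_mono(1)[of A S] col_mono(1)[of B S] by (elim disjE) (simp_all add: subset_trans)
  moreover have "c = False" if "ids P \<inter> S = {} \<or> ids Q \<inter> S = {}"
  proof -
    have "ids A \<inter> S = {} \<or> ids B \<inter> S = {}" using that A B by blast
    then show ?thesis using c col_mono(2)[of A S] col_mono(2)[of B S] by auto
  qed
  ultimately show "ids (Pr P Q) \<inter> S = {} \<or> ids (Pr P Q) \<subseteq> S"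
    by (simp add: Int_Un_distrib2) blast
qed

text \<open>The equation for the leaves is carried through the induction because
  \<open>corr_tens\<close> needs the leaves of each premise to lie in its linking.\<close>

lemma seqz_corr: "seqz P rs \<Longrightarrow> ids P = (\<Union>r\<in>set rs. ids (rtree r)) \<and> corr P (map rtree rs)"
proof (induction rule: seqz.induct)
  case (sq_id m n a)
  have "ids (Tn (Lf (LA a) m) (Lf (LNA a) n)) \<inter> S = {} \<or> ids (Tn (Lf (LA a) m) (Lf (LNA a) n)) \<subseteq> S"
    if "col S (Tn (Lf (LA a) m) (Lf (LNA a) n)) \<noteq> {}" for S
    using that by auto
  then show ?case using sq_id by (auto simp: corr_def)
next
  case (sq_exch P rs rs')
  then have "mset (map rtree rs') = mset (map rtree rs)" by simp
  then show ?case using sq_exch corr_perm mset_eq_setD by metis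
next
  case (sq_one n)
  then show ?case by (auto simp: corr_def)
next
  case (sq_bot P rs n)
  then show ?case using corr_bot[of P _ n] by simp
next
  case (sq_par P A B rs)
  then show ?case by (auto simp: corr_par)
next
  case (sq_tens P rs A Q B ds)
  have "corr P (A # map rtree rs)" using sq_tens.IH(1) corr_perm[of "A # map rtree rs" "map rtree rs @ [A]" P] by simp
  moreover have "corr Q (B # map rtree ds)" using sq_tens.IH(2) by simp
  ultimately have "corr (Pr P Q) (Tn A B # map rtree rs @ map rtree ds)"
    using sq_tens by (intro corr_tens) auto
  then show ?case using sq_tens.IH
      corr_perm[of "Tn A B # map rtree rs @ map rtree ds" "map rtree (rs @ [RF (Tn A B)] @ ds)" "Pr P Q"] by auto
next
  case (sq_cut P rs A Q B ds)
  have "corr P (A # map rtree rs)" using sq_cut.IH(1) corr_perm[of "A # map rtree rs" "map rtree rs @ [A]" P] by simp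
  moreover have "corr Q (B # map rtree ds)" using sq_cut.IH(2) by simp
  ultimately have "corr (Pr P Q) (Tn A B # map rtree rs @ map rtree ds)"
    using sq_cut by (intro corr_tens) auto
  then show ?case using sq_cut.IH
      corr_perm[of "Tn A B # map rtree rs @ map rtree ds" "map rtree (rs @ [RC A B] @ ds)" "Pr P Q"] by auto
qed

text \<open>All rewriting rules in both directions, except that a bottom may enter a par but not
  leave it. No sequent is mentioned, so moves can be made inside any linking.\<close>

definition inward :: "'a tree \<Rightarrow> 'a tree \<Rightarrow> bool" where
  "inward P P' \<longleftrightarrow> (\<exists>p t u. subt P p = Some t \<and> P' = repl P p u \<and>
     (lrw t u \<or> lrw u t \<or> (\<exists>Q R i. t = Tn (Pr Q R) (Lf LB i) \<and> u = Pr Q (Tn R (Lf LB i)))))"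

lemma inward_inv:
  assumes "inward P P'"
  shows "mset (leaves P') = mset (leaves P)" "tens P' = tens P" "corr P ts \<Longrightarrow> corr P' ts"
proof -
  from assms obtain p t u where sub: "subt P p = Some t" and P': "P' = repl P p u" and
    *: "lrw t u \<or> lrw u t \<or> (\<exists>Q R i. t = Tn (Pr Q R) (Lf LB i) \<and> u = Pr Q (Tn R (Lf LB i)))"
    unfolding inward_def by blast
  have "mset (leaves P') = mset (leaves P) \<and> tens P' = tens P \<and> (corr P ts \<longrightarrow> corr P' ts)"
  proof (cases "lrw t u \<or> lrw u t")
    case True
    then show ?thesis using lrw_repl[OF sub] P' by simp
  next
    case False
    with * obtain Q R i where t: "t = Tn (Pr Q R) (Lf LB i)" and u: "u = Pr Q (Tn R (Lf LB i))" by blast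
    have P: "repl P p (Tn (Pr Q R) (Lf LB i)) = P" using repl_subt[OF sub] t by simp
    show ?thesis
      using mset_leaves_repl[OF sub, of t u] tens_repl[OF sub, of t u] corr_inward[OF sub, of Q R LB i ts] P
      unfolding P' by (simp add: t u)
  qed
  then show "mset (leaves P') = mset (leaves P)" "tens P' = tens P" "corr P ts \<Longrightarrow> corr P' ts" by auto
qed

text \<open>When a bottom moves inwards, the step of the equivalence is the reverse one. Its side
  condition follows by \<open>bot_bridge\<close> from the correctness of the graph before the
  move.\<close>

lemma inward_eq_step:
  assumes "inward P P'" "shared P (map rtree rs)" "corr P (map rtree rs)"
  shows "eq_step rs P P' \<or> eq_step rs P' P"
proof -
  from assms(1) obtain p t u where sub: "subt P p = Some t" and P': "P' = repl P p u" and
    *: "lrw t u \<or> lrw u t \<or> (\<exists>Q R i. t = Tn (Pr Q R) (Lf LB i) \<and> u = Pr Q (Tn R (Lf LB i)))"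
    unfolding inward_def by blast
  have sub': "subt P' p = Some u" unfolding P' by (rule subt_repl[OF sub])
  have P: "P = repl P' p t" unfolding P' repl_repl[OF sub] by (simp add: repl_subt[OF sub])
  from * show ?thesis
  proof (elim disjE exE conjE)
    assume "lrw t u"
    then show ?thesis using sub P' unfolding eq_step_def by blast
  next
    assume "lrw u t"
    then show ?thesis using sub' P unfolding eq_step_def by blast
  next
    fix Q R i assume t: "t = Tn (Pr Q R) (Lf LB i)" and u: "u = Pr Q (Tn R (Lf LB i))"
    have wf': "shared P' (map rtree rs)" using assms(2) shared_mset[OF inward_inv(1)[OF assms(1)]] by blast
    have "corr (repl P p (Tn (Pr Q R) (Lf LB i))) (map rtree rs)"
      using assms(3) repl_subt[OF sub] t by simp
    from bot_bridge[OF sub this] have "separated (repl P p (Pr Q R)) (map rtree rs) Q i"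
      unfolding separated_def by blast
    then have "separated (repl P' p (Pr Q R)) (map rtree rs) Q i"
      unfolding P' repl_repl[OF sub] .
    then have "bot_cond rs P' p Q i"
      using bot_cond_iff[OF wf' sub'[unfolded u]] by blast
    then have "eq_step rs P' P" using sub' P u t unfolding eq_step_def by blast
    then show ?thesis ..
  qed
qed

lemma inward_base:
  "lrw t u \<Longrightarrow> inward t u" "lrw u t \<Longrightarrow> inward t u" "inward (Tn (Pr Q R) (Lf LB i)) (Pr Q (Tn R (Lf LB i)))"
  unfolding inward_def by (rule exI[of _ "[]"], simp)+

lemma inward_cong:
  assumes "inward a a'"
  shows "inward (Tn a b) (Tn a' b)" "inward (Tn b a) (Tn b a')" "inward (Pr a b) (Pr a' b)" "inward (Pr b a) (Pr b a')"
proof -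
  from assms obtain p t u where *: "subt a p = Some t" "a' = repl a p u"
    "lrw t u \<or> lrw u t \<or> (\<exists>Q R i. t = Tn (Pr Q R) (Lf LB i) \<and> u = Pr Q (Tn R (Lf LB i)))"
    unfolding inward_def by blast
  have "subt (Tn a b) (False # p) = Some t" "Tn a' b = repl (Tn a b) (False # p) u" using *(1,2) by simp_all
  with *(3) show "inward (Tn a b) (Tn a' b)" unfolding inward_def by blast
  have "subt (Tn b a) (True # p) = Some t" "Tn b a' = repl (Tn b a) (True # p) u" using *(1,2) by simp_all
  with *(3) show "inward (Tn b a) (Tn b a')" unfolding inward_def by blast
  have "subt (Pr a b) (False # p) = Some t" "Pr a' b = repl (Pr a b) (False # p) u" using *(1,2) by simp_all
  with *(3) show "inward (Pr a b) (Pr a' b)" unfolding inward_def by blast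
  have "subt (Pr b a) (True # p) = Some t" "Pr b a' = repl (Pr b a) (True # p) u" using *(1,2) by simp_all
  with *(3) show "inward (Pr b a) (Pr b a')" unfolding inward_def by blast
qed

abbreviation inwards :: "'a tree \<Rightarrow> 'a tree \<Rightarrow> bool" where
  "inwards \<equiv> inward\<^sup>*\<^sup>*"

lemma inwards_map: "inwards a a' \<Longrightarrow> (\<And>x y. inward x y \<Longrightarrow> inward (C x) (C y)) \<Longrightarrow> inwards (C a) (C a')"
  by (induction rule: rtranclp_induct) (auto intro: rtranclp.rtrancl_into_rtrancl)

lemma inwards_cong:
  assumes "inwards a a'"
  shows "inwards (Tn a b) (Tn a' b)" "inwards (Tn b a) (Tn b a')" "inwards (Pr a b) (Pr a' b)" "inwards (Pr b a) (Pr b a')"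
  by (rule inwards_map[OF assms, of "\<lambda>x. Tn x b"], erule inward_cong)
    (rule inwards_map[OF assms, of "\<lambda>x. Tn b x"], erule inward_cong,
     rule inwards_map[OF assms, of "\<lambda>x. Pr x b"], erule inward_cong,
     rule inwards_map[OF assms, of "\<lambda>x. Pr b x"], erule inward_cong)

lemma inwards_comm: "inwards (Tn a b) (Tn b a)" "inwards (Pr a b) (Pr b a)"
  by (auto intro!: inward_base(1) lrw.intros)

lemma inwards_assoc: "inwards (Pr (Pr a b) c) (Pr a (Pr b c))" "inwards (Pr a (Pr b c)) (Pr (Pr a b) c)"
  by (rule r_into_rtranclp, rule inward_base(1), rule par_assoc)
    (rule r_into_rtranclp, rule inward_base(2), rule par_assoc)

lemma inwards_bot_bot: "inwards (Tn (Lf LB i) (Tn (Lf LB j) a)) (Tn (Lf LB j) (Tn (Lf LB i) a))"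
proof -
  have "inwards (Tn (Lf LB i) (Tn (Lf LB j) a)) (Tn (Lf LB i) (Tn a (Lf LB j)))"
    by (intro inwards_cong inwards_comm)
  also have "inwards \<dots> (Tn (Tn (Lf LB i) a) (Lf LB j))"
    by (rule r_into_rtranclp, rule inward_base(1), rule bot_assoc)
  also have "inwards \<dots> (Tn (Lf LB j) (Tn (Lf LB i) a))"
    by (rule inwards_comm)
  finally show ?thesis .
qed

lemma inwards_bot_par: "inwards (Tn (Lf LB i) (Pr a b)) (Pr a (Tn (Lf LB i) b))"
proof -
  have "inwards (Tn (Lf LB i) (Pr a b)) (Tn (Pr a b) (Lf LB i))" by (rule inwards_comm)
  also have "inwards \<dots> (Pr a (Tn b (Lf LB i)))" by (rule r_into_rtranclp, rule inward_base(3))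
  also have "inwards \<dots> (Pr a (Tn (Lf LB i) b))" by (intro inwards_cong inwards_comm)
  finally show ?thesis .
qed

lemma inwards_bot_par': "inwards (Tn (Lf LB i) (Pr a b)) (Pr (Tn (Lf LB i) a) b)"
proof -
  have "inwards (Tn (Lf LB i) (Pr a b)) (Tn (Lf LB i) (Pr b a))" by (intro inwards_cong inwards_comm)
  also have "inwards \<dots> (Pr b (Tn (Lf LB i) a))" by (rule inwards_bot_par)
  also have "inwards \<dots> (Pr (Tn (Lf LB i) a) b)" by (rule inwards_comm)
  finally show ?thesis .
qed

lemma inwards_inv: "inwards P P' \<Longrightarrow> mset (leaves P') = mset (leaves P) \<and> tens P' = tens P \<and> (corr P ts \<longrightarrow> corr P' ts)"
  by (induction rule: rtranclp_induct) (auto simp: inward_inv)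

text \<open>Every inner node of a linking is the root of a linking and can be exchanged for another
  one. Leaves are excluded because an atom or a bottom alone is no linking.\<close>

lemma is_linking_subt_repl:
  assumes "is_linking P" "subt P p = Some t" "\<forall>l n. t \<noteq> Lf l n"
  shows "is_linking t \<and> (is_linking u \<longrightarrow> is_linking (repl P p u))"
  using assms
proof (induction P arbitrary: p rule: is_linking.induct)
  case (lk_par L M)
  then show ?case by (cases p) (auto intro: is_linking.intros split: if_splits)
next
  case (lk_botl L n)
  then show ?case by (cases p) (auto intro: is_linking.intros split: if_splits elim: subt.elims)
next
  case (lk_botr L n)
  then show ?case by (cases p) (auto intro: is_linking.intros split: if_splits elim: subt.elims)
next
  case (lk_one n)
  then show ?case by (cases p) (auto intro: is_linking.intros)
next
  case (lk_ax1 a m n)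
  then show ?case by (cases p) (auto intro: is_linking.intros split: if_splits elim: subt.elims)
next
  case (lk_ax2 a m n)
  then show ?case by (cases p) (auto intro: is_linking.intros split: if_splits elim: subt.elims)
qed

inductive_simps is_linking_Lf [simp]: "is_linking (Lf l n)"
inductive_simps is_linking_Pr [simp]: "is_linking (Pr a b)"
inductive_cases is_linking_TnE: "is_linking (Tn a b)"

lemma is_linking_bot [simp]: "is_linking (Tn (Lf LB n) L) = is_linking L" "is_linking (Tn L (Lf LB n)) = is_linking L"
  by (auto intro: is_linking.intros elim!: is_linking_TnE)

lemma is_linking_comm: "is_linking (Tn a b) \<Longrightarrow> is_linking (Tn b a)"
  by (erule is_linking_TnE) (auto intro: is_linking.intros)

lemma lrw_linking: "lrw t u \<Longrightarrow> is_linking t = is_linking u"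
  by (induction rule: lrw.induct) (auto dest: is_linking_comm)

lemma lrw_not_leaf: "lrw t u \<Longrightarrow> (\<forall>l n. t \<noteq> Lf l n) \<and> (\<forall>l n. u \<noteq> Lf l n)"
  by (induction rule: lrw.induct) auto

lemma inward_linking:
  assumes "inward P P'" "is_linking P"
  shows "is_linking P'"
proof -
  from assms(1) obtain p t u where sub: "subt P p = Some t" and P': "P' = repl P p u" and
    *: "lrw t u \<or> lrw u t \<or> (\<exists>Q R i. t = Tn (Pr Q R) (Lf LB i) \<and> u = Pr Q (Tn R (Lf LB i)))"
    unfolding inward_def by blast
  have nl: "\<forall>l n. t \<noteq> Lf l n" using * lrw_not_leaf by blast
  note lk = is_linking_subt_repl[OF assms(2) sub nl]
  have "is_linking u" using lk * lrw_linking by auto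
  then show ?thesis unfolding P' using lk by blast
qed

section \<open>Clusters and empires\<close>

inductive cluster :: "'a tree \<Rightarrow> bool" where
  "cluster (Lf L1 n)"
| "cluster (Tn (Lf (LA a) m) (Lf (LNA a) n))"
| "cluster c \<Longrightarrow> cluster (Tn (Lf LB n) c)"

inductive normal :: "'a tree \<Rightarrow> bool" where
  normal_cluster: "cluster c \<Longrightarrow> normal c"
| normal_Pr: "normal a \<Longrightarrow> normal b \<Longrightarrow> normal (Pr a b)"

text \<open>The bottom descends through the pars, always into the right premise, until it reaches a
  cluster.\<close>

lemma normal_bot: "normal N \<Longrightarrow> \<exists>N'. inwards (Tn (Lf LB n) N) N' \<and> normal N'"
proof (induction rule: normal.induct)
  case (normal_cluster c)
  then show ?case by (intro exI[of _ "Tn (Lf LB n) c"]) (auto intro: normal.intros cluster.intros)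
next
  case (normal_Pr a b)
  then obtain b' where b': "inwards (Tn (Lf LB n) b) b'" "normal b'" by blast
  have "inwards (Tn (Lf LB n) (Pr a b)) (Pr a (Tn (Lf LB n) b))" by (rule inwards_bot_par)
  also have "inwards \<dots> (Pr a b')" by (rule inwards_cong(4)[OF b'(1)])
  finally show ?case using normal_Pr(1) b'(2) by (blast intro: normal.intros)
qed

lemma normal_exists: "is_linking P \<Longrightarrow> \<exists>N. inwards P N \<and> normal N"
proof (induction rule: is_linking.induct)
  case (lk_one n)
  then show ?case by (auto intro!: exI[of _ "Lf L1 n"] normal.intros cluster.intros)
next
  case (lk_ax1 a m n)
  then show ?case
    by (intro exI[of _ "Tn (Lf (LA a) m) (Lf (LNA a) n)"]) (auto intro!: normal.intros cluster.intros)
next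
  case (lk_ax2 a m n)
  show ?case
    by (intro exI[of _ "Tn (Lf (LA a) n) (Lf (LNA a) m)"])
      (auto intro!: normal_cluster cluster.intros inward_base(1) tens_comm)
next
  case (lk_botl L n)
  then obtain N where N: "inwards L N" "normal N" by blast
  obtain N' where N': "inwards (Tn (Lf LB n) N) N'" "normal N'" using normal_bot[OF N(2)] by blast
  show ?case using rtranclp_trans[OF inwards_cong(2)[OF N(1)] N'(1)] N'(2) by blast
next
  case (lk_botr L n)
  then obtain N where N: "inwards L N" "normal N" by blast
  obtain N' where N': "inwards (Tn (Lf LB n) N) N'" "normal N'" using normal_bot[OF N(2)] by blast
  show ?case using rtranclp_trans[OF inwards_comm(1) rtranclp_trans[OF inwards_cong(2)[OF N(1)] N'(1)]] N'(2) by blast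
next
  case (lk_par L M)
  then obtain N N' where N: "inwards L N" "normal N" "inwards M N'" "normal N'" by blast
  show ?case using rtranclp_trans[OF inwards_cong(3)[OF N(1)] inwards_cong(4)[OF N(3)]] N(2,4)
    by (blast intro: normal.intros)
qed

fun clusters :: "'a tree \<Rightarrow> nat set set" where
  "clusters (Pr a b) = clusters a \<union> clusters b"
| "clusters t = {ids t}"

definition unsplit :: "nat set \<Rightarrow> nat set \<Rightarrow> bool" where
  "unsplit S c \<longleftrightarrow> c \<subseteq> S \<or> c \<inter> S = {}"

lemma cluster_clusters: "cluster c \<Longrightarrow> clusters c = {ids c}"
  by (induction rule: cluster.induct) auto

lemma cluster_col: "cluster c \<Longrightarrow> col S c \<noteq> {} \<Longrightarrow> unsplit S (ids c)"
proof (induction rule: cluster.induct)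
  case (3 c n)
  then have n: "(n \<in> S) \<in> col S c" by auto
  then have "unsplit S (ids c)" using 3 by blast
  then show ?case using n col_mono[of c S] by (auto simp: unsplit_def)
qed (auto simp: unsplit_def split: if_splits)

lemma unsplit_col: "unsplit S (ids t) \<Longrightarrow> col S t \<noteq> {}"
  using col_mono[of t S] by (auto simp: unsplit_def)

text \<open>A cluster contains no par, so it can only be monochromatic, while a par demands nothing
  of its premises beyond their being colourable. A normal linking thus acts as a mere family of leaf
  sets.\<close>

lemma normal_col: "normal N \<Longrightarrow> col S N \<noteq> {} \<longleftrightarrow> (\<forall>c\<in>clusters N. unsplit S c)"
proof (induction rule: normal.induct)
  case (normal_cluster c)
  then show ?case using cluster_clusters[of c] cluster_col[of c S] unsplit_col[of S c] by auto
next
  case (normal_Pr a b)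
  have "col S (Pr a b) \<noteq> {} \<longleftrightarrow> col S a \<noteq> {} \<and> col S b \<noteq> {}" by auto
  then show ?case using normal_Pr by auto
qed

lemma clusters_ids: "c \<in> clusters N \<Longrightarrow> c \<subseteq> ids N"
  by (induction N rule: clusters.induct) auto

text \<open>Associativity and commutativity of par allow the clusters inside \<open>S\<close> to be
  collected in one premise and those outside in the other.\<close>

lemma normal_split:
  "normal N \<Longrightarrow> \<forall>c\<in>clusters N. unsplit S c \<Longrightarrow> ids N \<subseteq> S \<or> ids N \<inter> S = {} \<or>
    (\<exists>N1 N2. inwards N (Pr N1 N2) \<and> normal N1 \<and> normal N2 \<and> ids N1 \<subseteq> S \<and> ids N2 \<inter> S = {})"
proof (induction rule: normal.induct)
  case (normal_cluster c)
  then have "ids c \<subseteq> S \<or> ids c \<inter> S = {}" by (simp add: cluster_clusters unsplit_def)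
  then show ?case by blast
next
  case (normal_Pr a b)
  define P where "P N = (\<exists>N1 N2. inwards N (Pr N1 N2) \<and> normal N1 \<and> normal N2 \<and> ids N1 \<subseteq> S \<and> ids N2 \<inter> S = {})" for N :: "'a tree"
  have PI: "P N" if "inwards N (Pr N1 N2)" "normal N1" "normal N2" "ids N1 \<subseteq> S" "ids N2 \<inter> S = {}" for N N1 N2
    using that unfolding P_def by blast
  have one: "P (Pr a b)"
    if "normal a" "normal b" "P a" "ids b \<subseteq> S \<or> ids b \<inter> S = {}" for a b
  proof -
    from that(3) obtain a1 a2 where a: "inwards a (Pr a1 a2)" "normal a1" "normal a2" "ids a1 \<subseteq> S" "ids a2 \<inter> S = {}"
      unfolding P_def by blast
    have st: "inwards (Pr a b) (Pr (Pr a1 a2) b)" by (rule inwards_cong(3)[OF a(1)])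
    from that(4) show ?thesis
    proof
      assume b: "ids b \<subseteq> S"
      note st
      also have "inwards (Pr (Pr a1 a2) b) (Pr b (Pr a1 a2))" by (rule inwards_comm)
      also have "inwards \<dots> (Pr (Pr b a1) a2)" by (rule inwards_assoc)
      finally show ?thesis using a b that by (intro PI[of _ "Pr b a1" a2]) (auto intro: normal.intros)
    next
      assume b: "ids b \<inter> S = {}"
      note st
      also have "inwards (Pr (Pr a1 a2) b) (Pr a1 (Pr a2 b))" by (rule inwards_assoc)
      finally show ?thesis using a b that by (intro PI[of _ a1 "Pr a2 b"]) (auto intro: normal.intros)
    qed
  qed
  have comm: "P (Pr a b)" if "P (Pr b a)" for a b
    using that unfolding P_def by (meson inwards_comm(2) rtranclp_trans)
  have both: "P (Pr a b)" if "P a" "P b"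
  proof -
    from that(1) obtain a1 a2 where a: "inwards a (Pr a1 a2)" "normal a1" "normal a2" "ids a1 \<subseteq> S" "ids a2 \<inter> S = {}"
      unfolding P_def by blast
    from that(2) obtain b1 b2 where b: "inwards b (Pr b1 b2)" "normal b1" "normal b2" "ids b1 \<subseteq> S" "ids b2 \<inter> S = {}"
      unfolding P_def by blast
    have "inwards (Pr a b) (Pr (Pr a1 a2) b)" by (rule inwards_cong(3)[OF a(1)])
    also have "inwards \<dots> (Pr (Pr a1 a2) (Pr b1 b2))" by (rule inwards_cong(4)[OF b(1)])
    also have "inwards \<dots> (Pr a1 (Pr a2 (Pr b1 b2)))" by (rule inwards_assoc)
    also have "inwards \<dots> (Pr a1 (Pr (Pr b1 b2) a2))" by (intro inwards_cong inwards_comm)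
    also have "inwards \<dots> (Pr a1 (Pr b1 (Pr b2 a2)))" by (intro inwards_cong inwards_assoc)
    also have "inwards \<dots> (Pr (Pr a1 b1) (Pr b2 a2))" by (rule inwards_assoc)
    finally show ?thesis using a b by (intro PI[of _ "Pr a1 b1" "Pr b2 a2"]) (auto intro: normal.intros)
  qed
  have IH: "ids a \<subseteq> S \<or> ids a \<inter> S = {} \<or> P a" "ids b \<subseteq> S \<or> ids b \<inter> S = {} \<or> P b"
    using normal_Pr unfolding P_def by auto
  consider "ids a \<subseteq> S" "ids b \<subseteq> S" | "ids a \<inter> S = {}" "ids b \<inter> S = {}"
    | "ids a \<subseteq> S" "ids b \<inter> S = {}" | "ids b \<subseteq> S" "ids a \<inter> S = {}"
    | "P a" "ids b \<subseteq> S \<or> ids b \<inter> S = {}" | "P b" "ids a \<subseteq> S \<or> ids a \<inter> S = {}" | "P a" "P b"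
    using IH by argo
  then have "ids (Pr a b) \<subseteq> S \<or> ids (Pr a b) \<inter> S = {} \<or> P (Pr a b)"
  proof cases
    case 3
    then have "P (Pr a b)" using normal_Pr by (intro PI[of _ a b]) auto
    then show ?thesis by blast
  next
    case 4
    then have "P (Pr b a)" using normal_Pr by (intro PI[of _ b a]) auto
    then show ?thesis using comm by blast
  next
    case 5
    then show ?thesis using one normal_Pr.hyps by blast
  next
    case 6
    then show ?thesis using one comm normal_Pr.hyps by blast
  next
    case 7
    then show ?thesis using both by blast
  qed (auto simp: Int_Un_distrib2)
  then show ?case unfolding P_def .
qed

definition recolour :: "nat set \<Rightarrow> nat \<Rightarrow> bool \<Rightarrow> nat set" where
  "recolour S n c = (if c then insert n S else S - {n})"

lemma recolour_mem [simp]: "m \<in> recolour S n c \<longleftrightarrow> (if m = n then c else m \<in> S)"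
  by (simp add: recolour_def)

lemma col_recolour: "n \<notin> ids t \<Longrightarrow> col (recolour S n c) t = col S t"
  by (rule col_cong) (auto simp: recolour_def)

text \<open>\<open>P0\<close> arises from \<open>P\<close> by deleting the bottom \<open>n\<close>,
  and inward moves lead from \<open>Tn (Lf LB n) P0\<close> back to \<open>P\<close>. Correctness
  does not travel against these moves, so the last clause prepares a direct proof for
  \<open>P0\<close>: a colouring of \<open>P0\<close> extends to \<open>P\<close> when
  \<open>n\<close> receives the colour of the subtree to which it is attached.\<close>

lemma extract_bot:
  fixes P :: "'a tree"
  assumes "is_linking P" "(LB, n) \<in> set (leaves P)" "distinct (map snd (leaves P))"
  shows "\<exists>P0. is_linking P0 \<and> inwards (Tn (Lf LB n) P0) P \<and>
    (\<forall>S. \<forall>b\<in>col S P0. \<exists>c. b \<in> col (recolour S n c) P)"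
  using assms
proof -
  have bot: "\<exists>P0. is_linking P0 \<and> inwards (Tn (Lf LB n) P0) (Tn (Lf LB m) L) \<and>
      (\<forall>S. \<forall>b\<in>col S P0. \<exists>c. b \<in> col (recolour S n c) (Tn (Lf LB m) L))"
    if lk: "is_linking L" and n: "m = n \<Longrightarrow> n \<notin> ids L"
      and IH: "m \<noteq> n \<Longrightarrow> \<exists>P0. is_linking P0 \<and> inwards (Tn (Lf LB n) P0) L \<and>
        (\<forall>S. \<forall>b\<in>col S P0. \<exists>c. b \<in> col (recolour S n c) L)" for L :: "'a tree" and m
  proof (cases "m = n")
    case True
    have "b \<in> col (recolour S n b) (Tn (Lf LB m) L)" if "b \<in> col S L" for S b
      using that True col_recolour[OF n[OF True]] by simp
    then show ?thesis using lk True by (intro exI[of _ L]) auto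
  next
    case False
    then obtain L0 where L0: "is_linking L0" "inwards (Tn (Lf LB n) L0) L"
      "\<And>S b. b \<in> col S L0 \<Longrightarrow> \<exists>c. b \<in> col (recolour S n c) L" using IH by auto
    have "inwards (Tn (Lf LB n) (Tn (Lf LB m) L0)) (Tn (Lf LB m) L)"
      using rtranclp_trans[OF inwards_bot_bot inwards_cong(2)[OF L0(2)]] .
    moreover have "\<exists>c. b \<in> col (recolour S n c) (Tn (Lf LB m) L)" if "b \<in> col S (Tn (Lf LB m) L0)" for S b
    proof -
      have b: "b \<in> col S L0" "b = (m \<in> S)" using that by auto
      from L0(3)[OF b(1)] obtain c where "b \<in> col (recolour S n c) L" ..
      then show ?thesis using b(2) False by (intro exI[of _ c]) simp
    qed
    moreover have "is_linking (Tn (Lf LB m) L0)" using L0(1) by simp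
    ultimately show ?thesis by blast
  qed
  from assms show ?thesis
  proof (induction rule: is_linking.induct)
  case (lk_botl L m)
  then show ?case by (intro bot) (auto simp: ids_def)
next
  case (lk_botr L m)
  then have "\<exists>P0. is_linking P0 \<and> inwards (Tn (Lf LB n) P0) (Tn (Lf LB m) L) \<and>
      (\<forall>S. \<forall>b\<in>col S P0. \<exists>c. b \<in> col (recolour S n c) (Tn (Lf LB m) L))"
    by (intro bot) (auto simp: ids_def)
  moreover have "inwards Q (Tn L (Lf LB m))" if "inwards Q (Tn (Lf LB m) L)" for Q
    using rtranclp_trans[OF that inwards_comm(1)] .
  moreover have "col S (Tn (Lf LB m) L) = col S (Tn L (Lf LB m))" for S by auto
  ultimately show ?case by metis
next
  case (lk_par L M)
  have main: "\<exists>P0. is_linking P0 \<and> inwards (Tn (Lf LB n) P0) (Pr L M) \<and>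
      (\<forall>S. \<forall>b\<in>col S P0. \<exists>c. b \<in> col (recolour S n c) (Pr L M))"
    if L0: "is_linking L0" "inwards (Tn (Lf LB n) L0) L" "is_linking M" "n \<notin> ids M"
      "\<And>S b. b \<in> col S L0 \<Longrightarrow> \<exists>c. b \<in> col (recolour S n c) L" for L0 L M :: "'a tree"
  proof -
    have "inwards (Tn (Lf LB n) (Pr L0 M)) (Pr L M)"
      using rtranclp_trans[OF inwards_bot_par' inwards_cong(3)[OF L0(2)]] .
    moreover have "\<exists>c. b \<in> col (recolour S n c) (Pr L M)" if "b \<in> col S (Pr L0 M)" for S b
    proof -
      from that obtain d where d: "d \<in> col S L0" "b = d \<or> b \<in> col S M" "col S M \<noteq> {}"
        by (auto split: if_splits)
      from L0(5)[OF d(1)] obtain c where "d \<in> col (recolour S n c) L" ..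
      then show ?thesis using d(2,3) col_recolour[OF L0(4), of S c] by (intro exI[of _ c]) auto
    qed
    ultimately show ?thesis using L0(1,3) by (intro exI[of _ "Pr L0 M"]) simp
  qed
  from lk_par.prems(1) consider "(LB, n) \<in> set (leaves L)" | "(LB, n) \<in> set (leaves M)" by auto
  then show ?case
  proof cases
    case 1
    have "n \<notin> ids M" using lk_par.prems 1 by (force simp: ids_def)
    moreover obtain L0 where "is_linking L0" "inwards (Tn (Lf LB n) L0) L"
      "\<And>S b. b \<in> col S L0 \<Longrightarrow> \<exists>c. b \<in> col (recolour S n c) L" using 1 lk_par by auto
    ultimately show ?thesis using main lk_par.hyps by blast
  next
    case 2
    have "n \<notin> ids L" using lk_par.prems 2 by (force simp: ids_def)
    moreover obtain M0 where "is_linking M0" "inwards (Tn (Lf LB n) M0) M"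
      "\<And>S b. b \<in> col S M0 \<Longrightarrow> \<exists>c. b \<in> col (recolour S n c) M" using 2 lk_par by auto
    ultimately obtain P0 where P0: "is_linking P0" "inwards (Tn (Lf LB n) P0) (Pr M L)"
      "\<And>S b. b \<in> col S P0 \<Longrightarrow> \<exists>c. b \<in> col (recolour S n c) (Pr M L)" using main[of M0 M L] lk_par.hyps by blast
    have "col S (Pr L M) = col S (Pr M L)" for S by auto
    then show ?thesis using P0 rtranclp_trans[OF P0(2) inwards_comm(2)] by metis
  qed
qed auto
qed

section \<open>Empires of the premises of tensor roots\<close>

fun subtrees :: "'a tree \<Rightarrow> 'a tree set" where
  "subtrees (Lf l n) = {Lf l n}"
| "subtrees (Tn a b) = insert (Tn a b) (subtrees a \<union> subtrees b)"
| "subtrees (Pr a b) = insert (Pr a b) (subtrees a \<union> subtrees b)"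

lemma subtrees_self [simp]: "t \<in> subtrees t"
  by (cases t) auto

lemma subtrees_sub: "u \<in> subtrees t \<Longrightarrow> subtrees u \<subseteq> subtrees t"
  by (induction t) auto

lemma finite_subtrees [simp]: "finite (subtrees t)"
  by (induction t) auto

lemma subtrees_ids: "u \<in> subtrees t \<Longrightarrow> ids u \<subseteq> ids t"
  by (induction t) auto

definition tnodes :: "'a tree \<Rightarrow> 'a tree set" where
  "tnodes t = {u \<in> subtrees t. \<exists>a b. u = Tn a b}"

text \<open>Equal subtrees are counted once, which gives an upper bound, the direction that the
  count of links in \<open>cut_exists\<close> requires.\<close>

lemma card_tnodes: "card (tnodes t) \<le> tens t"
proof (induction t)
  case (Tn a b)
  have "tnodes (Tn a b) = insert (Tn a b) (tnodes a \<union> tnodes b)" by (auto simp: tnodes_def)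
  moreover have "finite (tnodes a \<union> tnodes b)" by (simp add: tnodes_def)
  ultimately show ?case using Tn card_Un_le[of "tnodes a" "tnodes b"] by (simp add: card_insert_if)
next
  case (Pr a b)
  have "tnodes (Pr a b) = tnodes a \<union> tnodes b" by (auto simp: tnodes_def)
  then show ?case using Pr card_Un_le[of "tnodes a" "tnodes b"] by simp
qed (simp add: tnodes_def)

text \<open>The counterpart of \<open>rep\<close> with switches attached to subtrees instead of
  positions; at a tensor the left premise is taken.\<close>

fun trep :: "('a tree \<Rightarrow> bool) \<Rightarrow> 'a tree \<Rightarrow> nat" where
  "trep s (Lf l n) = n"
| "trep s (Tn a b) = trep s a"
| "trep s (Pr a b) = (if s (Pr a b) then trep s b else trep s a)"

text \<open>Nodes are identified with their subtrees. The assumption \<open>roots\<close> says that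
  a root is nobody's premise; it lets the colour of a root be reset without disturbing other
  nodes.\<close>

locale cut_net =
  fixes N :: "'a tree" and ts :: "'a tree list"
  assumes normal: "normal N" and corr: "corr N ts" and ids: "ids N = (\<Union>t\<in>set ts. ids t)"
    and roots: "\<And>T a b. T \<in> set ts \<Longrightarrow> Tn a b \<in> (\<Union>t\<in>set ts. subtrees t) \<or> Pr a b \<in> (\<Union>t\<in>set ts. subtrees t) \<Longrightarrow>
      a \<noteq> T \<and> b \<noteq> T"
begin

definition U :: "'a tree set" where "U = (\<Union>t\<in>set ts. subtrees t)"

lemma U_sub: "Tn a b \<in> U \<Longrightarrow> a \<in> U \<and> b \<in> U" "Pr a b \<in> U \<Longrightarrow> a \<in> U \<and> b \<in> U"
proof -
  have sub: "subtrees u \<subseteq> U" if "u \<in> U" for u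
  proof -
    from that obtain t where "t \<in> set ts" "u \<in> subtrees t" unfolding U_def by (rule UN_E)
    then show ?thesis unfolding U_def using subtrees_sub[of u t] by (meson UN_upper order_trans)
  qed
  show "Tn a b \<in> U \<Longrightarrow> a \<in> U \<and> b \<in> U" "Pr a b \<in> U \<Longrightarrow> a \<in> U \<and> b \<in> U"
    using sub[of "Tn a b"] sub[of "Pr a b"] by auto
qed

lemma finite_U: "finite U"
  by (simp add: U_def)

lemma U_ids: "u \<in> U \<Longrightarrow> ids u \<subseteq> ids N"
  unfolding U_def ids using subtrees_ids by blast

lemma ts_U: "t \<in> set ts \<Longrightarrow> t \<in> U"
  unfolding U_def using subtrees_self by blast

lemma nontrivial:
  assumes "\<And>c. c \<in> clusters N \<Longrightarrow> unsplit S c" "\<And>t. t \<in> set ts \<Longrightarrow> col S t \<noteq> {}"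
  shows "ids N \<inter> S = {} \<or> ids N \<subseteq> S"
  using corrD[OF corr] assms normal_col[OF normal, of S] by blast

text \<open>A formula counts as inside when all of its leaves are, so a par acts as a conjunction.
  This reading involves no switching and is stable under intersections. Only the tensor
  \<open>T\<close>, regarded as deleted, is exempt.\<close>

definition closed :: "'a tree \<Rightarrow> nat set \<Rightarrow> bool" where
  "closed T S \<longleftrightarrow> (\<forall>c\<in>clusters N. unsplit S c) \<and>
     (\<forall>a b. Tn a b \<in> U \<longrightarrow> Tn a b \<noteq> T \<longrightarrow> (ids a \<subseteq> S \<longleftrightarrow> ids b \<subseteq> S))"

text \<open>The conjunctive value of a par is always the value of one of its premises, so it is a
  colouring under a switching that keeps such a premise.\<close>

lemma closed_full_col:
  assumes "\<forall>a b. Tn a b \<in> U \<longrightarrow> (ids a \<subseteq> S \<longleftrightarrow> ids b \<subseteq> S)" "t \<in> U"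
  shows "(ids t \<subseteq> S) \<in> col S t"
  using assms(2)
proof (induction t)
  case (Tn a b)
  then show ?case using U_sub(1)[OF Tn.prems] assms(1) by auto
next
  case (Pr a b)
  then show ?case using U_sub(2)[OF Pr.prems] by (cases "ids a \<subseteq> S"; cases "ids b \<subseteq> S") auto
qed auto

lemma closed_trivial:
  assumes "closed (Tn A B) S" "ids A \<subseteq> S \<longleftrightarrow> ids B \<subseteq> S"
  shows "ids N \<inter> S = {} \<or> ids N \<subseteq> S"
proof (rule nontrivial)
  show "unsplit S c" if "c \<in> clusters N" for c using assms that by (simp add: closed_def)
  have "\<forall>a b. Tn a b \<in> U \<longrightarrow> (ids a \<subseteq> S \<longleftrightarrow> ids b \<subseteq> S)"
    using assms unfolding closed_def by (metis tree.inject(2))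
  from closed_full_col[OF this] show "col S t \<noteq> {}" if "t \<in> set ts" for t
    using ts_U[OF that] by blast
qed

text \<open>Here \<open>v\<close> colours all nodes under the switching \<open>s\<close> in the
  graph with the root \<open>T\<close> deleted, and \<open>S\<close> is its trace on the leaves. The
  value of \<open>T\<close> is fixed to false so that meets and differences of such colourings agree
  there.\<close>

definition valid :: "'a tree \<Rightarrow> ('a tree \<Rightarrow> bool) \<Rightarrow> nat set \<Rightarrow> ('a tree \<Rightarrow> bool) \<Rightarrow> bool" where
  "valid T s S v \<longleftrightarrow> (\<forall>l n. Lf l n \<in> U \<longrightarrow> v (Lf l n) = (n \<in> S)) \<and>
     \<not> v T \<and> (\<forall>a b. Tn a b \<in> U \<longrightarrow> Tn a b \<noteq> T \<longrightarrow> v a = v b \<and> v (Tn a b) = v a) \<and>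
     (\<forall>a b. Pr a b \<in> U \<longrightarrow> v (Pr a b) = v (if s (Pr a b) then b else a)) \<and>
     (\<forall>c\<in>clusters N. unsplit S c)"

text \<open>Descend to a child of equal colour: the kept premise at a par, any premise at a tensor
  other than \<open>T\<close>, and the false premise \<open>B\<close> at \<open>T\<close>.\<close>

lemma valid_leaf:
  assumes "valid T s S v" "T = Tn A B \<or> T = Tn B A" "\<not> v B" "t \<in> U"
  shows "\<exists>n\<in>ids t. (n \<in> S) = v t"
  using assms(4)
proof (induction t)
  case (Lf l n)
  then show ?case using assms(1) by (auto simp: valid_def)
next
  case (Tn a b)
  note ab = U_sub(1)[OF Tn.prems]
  show ?case
  proof (cases "Tn a b = T")
    case True
    then have "B = a \<or> B = b" "\<not> v (Tn a b)" using assms(1,2) by (auto simp: valid_def)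
    then show ?thesis using Tn.IH ab assms(3) by auto
  next
    case False
    then have "v (Tn a b) = v a" using assms(1) Tn.prems by (simp add: valid_def)
    then show ?thesis using Tn.IH ab by auto
  qed
next
  case (Pr a b)
  note ab = U_sub(2)[OF Pr.prems]
  have "v (Pr a b) = v (if s (Pr a b) then b else a)" using assms(1) Pr.prems by (simp add: valid_def)
  then show ?case using Pr.IH ab by (auto split: if_splits)
qed

lemma valid_trivial:
  assumes "valid T s S v" "T = Tn A B \<or> T = Tn B A" "\<not> v A" "\<not> v B"
  shows "ids N \<inter> S = {} \<or> ids N \<subseteq> S"
proof (rule nontrivial)
  show "unsplit S c" if "c \<in> clusters N" for c using assms that by (simp add: valid_def)
  have "v t \<in> col S t" if "t \<in> U" for t
    using that
  proof (induction t)
    case (Lf l n)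
    then show ?case using assms(1) by (simp add: valid_def)
  next
    case (Tn a b)
    have "v a = v b \<and> v (Tn a b) = v a"
      using assms Tn.prems by (cases "Tn a b = T") (auto simp: valid_def)
    then show ?case using Tn.IH U_sub(1)[OF Tn.prems] by auto
  next
    case (Pr a b)
    have "v (Pr a b) = v (if s (Pr a b) then b else a)" using assms(1) Pr.prems by (simp add: valid_def)
    then show ?case using Pr.IH U_sub(2)[OF Pr.prems] by (auto split: if_splits)
  qed
  then show "col S t \<noteq> {}" if "t \<in> set ts" for t using ts_U[OF that] by blast
qed

text \<open>Without the link of \<open>T\<close> too few links remain to connect the leaves, so a
  nontrivial colouring exists. If it coloured \<open>A\<close> and \<open>B\<close> alike, it would
  extend across \<open>T\<close>, against correctness. Complementing it, if necessary, makes
  \<open>A\<close> true.\<close>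

lemma cut_exists:
  assumes T: "T \<in> set ts" "T = Tn A B \<or> T = Tn B A"
  shows "\<exists>S v. valid T s S v \<and> v A \<and> \<not> v B"
proof -
  obtain r EN where EN: "(r, EN) \<in> sw N" using sw_ne by blast
  define W where "W = {u \<in> U. \<exists>a b. u = Tn a b} - {T}"
  \<comment> \<open>The default pair never occurs, because \<open>f\<close> is applied to tensors
    only.\<close>
  define f where "f u = (case u of Tn a b \<Rightarrow> (trep s a, trep s b) | _ \<Rightarrow> (0, 0))" for u :: "'a tree"
  define E where "E = f ` W \<union> EN"
  have "{u \<in> U. \<exists>a b. u = Tn a b} = (\<Union>t\<in>set ts. tnodes t)" by (auto simp: U_def tnodes_def)
  moreover have "card (\<Union>t\<in>set ts. tnodes t) \<le> (\<Sum>t\<in>set ts. card (tnodes t))" by (rule card_UN_le) simp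
  moreover have "(\<Sum>t\<in>set ts. card (tnodes t)) \<le> (\<Sum>t\<in>set ts. tens t)" by (rule sum_mono) (rule card_tnodes)
  moreover have "(\<Sum>t\<in>set ts. tens t) \<le> sum_list (map tens ts)"
    by (induction ts) (auto simp: sum.insert_if)
  ultimately have "card {u \<in> U. \<exists>a b. u = Tn a b} \<le> sum_list (map tens ts)" by simp
  moreover have TW: "T \<in> {u \<in> U. \<exists>a b. u = Tn a b}" using T ts_U by blast
  moreover have finW: "finite {u \<in> U. \<exists>a b. u = Tn a b}" using finite_U by simp
  ultimately have "card W < sum_list (map tens ts)"
    unfolding W_def using card_Diff1_less[OF finW TW] by linarith
  moreover have "card E \<le> card W + tens N"
    unfolding E_def using card_Un_le[of "f ` W" EN] card_image_le[of W f] sw_card[OF EN] finW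
    by (simp add: W_def)
  ultimately have "card E + 1 < card (ids N)" using corr by (simp add: corr_def)
  moreover have "finite E" using finW sw_finite[OF EN] by (simp add: E_def W_def)
  ultimately have "\<not> con (ids N) E" using con_card[of E "ids N"] by auto
  then obtain S0 where S0: "resp S0 E" "\<not> (ids N \<inter> S0 = {} \<or> ids N \<subseteq> S0)" by (auto simp: con_def)
  have edge: "(trep s a \<in> S0) = (trep s b \<in> S0)" if "Tn a b \<in> U" "Tn a b \<noteq> T" for a b
  proof -
    have "f (Tn a b) \<in> E" unfolding E_def W_def using that by blast
    then show ?thesis using S0(1) by (auto simp: f_def resp_def)
  qed
  have colN: "col S0 N \<noteq> {}"
    using col_sw[of "r \<in> S0" S0 N] EN S0(1) unfolding E_def resp_simps by blast
  have diff: "(trep s A \<in> S0) \<noteq> (trep s B \<in> S0)"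
  proof
    assume eq: "(trep s A \<in> S0) = (trep s B \<in> S0)"
    have "(trep s t \<in> S0) \<in> col S0 t" if "t \<in> U" for t
      using that
    proof (induction t)
      case (Tn a b)
      have "(trep s a \<in> S0) = (trep s b \<in> S0)"
        using edge[OF Tn.prems] eq T(2) by (cases "Tn a b = T") auto
      then show ?case using Tn.IH U_sub(1)[OF Tn.prems] by auto
    next
      case (Pr a b)
      then show ?case using U_sub(2)[OF Pr.prems] by auto
    qed auto
    then have "ids N \<inter> S0 = {} \<or> ids N \<subseteq> S0"
      using colN ts_U normal_col[OF normal, of S0] by (intro nontrivial) blast+
    then show False using S0 by blast
  qed
  define S where "S = (if trep s A \<in> S0 then S0 else - S0)"
  have mem: "(n \<in> S) = (m \<in> S) \<longleftrightarrow> (n \<in> S0) = (m \<in> S0)" for n m by (auto simp: S_def)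
  have AB: "trep s A \<in> S" "trep s B \<notin> S" using diff by (auto simp: S_def)
  \<comment> \<open>Setting \<open>T\<close> to false violates nothing, since \<open>T\<close> is no
    premise of any node.\<close>
  define v where "v u = (u \<noteq> T \<and> trep s u \<in> S)" for u
  have TU: "Tn a b \<in> U \<or> Pr a b \<in> U \<Longrightarrow> a \<noteq> T \<and> b \<noteq> T" for a b
    using roots[OF T(1)] unfolding U_def .
  have ABT: "A \<noteq> T" "B \<noteq> T" using TU ts_U[OF T(1)] T(2) by auto
  have "valid T s S v"
    unfolding valid_def
  proof (intro conjI allI impI ballI)
    show "v (Lf l n) = (n \<in> S)" for l n using T(2) by (auto simp: v_def)
    show "\<not> v T" by (simp add: v_def)
    show "v a = v b" "v (Tn a b) = v a" if "Tn a b \<in> U" "Tn a b \<noteq> T" for a b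
      using edge[OF that] TU[of a b] that by (auto simp: v_def mem)
    show "v (Pr a b) = v (if s (Pr a b) then b else a)" if "Pr a b \<in> U" for a b
      using TU[of a b] that T(2) by (auto simp: v_def)
    have "resp S EN" using S0(1) resp_Compl by (auto simp: S_def E_def)
    then have "col S N \<noteq> {}" using col_sw[of "r \<in> S" S N] EN by blast
    then show "unsplit S c" if "c \<in> clusters N" for c using normal_col[OF normal] that by blast
  qed
  moreover have "v A" "\<not> v B" using AB ABT by (auto simp: v_def)
  ultimately show ?thesis by blast
qed

text \<open>A cut with as few true nodes as possible, over all switchings: if some true par node had
  a false premise, flipping the switch at that node would lead to a smaller cut or to a
  colouring that contradicts connectedness.\<close>
lemma cut_closed:
  assumes T: "T \<in> set ts" "T = Tn A B \<or> T = Tn B A"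
  shows "\<exists>S. closed T S \<and> ids A \<subseteq> S \<and> \<not> ids B \<subseteq> S"
proof -
  define C where "C = (\<lambda>(s, S, v). valid T s S v \<and> v A \<and> \<not> v B)"
  define m where "m = (\<lambda>(s :: 'a tree \<Rightarrow> bool, S :: nat set, v). card {u \<in> U. v u})"
  obtain x0 where "C x0" using cut_exists[OF T, of "\<lambda>_. False"] unfolding C_def by auto
  from ex_has_least_nat[of C, OF this, of m] obtain x where x: "C x" "\<And>y. C y \<Longrightarrow> m x \<le> m y" by blast
  obtain s S v where xs: "x = (s, S, v)" by (cases x)
  have val: "valid T s S v" and vA: "v A" and vB: "\<not> v B" using x(1) by (auto simp: C_def xs)
  have least: "card {u \<in> U. v u} \<le> card {u \<in> U. v' u}" if "valid T s' S' v'" "v' A" "\<not> v' B" for s' S' v'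
    using x(2)[of "(s', S', v')"] that by (auto simp: C_def m_def xs)
  have TU: "A \<in> U" "B \<in> U" using ts_U[OF T(1)] U_sub(1)[of A B] U_sub(1)[of B A] T(2) by auto
  have par: "v a \<and> v b" if p: "Pr a b \<in> U" and vp: "v (Pr a b)" for a b
  proof (rule ccontr)
    assume no: "\<not> (v a \<and> v b)"
    define s' where "s' = s(Pr a b := \<not> s (Pr a b))"
    \<comment> \<open>\<open>x\<close> is the premise kept by \<open>s\<close>, hence true like the
      par itself; \<open>y\<close> is the deleted one. The flipped switching \<open>s'\<close> keeps
      \<open>y\<close>.\<close>
    define x where "x = (if s (Pr a b) then b else a)"
    define y where "y = (if s (Pr a b) then a else b)"
    have vx: "v x" using val p vp by (simp add: valid_def x_def)
    have vy: "\<not> v y" using no vx by (auto simp: x_def y_def split: if_splits)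
    obtain S' v' where v': "valid T s' S' v'" "v' A" "\<not> v' B" using cut_exists[OF T] by blast
    have v'p: "v' (Pr a b) = v' y" using v'(1) p by (simp add: valid_def s'_def y_def)
    have yU: "y \<in> U" using U_sub(2)[OF p] by (simp add: y_def)
    show False
    proof (cases "v' (Pr a b)")
      case False
      \<comment> \<open>The par and \<open>y\<close> are both false in the meet, so it obeys
        \<open>s'\<close>. It is a strictly smaller cut, against the choice of
        \<open>v\<close>.\<close>
      define w where "w u = (v u \<and> v' u)" for u
      have "valid T s' (S \<inter> S') w"
        unfolding valid_def
      proof (intro conjI allI impI ballI)
        show "w (Lf l n) = (n \<in> S \<inter> S')" if "Lf l n \<in> U" for l n
          using val v'(1) that by (simp add: valid_def w_def)
        show "\<not> w T" using val by (simp add: valid_def w_def)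
        show "w a = w b" "w (Tn a b) = w a" if "Tn a b \<in> U" "Tn a b \<noteq> T" for a b
          using val v'(1) that by (simp_all add: valid_def w_def)
        show "w (Pr c d) = w (if s' (Pr c d) then d else c)" if q: "Pr c d \<in> U" for c d
        proof (cases "Pr c d = Pr a b")
          case True
          then show ?thesis using False v'p vy by (auto simp: w_def s'_def y_def)
        next
          case False
          then have "s' (Pr c d) = s (Pr c d)" by (simp add: s'_def)
          then show ?thesis using val v'(1) q by (simp add: valid_def w_def)
        qed
        show "unsplit (S \<inter> S') c" if "c \<in> clusters N" for c
          using val v'(1) that by (auto simp: valid_def unsplit_def)
      qed
      moreover have "w A" "\<not> w B" using vA vB v' by (auto simp: w_def)
      ultimately have "card {u \<in> U. v u} \<le> card {u \<in> U. w u}" by (rule least)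
      moreover have "card {u \<in> U. w u} < card {u \<in> U. v u}"
        using finite_U p vp False by (intro psubset_card_mono) (auto simp: w_def)
      ultimately show False by simp
    next
      case True
      \<comment> \<open>The par and \<open>x\<close> are both false in the difference, so it obeys
        \<open>s\<close>. It is false at both premises of \<open>T\<close> and must be trivial,
        although it is true at \<open>y\<close>.\<close>
      define w where "w u = (v' u \<and> \<not> v u)" for u
      have val': "valid T s (S' - S) w"
        unfolding valid_def
      proof (intro conjI allI impI ballI)
        show "w (Lf l n) = (n \<in> S' - S)" if "Lf l n \<in> U" for l n
          using val v'(1) that by (simp add: valid_def w_def)
        show "\<not> w T" using v'(1) by (simp add: valid_def w_def)
        show "w a = w b" "w (Tn a b) = w a" if "Tn a b \<in> U" "Tn a b \<noteq> T" for a b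
          using val v'(1) that by (simp_all add: valid_def w_def)
        show "w (Pr c d) = w (if s (Pr c d) then d else c)" if q: "Pr c d \<in> U" for c d
        proof (cases "Pr c d = Pr a b")
          case True
          then show ?thesis using vp vx by (auto simp: w_def x_def)
        next
          case False
          then have "s' (Pr c d) = s (Pr c d)" by (simp add: s'_def)
          then show ?thesis using val v'(1) q by (simp add: valid_def w_def)
        qed
        show "unsplit (S' - S) c" if "c \<in> clusters N" for c
          using val v'(1) that by (auto simp: valid_def unsplit_def)
      qed
      have wA: "\<not> w A" and wB: "\<not> w B" using vA v' by (auto simp: w_def)
      have wy: "w y" using True v'p vy by (simp add: w_def)
      obtain n where n: "n \<in> ids A" "n \<notin> S' - S" using valid_leaf[OF val' T(2) wB TU(1)] wA by auto
      obtain n' where n': "n' \<in> ids y" "n' \<in> S' - S" using valid_leaf[OF val' T(2) wB yU] wy by auto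
      have "ids N \<inter> (S' - S) = {} \<or> ids N \<subseteq> S' - S" by (rule valid_trivial[OF val' T(2) wA wB])
      then show False using n n' U_ids[OF TU(1)] U_ids[OF yU] by blast
    qed
  qed
  \<comment> \<open>A true par now has two true premises, so truth at a node means that all its
    leaves are in \<open>S\<close>. This turns the cut of one switching into a closed set.\<close>
  have full: "v u = (ids u \<subseteq> S)" if "u \<in> U" for u
    using that
  proof (induction u)
    case (Lf l n)
    then show ?case using val by (simp add: valid_def)
  next
    case (Tn a b)
    have ab: "v a = (ids a \<subseteq> S)" "v b = (ids b \<subseteq> S)" using Tn U_sub(1)[OF Tn.prems] by blast+
    show ?case
    proof (cases "Tn a b = T")
      case True
      then have "\<not> v (Tn a b)" "B = a \<or> B = b" using val T(2) by (auto simp: valid_def)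
      then show ?thesis using vB ab by auto
    next
      case False
      then have "v a = v b \<and> v (Tn a b) = v a" using val Tn.prems by (simp add: valid_def)
      then show ?thesis using ab by auto
    qed
  next
    case (Pr a b)
    have ab: "v a = (ids a \<subseteq> S)" "v b = (ids b \<subseteq> S)" using Pr U_sub(2)[OF Pr.prems] by blast+
    have "v (Pr a b) = v (if s (Pr a b) then b else a)" using val Pr.prems by (simp add: valid_def)
    then have "v (Pr a b) = (v a \<and> v b)" using par[OF Pr.prems] by (auto split: if_splits)
    then show ?case using ab by simp
  qed
  have "closed T S"
    unfolding closed_def
  proof (intro conjI allI impI ballI)
    show "unsplit S c" if "c \<in> clusters N" for c using val that by (simp add: valid_def)
    show "ids a \<subseteq> S \<longleftrightarrow> ids b \<subseteq> S" if "Tn a b \<in> U" "Tn a b \<noteq> T" for a b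
    proof -
      have "v a = v b" using val that by (simp add: valid_def)
      then show ?thesis using full U_sub(1)[OF that(1)] by simp
    qed
  qed
  then show ?thesis using full TU vA vB by blast
qed

definition empire :: "'a tree \<Rightarrow> 'a tree \<Rightarrow> nat set" where
  "empire T A = \<Inter>{S. closed T S \<and> ids A \<subseteq> S}"

lemma closed_Inter:
  assumes "\<And>S. S \<in> \<S> \<Longrightarrow> closed T S"
  shows "closed T (\<Inter>\<S>)"
  unfolding closed_def
proof (intro conjI allI impI ballI)
  fix c assume "c \<in> clusters N"
  then have "unsplit S c" if "S \<in> \<S>" for S using assms[OF that] by (simp add: closed_def)
  then show "unsplit (\<Inter>\<S>) c" unfolding unsplit_def by blast
next
  fix a b assume "Tn a b \<in> U" "Tn a b \<noteq> T"
  then have "ids a \<subseteq> S \<longleftrightarrow> ids b \<subseteq> S" if "S \<in> \<S>" for S using assms[OF that] by (simp add: closed_def)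
  then show "ids a \<subseteq> \<Inter>\<S> \<longleftrightarrow> ids b \<subseteq> \<Inter>\<S>" unfolding le_Inf_iff by blast
qed

lemma empire_closed: "closed T (empire T A)" "ids A \<subseteq> empire T A"
  unfolding empire_def by (rule closed_Inter) auto

lemma empire_least: "closed T S \<Longrightarrow> ids A \<subseteq> S \<Longrightarrow> empire T A \<subseteq> S"
  unfolding empire_def by blast

lemma empire_B: "T \<in> set ts \<Longrightarrow> T = Tn A B \<or> T = Tn B A \<Longrightarrow> \<not> ids B \<subseteq> empire T A"
proof -
  assume "T \<in> set ts" "T = Tn A B \<or> T = Tn B A"
  from cut_closed[OF this] obtain S where "closed T S" "ids A \<subseteq> S" "\<not> ids B \<subseteq> S" by blast
  then show "\<not> ids B \<subseteq> empire T A" using empire_least[of T S A] by blast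
qed

lemma empire_sub: "A \<in> U \<Longrightarrow> empire T A \<subseteq> ids N"
proof (rule empire_least)
  show "closed T (ids N)"
    unfolding closed_def unsplit_def using clusters_ids U_sub(1) U_ids by blast
qed (rule U_ids)

text \<open>Both premises of every tensor root compete for the largest empire. Maximality is used
  against another tensor root \<open>t\<close> that crosses \<open>E\<close>: the empire of a
  premise of \<open>t\<close> that meets \<open>E\<close> would contain both \<open>E\<close> and
  \<open>B\<close>.\<close>

theorem splitting:
  assumes no_par: "\<And>a b. Pr a b \<notin> set ts" and ex: "Tn A0 B0 \<in> set ts"
  shows "\<exists>A B E. Tn A B \<in> set ts \<and> ids A \<subseteq> E \<and> ids B \<inter> E = {} \<and> (\<forall>c\<in>clusters N. unsplit E c) \<and>
    (\<forall>t\<in>set ts. t \<noteq> Tn A B \<longrightarrow> unsplit E (ids t))"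
proof -
  define C where "C = (\<lambda>(T, A, B). T \<in> set ts \<and> (T = Tn A B \<or> T = Tn B A))"
  define m where "m = (\<lambda>(T, A, B :: 'a tree). card (empire T A))"
  have C0: "C (Tn A0 B0, A0, B0)" using ex by (simp add: C_def)
  have CU: "A \<in> U" "B \<in> U" if "C (T, A, B)" for T A B
  proof -
    have "Tn A B \<in> U \<or> Tn B A \<in> U" using that ts_U by (auto simp: C_def)
    then show "A \<in> U" "B \<in> U" using U_sub(1)[of A B] U_sub(1)[of B A] by blast+
  qed
  have bound: "\<forall>y. C y \<longrightarrow> m y < Suc (card (ids N))"
  proof (intro allI impI)
    fix y assume "C y"
    moreover obtain T A B where y: "y = (T, A, B)" by (cases y)
    ultimately have "empire T A \<subseteq> ids N" using CU(1) empire_sub by blast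
    then show "m y < Suc (card (ids N))" by (simp add: y m_def card_mono less_Suc_eq_le)
  qed
  from Lattices_Big.ex_has_greatest_nat[OF C0 bound] obtain x where x: "C x" "\<And>y. C y \<Longrightarrow> m y \<le> m x" by blast
  obtain T A B where xT: "x = (T, A, B)" by (cases x)
  have T: "T \<in> set ts" "T = Tn A B \<or> T = Tn B A" using x(1) by (auto simp: C_def xT)
  note AB = CU[OF x(1)[unfolded xT]]
  define E where "E = empire T A"
  have E: "closed T E" "ids A \<subseteq> E" "\<not> ids B \<subseteq> E"
    unfolding E_def by (rule empire_closed empire_B[OF T])+
  have max: "card (empire T' A') \<le> card E" if "T' \<in> set ts" "T' = Tn A' B' \<or> T' = Tn B' A'" for T' A' B'
    using x(2)[of "(T', A', B')"] that by (auto simp: C_def m_def xT E_def)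
  have meet_closed: "closed T (E \<inter> S)" if "closed T S" for S
    using closed_Inter[of "{E, S}" T] E(1) that by auto
  have trivial: "ids N \<inter> S = {} \<or> ids N \<subseteq> S" if "closed T S" "ids A \<subseteq> S \<longleftrightarrow> ids B \<subseteq> S" for S
    using T(2) closed_trivial[of A B S] closed_trivial[of B A S] that by blast
  \<comment> \<open>Neither premise of \<open>T\<close> lies in both empires, so their intersection
    also satisfies the constraint at \<open>T\<close> and is trivial. A leaf of \<open>B\<close> in
    \<open>E\<close> would make it the whole net.\<close>
  have B: "ids B \<inter> E = {}"
  proof (rule ccontr)
    assume ne: "ids B \<inter> E \<noteq> {}"
    let ?F = "empire T B"
    have F: "closed T ?F" "ids B \<subseteq> ?F" "\<not> ids A \<subseteq> ?F"
      using empire_closed empire_B[of T B A] T by blast+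
    have "ids N \<inter> (E \<inter> ?F) = {} \<or> ids N \<subseteq> E \<inter> ?F"
      using F E by (intro trivial meet_closed) auto
    then show False using ne F E U_ids AB by blast
  qed
  have others: "unsplit E (ids t)" if t: "t \<in> set ts" "t \<noteq> T" for t
  proof (rule ccontr)
    assume nm: "\<not> unsplit E (ids t)"
    then obtain A' B' where tAB: "t = Tn A' B'"
      using no_par t(1) by (cases t) (auto simp: unsplit_def)
    have tU: "Tn A' B' \<in> U" using ts_U[OF t(1)] tAB by simp
    have "ids A' \<subseteq> E \<longleftrightarrow> ids B' \<subseteq> E" using E(1) tU t(2) tAB by (auto simp: closed_def)
    then have normal: "\<not> ids A' \<subseteq> E" "\<not> ids B' \<subseteq> E" using nm tAB by (auto simp: unsplit_def)
    have "ids A' \<inter> E \<noteq> {} \<or> ids B' \<inter> E \<noteq> {}" using nm tAB by (auto simp: unsplit_def)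
    then obtain A1 B1 where A1: "t = Tn A1 B1 \<or> t = Tn B1 A1" "ids A1 \<inter> E \<noteq> {}" "\<not> ids A1 \<subseteq> E" "\<not> ids B1 \<subseteq> E"
      using normal tAB by blast
    let ?F = "empire t A1"
    have A1U: "A1 \<in> U" using U_sub(1)[OF tU] A1(1) tAB by auto
    have F: "closed t ?F" "ids A1 \<subseteq> ?F" using empire_closed by blast+
    \<comment> \<open>\<open>?F\<close> need not satisfy the constraint at \<open>t\<close>, but
      neither premise of \<open>t\<close> lies inside \<open>E\<close>, so the intersection
      satisfies it.\<close>
    have D: "closed T (E \<inter> ?F)"
      unfolding closed_def
    proof (intro conjI allI impI ballI)
      show "unsplit (E \<inter> ?F) c" if "c \<in> clusters N" for c
        using E(1) F(1) that by (auto simp: closed_def unsplit_def)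
      show "ids a \<subseteq> E \<inter> ?F \<longleftrightarrow> ids b \<subseteq> E \<inter> ?F" if ab: "Tn a b \<in> U" "Tn a b \<noteq> T" for a b
      proof (cases "Tn a b = t")
        case True
        then show ?thesis using A1 by auto
      next
        case False
        then show ?thesis using E(1) F(1) ab by (simp add: closed_def)
      qed
    qed
    \<comment> \<open>Otherwise neither premise of \<open>T\<close> is inside, the closed
      intersection is trivial, and yet it contains a leaf of \<open>A1\<close> and misses a leaf of
      \<open>A\<close>.\<close>
    have "ids A \<subseteq> E \<inter> ?F"
    proof (rule ccontr)
      assume nA: "\<not> ids A \<subseteq> E \<inter> ?F"
      then have "ids N \<inter> (E \<inter> ?F) = {} \<or> ids N \<subseteq> E \<inter> ?F" using E(3) by (intro trivial D) auto
      then show False using nA A1(2) F(2) U_ids[OF A1U] U_ids[OF AB(1)] by blast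
    qed
    then have AF: "ids A \<subseteq> ?F" and "E \<subseteq> ?F"
      using empire_least[OF D, of A] unfolding E_def by auto
    have "ids A \<subseteq> ?F \<longleftrightarrow> ids B \<subseteq> ?F" using F(1) T t(2) ts_U[OF T(1)] by (auto simp: closed_def)
    then have "ids B \<subseteq> ?F" using AF by blast
    then have "E \<subset> ?F" using \<open>E \<subseteq> ?F\<close> E(3) by blast
    then have "card E < card ?F"
      using finite_subset[OF empire_sub[OF A1U]] by (intro psubset_card_mono) auto
    then show False using max[OF t(1) A1(1)] by simp
  qed
  have mE: "\<forall>c\<in>clusters N. unsplit E c" using E(1) by (simp add: closed_def)
  from T(2) show ?thesis
  proof
    assume "T = Tn A B"
    then show ?thesis using T(1) E(2) B mE others by blast
  next
    \<comment> \<open>The largest empire belongs to the right premise, so its complement plays the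
      part of the left half.\<close>
    assume TBA: "T = Tn B A"
    have neg: "unsplit (- E) c" if "unsplit E c" for c using that by (auto simp: unsplit_def)
    show ?thesis
      by (intro exI[of _ B] exI[of _ A] exI[of _ "- E"]) (use TBA T(1) E(2) B mE others neg in auto)
  qed
qed

end

section \<open>Sequentialization\<close>

definition net :: "'a tree \<Rightarrow> 'a tree list \<Rightarrow> bool" where
  "net P ts \<longleftrightarrow> shared P ts \<and> corr P ts \<and> is_linking P"

lemma shared_perm:
  fixes P :: "'a tree"
  shows "mset ts = mset ts' \<Longrightarrow> shared P ts = shared P ts'"
proof -
  have "mset (concat (map leaves ts)) = (\<Sum>t\<in>#mset ts. mset (leaves t))" for ts :: "'a tree list"
    by (induction ts) auto
  then show "mset ts = mset ts' \<Longrightarrow> shared P ts = shared P ts'" unfolding shared_iff by simp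
qed

lemma net_perm: "mset ts = mset ts' \<Longrightarrow> net P ts = net P ts'"
  unfolding net_def using shared_perm[of ts ts' P] corr_perm[of ts ts' P] by blast

lemma net_ids: "net P ts \<Longrightarrow> ids P = (\<Union>t\<in>set ts. ids t)"
  unfolding net_def using shared_ids by blast

lemma net_par: "net P (Pr A B # ts) \<longleftrightarrow> net P (A # B # ts)"
  by (simp add: net_def corr_par shared_def)

lemma net_bot:
  assumes "net P ts" "n \<notin> ids P"
  shows "net (Tn (Lf LB n) P) (Lf LB n # ts)"
  using assms corr_bot[of P ts n LB] by (auto simp: net_def shared_iff ids_def)

lemma net_tens:
  assumes P: "net P (A # rs)" and Q: "net Q (B # ds)" and disj: "ids P \<inter> ids Q = {}"
  shows "net (Pr P Q) (Tn A B # rs @ ds)"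
proof -
  have "corr (Pr P Q) (Tn A B # rs @ ds)"
    using P Q disj net_ids[OF P] net_ids[OF Q] by (intro corr_tens) (auto simp: net_def)
  moreover have "shared (Pr P Q) (Tn A B # rs @ ds)"
    using P Q disj unfolding net_def shared_iff by (auto simp: ids_def)
  ultimately show ?thesis using P Q by (simp add: net_def)
qed

lemma inwards_net: "inwards P P' \<Longrightarrow> net P ts \<Longrightarrow> net P' ts"
proof (induction rule: rtranclp_induct)
  case (step y z)
  then have y: "net y ts" by blast
  show ?case
    using y inward_inv[OF step(2)] shared_mset[of z y ts] inward_linking[OF step(2)] by (simp add: net_def)
qed

text \<open>Equivalence through correct graphs by moves free of side conditions. Unlike
  \<open>lk_equiv\<close> it lifts from a subnet to a larger net, since the side conditions are
  recovered only at the end, for the final sequent.\<close>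

definition net_equiv :: "'a tree list \<Rightarrow> 'a tree \<Rightarrow> 'a tree \<Rightarrow> bool" where
  "net_equiv ts = (\<lambda>P P'. net P ts \<and> net P' ts \<and> (inward P P' \<or> inward P' P))\<^sup>*\<^sup>*"

lemma net_equiv_refl [simp]: "net_equiv ts P P"
  by (simp add: net_equiv_def)

lemma net_equiv_trans [trans]: "net_equiv ts P Q \<Longrightarrow> net_equiv ts Q R \<Longrightarrow> net_equiv ts P R"
  unfolding net_equiv_def by (rule rtranclp_trans)

lemma net_equiv_sym: "net_equiv ts P Q \<Longrightarrow> net_equiv ts Q P"
  unfolding net_equiv_def by (rule sympD[OF symp_rtranclp]) (auto simp: symp_def)

lemma net_equiv_net: "net_equiv ts P Q \<Longrightarrow> net P ts \<Longrightarrow> net Q ts"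
  unfolding net_equiv_def by (induction rule: rtranclp_induct) auto

lemma net_equiv_perm: "mset ts = mset ts' \<Longrightarrow> net_equiv ts = net_equiv ts'"
  unfolding net_equiv_def using net_perm[of ts ts'] by presburger

lemma inwards_net_equiv: "inwards P P' \<Longrightarrow> net P ts \<Longrightarrow> net_equiv ts P P'"
proof (induction rule: rtranclp_induct)
  case (step y z)
  have "net y ts" by (rule inwards_net[OF step(1,4)])
  moreover have "net z ts" using inwards_net[OF _ calculation] step(2) by blast
  ultimately have "net_equiv ts y z" using step(2) unfolding net_equiv_def by blast
  with step show ?case using net_equiv_trans by blast
qed simp

lemma net_equiv_lift:
  assumes "net_equiv ts P P'" "\<And>P. net P ts \<Longrightarrow> net (C P) ts'" "\<And>x y. inward x y \<Longrightarrow> inward (C x) (C y)"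
  shows "net_equiv ts' (C P) (C P')"
  using assms(1) unfolding net_equiv_def
proof (induction rule: rtranclp_induct)
  case (step y z)
  then have "net (C y) ts' \<and> net (C z) ts' \<and> (inward (C y) (C z) \<or> inward (C z) (C y))"
    using assms(2,3) by blast
  with step.IH show ?case by (rule rtranclp.rtrancl_into_rtrancl)
qed simp

lemma net_equiv_lk_equiv: "net_equiv (map rtree rs) P P' \<Longrightarrow> lk_equiv rs P P'"
  unfolding net_equiv_def lk_equiv_def
proof (induction rule: rtranclp_induct)
  case (step y z)
  then have "eq_step rs y z \<or> eq_step rs z y"
    using inward_eq_step[of y z rs] inward_eq_step[of z y rs] by (auto simp: net_def)
  with step.IH show ?case by (rule rtranclp.rtrancl_into_rtrancl)
qed simp

lemma connected_card:
  assumes "\<And>S. col S P \<noteq> {} \<Longrightarrow> (\<forall>t\<in>set ts. col S t \<noteq> {}) \<Longrightarrow> ids P \<inter> S = {} \<or> ids P \<subseteq> S"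
  shows "card (ids P) \<le> tens P + sum_list (map tens ts) + 1"
proof -
  obtain r E where E: "(r, E) \<in> sw P" using sw_ne by blast
  have F: "seq_links (\<lambda>_. False) ts \<in> swl ts" by (rule seq_links_swl)
  let ?F = "seq_links (\<lambda>_. False) ts"
  have "con (ids P) (E \<union> ?F)"
    unfolding con_def resp_simps
  proof (intro allI impI assms)
    fix S assume "resp S E \<and> resp S ?F"
    then show "col S P \<noteq> {}" "\<forall>t\<in>set ts. col S t \<noteq> {}"
      using col_sw[of "r \<in> S" S P] E swl_col[of ts S] F by blast+
  qed
  then have "card (ids P) \<le> card (E \<union> ?F) + 1"
    using sw_finite[OF E] swl_finite[OF F] by (intro con_card) auto
  also have "card (E \<union> ?F) \<le> tens P + sum_list (map tens ts)"
    using card_Un_le[of E ?F] sw_card[OF E] swl_card[OF F] by linarith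
  finally show ?thesis by simp
qed

text \<open>A colouring of the left half is extended to the whole by giving everything outside
  \<open>E\<close> one colour \<open>b\<close> that \<open>A\<close> can take. \<open>B\<close> then
  takes \<open>b\<close> too, so the splitting tensor is satisfied and connectedness of the whole
  applies.\<close>

lemma connected_half:
  fixes N1 N2 A B :: "'a tree" and rs1 rs2 :: "'a tree list"
  assumes h: "\<And>S. col S N1 \<noteq> {} \<Longrightarrow> col S N2 \<noteq> {} \<Longrightarrow> col S A \<inter> col S B \<noteq> {} \<Longrightarrow>
      (\<forall>t\<in>set rs1 \<union> set rs2. col S t \<noteq> {}) \<Longrightarrow> ids N1 \<inter> S = {} \<or> ids N1 \<subseteq> S"
    and E: "ids N1 \<subseteq> E" "ids A \<subseteq> E" "\<forall>t\<in>set rs1. ids t \<subseteq> E"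
    and nE: "ids N2 \<inter> E = {}" "ids B \<inter> E = {}" "\<forall>t\<in>set rs2. ids t \<inter> E = {}"
    and S: "col S N1 \<noteq> {}" "\<forall>t\<in>set (A # rs1). col S t \<noteq> {}"
  shows "ids N1 \<inter> S = {} \<or> ids N1 \<subseteq> S"
proof -
  obtain b where b: "b \<in> col S A" using S(2) by auto
  define S' where "S' = S \<inter> E \<union> (if b then - E else {})"
  have in_eq: "col S' t = col S t" if "ids t \<subseteq> E" for t :: "'a tree"
    by (rule col_cong) (use that in \<open>auto simp: S'_def\<close>)
  have out_eq: "col S' t = {b}" if "ids t \<inter> E = {}" for t :: "'a tree"
  proof -
    have "if b then ids t \<subseteq> S' else ids t \<inter> S' = {}" using that by (auto simp: S'_def)
    then show ?thesis using col_mono[of t S'] by (cases b) auto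
  qed
  have "ids N1 \<inter> S' = {} \<or> ids N1 \<subseteq> S'"
  proof (rule h)
    show "col S' N1 \<noteq> {}" using S(1) in_eq[OF E(1)] by simp
    show "col S' N2 \<noteq> {}" using out_eq[OF nE(1)] by simp
    show "col S' A \<inter> col S' B \<noteq> {}" using b in_eq[OF E(2)] out_eq[OF nE(2)] by auto
    show "\<forall>t\<in>set rs1 \<union> set rs2. col S' t \<noteq> {}"
    proof
      fix t assume "t \<in> set rs1 \<union> set rs2"
      then show "col S' t \<noteq> {}"
      proof
        assume t: "t \<in> set rs1"
        then show ?thesis using in_eq[OF E(3)[rule_format, OF t]] S(2) by simp
      next
        assume t: "t \<in> set rs2"
        then show ?thesis using out_eq[OF nE(3)[rule_format, OF t]] by simp
      qed
    qed
  qed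
  moreover have "m \<in> S' \<longleftrightarrow> m \<in> S" if "m \<in> ids N1" for m using that E(1) by (auto simp: S'_def)
  ultimately show ?thesis by blast
qed

lemma filter_leaves:
  "ids t \<subseteq> E \<Longrightarrow> filter_mset (\<lambda>x. snd x \<in> E) (mset (leaves t)) = mset (leaves t)"
  "ids t \<inter> E = {} \<Longrightarrow> filter_mset (\<lambda>x. snd x \<in> E) (mset (leaves t)) = {#}"
  by (auto simp: ids_def filter_mset_eq_conv)

lemma filter_leaves_list:
  "\<forall>t\<in>set ts. ids t \<subseteq> E \<Longrightarrow>
    filter_mset (\<lambda>x. snd x \<in> E) (mset (concat (map leaves ts))) = mset (concat (map leaves ts))"
  "\<forall>t\<in>set ts. ids t \<inter> E = {} \<Longrightarrow> filter_mset (\<lambda>x. snd x \<in> E) (mset (concat (map leaves ts))) = {#}"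
  by (induction ts) (simp_all add: filter_leaves)

text \<open>Both halves are connected, so each has at most as many leaves as tensors plus 1. The
  splitting tensor accounts for the second 1, so these bounds add up to the exact count of the whole
  and both are equalities.\<close>

lemma net_split:
  assumes net: "net (Pr N1 N2) (Tn A B # rs1 @ rs2)"
    and E: "ids N1 \<subseteq> E" "ids A \<subseteq> E" "\<forall>t\<in>set rs1. ids t \<subseteq> E"
    and nE: "ids N2 \<inter> E = {}" "ids B \<inter> E = {}" "\<forall>t\<in>set rs2. ids t \<inter> E = {}"
  shows "net N1 (A # rs1)" "net N2 (B # rs2)"
proof -
  have corr: "corr (Pr N1 N2) (Tn A B # rs1 @ rs2)" and shared: "shared (Pr N1 N2) (Tn A B # rs1 @ rs2)"
    and lk: "is_linking N1" "is_linking N2" using net by (auto simp: net_def)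
  have nE': "ids N2 \<subseteq> - E" "ids B \<subseteq> - E" "\<forall>t\<in>set rs2. ids t \<subseteq> - E" using nE by blast+
  have E': "ids N1 \<inter> - E = {}" "ids A \<inter> - E = {}" "\<forall>t\<in>set rs1. ids t \<inter> - E = {}" using E by blast+
  have eq: "mset (leaves N1) + mset (leaves N2) = mset (leaves A) + mset (leaves B) +
      (mset (concat (map leaves rs1)) + mset (concat (map leaves rs2)))"
    using shared by (simp add: shared_iff ac_simps)
  \<comment> \<open>Filtering the leaf equation of the whole by \<open>E\<close> keeps exactly the
    left half.\<close>
  have eq1: "mset (leaves N1) = mset (leaves A) + mset (concat (map leaves rs1))"
    using arg_cong[OF eq, of "filter_mset (\<lambda>x. snd x \<in> E)"] E nE
    by (simp add: filter_leaves filter_leaves_list del: mset_concat)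
  have eq2: "mset (leaves N2) = mset (leaves B) + mset (concat (map leaves rs2))"
    using eq eq1 by (simp add: ac_simps del: mset_concat)
  have wf1: "shared N1 (A # rs1)" and wf2: "shared N2 (B # rs2)"
    using eq1 eq2 shared by (auto simp: shared_iff)
  have disj: "ids N1 \<inter> ids N2 = {}" using E nE by blast
  have h: "ids (Pr N1 N2) \<inter> S = {} \<or> ids (Pr N1 N2) \<subseteq> S"
    if "col S N1 \<noteq> {}" "col S N2 \<noteq> {}" "col S A \<inter> col S B \<noteq> {}" "\<forall>t\<in>set rs1 \<union> set rs2. col S t \<noteq> {}" for S
    by (rule corrD[OF corr]) (use that in auto)
  have con1: "ids N1 \<inter> S = {} \<or> ids N1 \<subseteq> S" if "col S N1 \<noteq> {}" "\<forall>t\<in>set (A # rs1). col S t \<noteq> {}" for S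
  proof (rule connected_half[OF _ E nE that])
    fix S assume "col S N1 \<noteq> {}" "col S N2 \<noteq> {}" "col S A \<inter> col S B \<noteq> {}" "\<forall>t\<in>set rs1 \<union> set rs2. col S t \<noteq> {}"
    from h[OF this] show "ids N1 \<inter> S = {} \<or> ids N1 \<subseteq> S" by auto
  qed
  have con2: "ids N2 \<inter> S = {} \<or> ids N2 \<subseteq> S" if "col S N2 \<noteq> {}" "\<forall>t\<in>set (B # rs2). col S t \<noteq> {}" for S
  proof (rule connected_half[OF _ nE' E' that])
    fix S assume "col S N2 \<noteq> {}" "col S N1 \<noteq> {}" "col S B \<inter> col S A \<noteq> {}" "\<forall>t\<in>set rs2 \<union> set rs1. col S t \<noteq> {}"
    with h[of S] show "ids N2 \<inter> S = {} \<or> ids N2 \<subseteq> S" by (auto simp: Int_commute Un_commute)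
  qed
  have "card (ids N1) + card (ids N2) = tens (Pr N1 N2) + sum_list (map tens (Tn A B # rs1 @ rs2)) + 1"
    using corr disj by (simp add: corr_def card_Un_disjoint)
  moreover have "card (ids N1) \<le> tens N1 + sum_list (map tens (A # rs1)) + 1"
    by (rule connected_card) (rule con1)
  moreover have "card (ids N2) \<le> tens N2 + sum_list (map tens (B # rs2)) + 1"
    by (rule connected_card) (rule con2)
  ultimately have "card (ids N1) = tens N1 + sum_list (map tens (A # rs1)) + 1"
    "card (ids N2) = tens N2 + sum_list (map tens (B # rs2)) + 1" by simp_all
  then have "corr N1 (A # rs1)" "corr N2 (B # rs2)"
    unfolding corr_def using con1 con2 by blast+
  then show "net N1 (A # rs1)" "net N2 (B # rs2)" using wf1 wf2 lk by (auto simp: net_def)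
qed

text \<open>Since \<open>n\<close> is itself a root, the sequent imposes nothing on its colour. The
  colour offered by \<open>extract_bot\<close> can therefore be used, and connectedness of
  \<open>P\<close> carries over to \<open>P0\<close>.\<close>

lemma net_extract_bot:
  assumes net: "net P (Lf LB n # ts)"
  shows "\<exists>P0. net P0 ts \<and> n \<notin> ids P0 \<and> net_equiv (Lf LB n # ts) (Tn (Lf LB n) P0) P"
proof -
  have shared: "shared P (Lf LB n # ts)" and corr: "corr P (Lf LB n # ts)" and lk: "is_linking P"
    using net by (auto simp: net_def)
  have "(LB, n) \<in> set (leaves P)" "distinct (map snd (leaves P))" using shared by (auto simp: shared_def)
  from extract_bot[OF lk this] obtain P0 where P0: "is_linking P0" "inwards (Tn (Lf LB n) P0) P"
    "\<And>S b. b \<in> col S P0 \<Longrightarrow> \<exists>c. b \<in> col (recolour S n c) P" by auto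
  have inv: "mset (leaves P) = mset (leaves (Tn (Lf LB n) P0))" "tens P = Suc (tens P0)"
    using inwards_inv[OF P0(2)] by auto
  have wf': "shared (Tn (Lf LB n) P0) (Lf LB n # ts)" using shared shared_mset[OF inv(1)] by blast
  then have wf0: "shared P0 ts" by (simp add: shared_iff)
  have n: "n \<notin> ids P0" using wf' by (auto simp: shared_iff ids_def)
  then have nts: "n \<notin> ids t" if "t \<in> set ts" for t using shared_ids[OF wf0] that by auto
  have idsP: "ids P = insert n (ids P0)" using ids_mset[OF inv(1)] by simp
  have "corr P0 ts"
    unfolding corr_def
  proof (intro conjI allI impI)
    show "card (ids P0) = tens P0 + sum_list (map tens ts) + 1"
      using corr n idsP inv(2) by (simp add: corr_def)
    fix S assume "col S P0 \<noteq> {}" and ts: "\<forall>t\<in>set ts. col S t \<noteq> {}"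
    then obtain c where c: "col (recolour S n c) P \<noteq> {}" using P0(3) by blast
    have "ids P \<inter> recolour S n c = {} \<or> ids P \<subseteq> recolour S n c"
      by (rule corrD[OF corr c]) (use ts nts in \<open>auto simp: col_recolour\<close>)
    moreover have "m \<in> recolour S n c \<longleftrightarrow> m \<in> S" if "m \<in> ids P0" for m using n that by auto
    ultimately show "ids P0 \<inter> S = {} \<or> ids P0 \<subseteq> S" using idsP by blast
  qed
  then have net0: "net P0 ts" using wf0 P0(1) by (simp add: net_def)
  then have "net_equiv (Lf LB n # ts) (Tn (Lf LB n) P0) P"
    using inwards_net_equiv[OF P0(2)] net_bot[OF net0 n] by blast
  then show ?thesis using net0 n by blast
qed

lemma shared_disjoint:
  assumes "shared P (t # ts)" "u \<in> set ts"
  shows "ids t \<inter> ids u = {}"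
proof -
  have "ids t \<inter> snd ` set (concat (map leaves ts)) = {}" using assms(1) by (simp add: shared_def ids_def)
  moreover have "ids u \<subseteq> snd ` set (concat (map leaves ts))"
    unfolding ids_def using assms(2) by (intro image_mono) auto
  ultimately show ?thesis by blast
qed

text \<open>Within its own tree a root is too large to be a premise, and in another tree its leaves
  do not occur.\<close>

lemma root_not_subtree:
  assumes shared: "shared P ts" and T: "T \<in> set ts" and ab: "Tn a b \<in> (\<Union>t\<in>set ts. subtrees t) \<or> Pr a b \<in> (\<Union>t\<in>set ts. subtrees t)"
  shows "a \<noteq> T \<and> b \<noteq> T"
proof -
  have "T \<noteq> a \<and> T \<noteq> b" if u: "u = Tn a b \<or> u = Pr a b" "u \<in> subtrees t" "t \<in> set ts" for u t
  proof (cases "t = T")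
    case True
    have "size u \<le> size t" if "u \<in> subtrees t" for u t :: "'a tree" using that by (induction t) auto
    then have "size u \<le> size T" using u(2) True by blast
    then show ?thesis using u(1) by auto
  next
    case False
    define ts' where "ts' = remove1 T ts"
    have ts': "mset ts = mset (T # ts')" using T by (simp add: ts'_def)
    have "t \<in> set ts'" using mset_eq_setD[OF ts'] u(3) False by auto
    then have "ids T \<inter> ids t = {}" using shared_disjoint shared shared_perm[OF ts'] by blast
    moreover have "ids u \<subseteq> ids t" using subtrees_ids u(2) by blast
    ultimately have "ids T \<inter> ids u = {}" by blast
    then show ?thesis using u(1) ids_ne[of T] by auto
  qed
  then show ?thesis using ab by blast
qed

text \<open>The induction measure; leaves count, so that removing a bottom root decreases
  it.\<close>

fun nodes :: "'a tree \<Rightarrow> nat" where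
  "nodes (Lf l n) = 1"
| "nodes (Tn a b) = Suc (nodes a + nodes b)"
| "nodes (Pr a b) = Suc (nodes a + nodes b)"

definition cuts_dual :: "'a root list \<Rightarrow> bool" where
  "cuts_dual rs \<longleftrightarrow> (\<forall>A B. RC A B \<in> set rs \<longrightarrow> is_dual A B)"

text \<open>Roots that are leaves admit every colouring. A par in the linking would leave its
  premises unconnected, so there is a single cluster, and without bottoms it is an axiom or a
  unit.\<close>

lemma leaf_roots_seqz:
  fixes N :: "'a tree"
  assumes normal: "normal N" and net: "net N (map rtree rs)"
    and leaf: "\<And>r. r \<in> set rs \<Longrightarrow> \<exists>l n. r = RF (Lf l n) \<and> l \<noteq> LB"
  shows "seqz N rs"
proof -
  define f where "f = (\<lambda>(l, n). RF (Lf l n) :: 'a root)"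
  have shared: "mset (leaves N) = mset (concat (map leaves (map rtree rs)))" and corr: "corr N (map rtree rs)"
    using net by (auto simp: net_def shared_iff)
  have "map f (concat (map leaves (map rtree rs))) = rs"
    using leaf by (induction rs) (fastforce simp: f_def)+
  then have rs: "mset rs = image_mset f (mset (leaves N))"
    unfolding shared by (metis mset_map)
  have noLB: "(LB, n) \<notin> set (leaves N)" for n
  proof
    assume "(LB, n) \<in> set (leaves N)"
    then have "f (LB, n) \<in># image_mset f (mset (leaves N))" by auto
    then have "f (LB, n) \<in> set rs" unfolding rs[symmetric] by simp
    then show False using leaf[of "f (LB, n)"] by (auto simp: f_def)
  qed
  from normal show ?thesis
  proof cases
    case normal_cluster
    then show ?thesis
    proof cases
      case (1 n)
      then show ?thesis using rs sq_exch[OF sq_one[of n], of rs] by (simp add: f_def)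
    next
      case (2 a m n)
      have "m \<noteq> n" using net 2 by (auto simp: net_def shared_def)
      then show ?thesis using 2 rs sq_exch[OF sq_id[of m n a], of rs] by (simp add: f_def)
    next
      case (3 c n)
      then show ?thesis using noLB[of n] by simp
    qed
  next
    case (normal_Pr a b)
    have "ids a \<inter> ids b = {}" using net normal_Pr by (auto simp: net_def shared_def ids_def)
    have "col (ids a) a \<noteq> {}" using col_mono(1)[of a "ids a"] by simp
    moreover have "col (ids a) b \<noteq> {}"
      using col_mono(2)[of b "ids a"] \<open>ids a \<inter> ids b = {}\<close> by (simp add: Int_commute)
    ultimately have 1: "col (ids a) N \<noteq> {}" using normal_Pr by simp
    have "col (ids a) t \<noteq> {}" if "t \<in> set (map rtree rs)" for t using that leaf by fastforce
    from corrD[OF corr 1 this] have "ids N \<inter> ids a = {} \<or> ids N \<subseteq> ids a" by blast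
    then have "ids b \<subseteq> ids a" using normal_Pr ids_ne[of a] by auto
    then show ?thesis using \<open>ids a \<inter> ids b = {}\<close> ids_ne[of b] by blast
  qed
qed

text \<open>The induction runs over the sequent, because the linking is replaced by equivalent ones
  on the way. Pars and bottoms are inverted at once; splitting is attempted only when every
  remaining root is a tensor, a cut, an atom or a unit, or the bottom case would apply as
  well.\<close>

lemma sequentialization:
  "net P (map rtree rs) \<Longrightarrow> cuts_dual rs \<Longrightarrow> \<exists>P'. net_equiv (map rtree rs) P P' \<and> seqz P' rs"
proof (induction "sum_list (map (nodes \<circ> rtree) rs)" arbitrary: P rs rule: less_induct)
  case less
  note net = less.prems(1) and dual = less.prems(2)
  have size_perm: "sum_list (map (nodes \<circ> rtree) rs') = sum_list (map (nodes \<circ> rtree) rs)" if "mset rs' = mset rs" for rs' :: "'a root list"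
    using that by (metis mset_map sum_mset_sum_list)
  have exch: "\<exists>P'. net_equiv (map rtree rs) P P' \<and> seqz P' rs"
    if "mset rs' = mset rs" "net_equiv (map rtree rs') P P'" "seqz P' rs'" for rs' P'
    using that net_equiv_perm[of "map rtree rs'" "map rtree rs"] sq_exch[OF that(3), of rs] by (auto intro!: exI[of _ P'])
  have pick: "\<exists>ds. mset (r # ds) = mset rs \<and> net P (rtree r # map rtree ds) \<and> cuts_dual ds" if "r \<in> set rs" for r
  proof (intro exI[of _ "remove1 r rs"] conjI)
    show m: "mset (r # remove1 r rs) = mset rs" using that by simp
    have "mset (rtree r # map rtree (remove1 r rs)) = mset (map rtree rs)"
      using arg_cong[OF m, of "image_mset rtree"] by simp
    then show "net P (rtree r # map rtree (remove1 r rs))" using net net_perm by blast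
    show "cuts_dual (remove1 r rs)" using dual set_remove1_subset[of r rs] unfolding cuts_dual_def by blast
  qed
  consider (par) A B where "RF (Pr A B) \<in> set rs" | (bot) n where "RF (Lf LB n) \<in> set rs"
    | (tens) "\<And>A B. RF (Pr A B) \<notin> set rs" "\<exists>A B. Tn A B \<in> set (map rtree rs)"
    | (leaf) "\<And>A B. RF (Pr A B) \<notin> set rs" "\<And>n. RF (Lf LB n) \<notin> set rs" "\<And>A B. Tn A B \<notin> set (map rtree rs)"
    by blast
  then show ?case
  proof cases
    case (par A B)
    from pick[OF this] obtain ds where ds: "mset (RF (Pr A B) # ds) = mset rs" "net P (Pr A B # map rtree ds)"
      "cuts_dual ds" by auto
    let ?rs' = "RF A # RF B # ds"
    have lt: "sum_list (map (nodes \<circ> rtree) ?rs') < sum_list (map (nodes \<circ> rtree) rs)"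
      using size_perm[OF ds(1)] by simp
    have "net P (map rtree ?rs')" "cuts_dual ?rs'" using ds by (simp_all add: net_par cuts_dual_def)
    from less.hyps[OF lt this] obtain P' where P': "net_equiv (A # B # map rtree ds) P P'" "seqz P' ?rs'" by auto
    \<comment> \<open>By \<open>net_par\<close> both sequents have the same nets, hence the same
      equivalence.\<close>
    have "net_equiv (A # B # map rtree ds) = net_equiv (Pr A B # map rtree ds)" unfolding net_equiv_def net_par ..
    then show ?thesis using exch[OF ds(1), of P'] P'(1) sq_par[OF P'(2)] by simp
  next
    case (bot n)
    from pick[OF this] obtain ds where ds: "mset (RF (Lf LB n) # ds) = mset rs" "net P (Lf LB n # map rtree ds)"
      "cuts_dual ds" by auto
    from net_extract_bot[OF ds(2)] obtain P0 where P0: "net P0 (map rtree ds)" "n \<notin> ids P0"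
      "net_equiv (Lf LB n # map rtree ds) (Tn (Lf LB n) P0) P" by blast
    have lt: "sum_list (map (nodes \<circ> rtree) ds) < sum_list (map (nodes \<circ> rtree) rs)"
      using size_perm[OF ds(1)] by simp
    from less.hyps[OF lt P0(1) ds(3)] obtain P' where P': "net_equiv (map rtree ds) P0 P'" "seqz P' ds" by blast
    have idsQ: "ids Q = ids P0" if "net Q (map rtree ds)" for Q using net_ids[OF that] net_ids[OF P0(1)] by simp
    have "net_equiv (Lf LB n # map rtree ds) (Tn (Lf LB n) P0) (Tn (Lf LB n) P')"
      using P'(1) by (rule net_equiv_lift) (use idsQ P0(2) in \<open>auto intro: net_bot inward_cong\<close>)
    then have "net_equiv (Lf LB n # map rtree ds) P (Tn (Lf LB n) P')" using net_equiv_trans[OF net_equiv_sym[OF P0(3)]] by blast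
    moreover have "n \<notin> ids P'" using idsQ[OF net_equiv_net[OF P'(1) P0(1)]] P0(2) by simp
    then have "seqz (Tn (Lf LB n) P') (RF (Lf LB n) # ds)" using sq_bot[OF P'(2)] by blast
    ultimately show ?thesis using exch[OF ds(1)] by auto
  next
    case tens
    obtain N where N: "inwards P N" "normal N" using normal_exists net by (auto simp: net_def)
    have netN: "net N (map rtree rs)" by (rule inwards_net[OF N(1) net])
    have PN: "net_equiv (map rtree rs) P N" by (rule inwards_net_equiv[OF N(1) net])
    interpret cut_net N "map rtree rs"
    proof
      show "normal N" by (rule N(2))
      show "corr N (map rtree rs)" using netN by (simp add: net_def)
      show "ids N = (\<Union>t\<in>set (map rtree rs). ids t)" by (rule net_ids[OF netN])
      show "a \<noteq> T \<and> b \<noteq> T" if "T \<in> set (map rtree rs)"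
        "Tn a b \<in> (\<Union>t\<in>set (map rtree rs). subtrees t) \<or> Pr a b \<in> (\<Union>t\<in>set (map rtree rs). subtrees t)" for T a b
        using netN root_not_subtree[OF _ that] by (auto simp: net_def)
    qed
    have "Pr a b \<notin> set (map rtree rs)" for a b
    proof
      assume "Pr a b \<in> set (map rtree rs)"
      then obtain r where r: "r \<in> set rs" "rtree r = Pr a b" by auto
      have "r = RF (Pr a b)" using r(2) by (cases r) auto
      then show False using tens(1) r(1) by blast
    qed
    then obtain A B E where AB: "Tn A B \<in> set (map rtree rs)" "ids A \<subseteq> E" "ids B \<inter> E = {}"
      "\<forall>c\<in>clusters N. unsplit E c" "\<And>t. t \<in> set (map rtree rs) \<Longrightarrow> t \<noteq> Tn A B \<Longrightarrow> unsplit E (ids t)"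
      using splitting tens(2) by metis
    obtain r where r: "r \<in> set rs" "rtree r = Tn A B" using AB(1) by auto
    from pick[OF r(1)] obtain ds where ds: "mset (r # ds) = mset rs" "cuts_dual ds" by auto
    have mrt: "mset (map rtree rs) = mset (Tn A B # map rtree ds)"
      using arg_cong[OF ds(1), of "image_mset rtree"] r(2) by simp
    have unsplitds: "unsplit E (ids (rtree q))" if "q \<in> set ds" for q
    proof (rule AB(5))
      show "rtree q \<in> set (map rtree rs)" using that mset_eq_setD[OF ds(1)] by auto
      \<comment> \<open>\<open>splitting\<close> tells roots apart only as trees. Disjoint leaves
        ensure that no other root equals the splitting one.\<close>
      have "shared N (Tn A B # map rtree ds)" using netN shared_perm[OF mrt] by (simp add: net_def)
      then have "ids (Tn A B) \<inter> ids (rtree q) = {}" by (rule shared_disjoint) (use that in simp)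
      then show "rtree q \<noteq> Tn A B" using ids_ne[of A] by auto
    qed
    define ds1 where "ds1 = filter (\<lambda>q. ids (rtree q) \<subseteq> E) ds"
    define ds2 where "ds2 = filter (\<lambda>q. \<not> ids (rtree q) \<subseteq> E) ds"
    have mds: "mset ds = mset ds1 + mset ds2" unfolding ds1_def ds2_def by (simp add: multiset_partition[symmetric])
    have ds1: "\<forall>t\<in>set (map rtree ds1). ids t \<subseteq> E" by (auto simp: ds1_def)
    have ds2: "\<forall>t\<in>set (map rtree ds2). ids t \<inter> E = {}" using unsplitds by (auto simp: ds2_def unsplit_def)
    let ?ts = "Tn A B # map rtree ds1 @ map rtree ds2"
    have mts: "mset (map rtree rs) = mset ?ts" unfolding mrt using arg_cong[OF mds, of "image_mset rtree"] by simp
    have netN': "net N ?ts" using netN net_perm[OF mts] by blast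
    have "ids A \<subseteq> ids N" "ids B \<subseteq> ids N" using net_ids[OF netN'] by auto
    then have "\<not> ids N \<subseteq> E" "ids N \<inter> E \<noteq> {}" using AB(2,3) ids_ne[of A] ids_ne[of B] by blast+
    then obtain N1 N2 where N12: "inwards N (Pr N1 N2)" "normal N1" "normal N2" "ids N1 \<subseteq> E" "ids N2 \<inter> E = {}"
      using normal_split[OF N(2) AB(4)] by blast
    have net12: "net (Pr N1 N2) ?ts" by (rule inwards_net[OF N12(1) netN'])
    note nets = net_split[OF net12 N12(4) AB(2) ds1 N12(5) AB(3) ds2]
    have size: "sum_list (map (nodes \<circ> rtree) rs) = Suc (nodes A + nodes B) +
        (sum_list (map (nodes \<circ> rtree) ds1) + sum_list (map (nodes \<circ> rtree) ds2))"
    proof -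
      have "mset (r # ds1 @ ds2) = mset rs" using ds(1) mds by simp
      from size_perm[OF this] show ?thesis by (simp add: r(2))
    qed
    have lt1: "sum_list (map (nodes \<circ> rtree) (ds1 @ [RF A])) < sum_list (map (nodes \<circ> rtree) rs)"
      and lt2: "sum_list (map (nodes \<circ> rtree) (RF B # ds2)) < sum_list (map (nodes \<circ> rtree) rs)"
      unfolding size by simp_all
    have d1: "cuts_dual (ds1 @ [RF A])" and d2: "cuts_dual (RF B # ds2)"
      using ds(2) by (auto simp: cuts_dual_def ds1_def ds2_def)
    have p1: "mset (map rtree (ds1 @ [RF A])) = mset (A # map rtree ds1)" by simp
    have "net N1 (map rtree (ds1 @ [RF A]))" using nets(1) net_perm[OF p1] by blast
    from less.hyps[OF lt1 this d1] obtain N1' where N1': "net_equiv (A # map rtree ds1) N1 N1'" "seqz N1' (ds1 @ [RF A])"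
      unfolding net_equiv_perm[OF p1] by blast
    have "net N2 (map rtree (RF B # ds2))" using nets(2) by simp
    from less.hyps[OF lt2 this d2] obtain N2' where N2': "net_equiv (B # map rtree ds2) N2 N2'" "seqz N2' (RF B # ds2)"
      by auto
    have ids1: "ids Q = ids N1" if "net Q (A # map rtree ds1)" for Q using net_ids[OF that] net_ids[OF nets(1)] by simp
    have ids2: "ids Q = ids N2" if "net Q (B # map rtree ds2)" for Q using net_ids[OF that] net_ids[OF nets(2)] by simp
    have disj: "ids N1 \<inter> ids N2 = {}" using N12(4,5) by blast
    have net1': "net N1' (A # map rtree ds1)" by (rule net_equiv_net[OF N1'(1) nets(1)])
    have net2': "net N2' (B # map rtree ds2)" by (rule net_equiv_net[OF N2'(1) nets(2)])
    have "net_equiv ?ts N (Pr N1 N2)" by (rule inwards_net_equiv[OF N12(1) netN'])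
    \<comment> \<open>The premises are replaced one at a time, so that every intermediate graph is a
      net by \<open>net_tens\<close>.\<close>
    also have "net_equiv ?ts (Pr N1 N2) (Pr N1' N2)"
      by (rule net_equiv_lift[OF N1'(1), of "\<lambda>x. Pr x N2"])
        (use net_tens[OF _ nets(2)] ids1 disj inward_cong in auto)
    also have "net_equiv ?ts (Pr N1' N2) (Pr N1' N2')"
      by (rule net_equiv_lift[OF N2'(1), of "\<lambda>x. Pr N1' x"])
        (use net_tens[OF net1'] ids1[OF net1'] ids2 disj inward_cong in auto)
    finally have "net_equiv (map rtree rs) N (Pr N1' N2')" unfolding net_equiv_perm[OF mts] .
    then have P: "net_equiv (map rtree rs) P (Pr N1' N2')" by (rule net_equiv_trans[OF PN])
    have disj': "ids N1' \<inter> ids N2' = {}" using ids1[OF net1'] ids2[OF net2'] disj by simp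
    have "seqz (Pr N1' N2') (ds1 @ [r] @ ds2)"
    proof (cases r)
      case (RF t)
      then show ?thesis using sq_tens[OF N1'(2) N2'(2) disj'] r(2) by simp
    next
      case (RC a b)
      then have "is_dual A B" using dual r by (auto simp: cuts_dual_def)
      then show ?thesis using sq_cut[OF N1'(2) N2'(2) _ disj'] RC r(2) by simp
    qed
    moreover have "mset rs = mset (ds1 @ [r] @ ds2)" using ds(1) mds by simp
    ultimately have "seqz (Pr N1' N2') rs" by (rule sq_exch)
    then show ?thesis using P by blast
  next
    case leaf
    obtain N where N: "inwards P N" "normal N" using normal_exists net by (auto simp: net_def)
    have "\<exists>l n. r = RF (Lf l n) \<and> l \<noteq> LB" if "r \<in> set rs" for r
    proof (cases r)
      case (RF t)
      have "rtree r \<in> set (map rtree rs)" using that by simp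
      then show ?thesis using RF that leaf by (cases t) auto
    next
      case (RC a b)
      have "rtree r \<in> set (map rtree rs)" using that by simp
      then show ?thesis using RC leaf(3) by simp
    qed
    then have "seqz N rs" using leaf_roots_seqz[OF N(2) inwards_net[OF N(1) net]] by blast
    then show ?thesis using inwards_net_equiv[OF N(1) net] by blast
  qed
qed

theorem theorem1p13:
  fixes P :: "'a tree" and \<Gamma> :: "'a root list"
  assumes "pre_proof_graph P \<Gamma>"
  shows "sequentializable P \<Gamma> \<longleftrightarrow> correct P \<Gamma>"
proof -
  have shared: "shared P (map rtree \<Gamma>)" by (rule ppg_shared[OF assms])
  show ?thesis
    unfolding correct_corr[OF shared]
  proof
    assume "sequentializable P \<Gamma>"
    then obtain P' where P': "lk_equiv \<Gamma> P P'" "seqz P' \<Gamma>" by (auto simp: sequentializable_def)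
    then show "corr P (map rtree \<Gamma>)" using seqz_corr[OF P'(2)] lk_equiv_inv(2)[OF P'(1) shared] by blast
  next
    assume "corr P (map rtree \<Gamma>)"
    then have "net P (map rtree \<Gamma>)" using shared assms by (simp add: net_def pre_proof_graph_def)
    moreover have "cuts_dual \<Gamma>" using assms by (force simp: cuts_dual_def pre_proof_graph_def)
    ultimately obtain P' where "net_equiv (map rtree \<Gamma>) P P'" "seqz P' \<Gamma>" using sequentialization by blast
    then show "sequentializable P \<Gamma>" using net_equiv_lk_equiv by (auto simp: sequentializable_def)
  qed
qed

end
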